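(* The ring $B(2,P)/J(2,P)$ is a flat deformation of $\Bbbk[x_{[2]\times P}]/L(2,P)$ over the polynomial ring $B=\Bbbk[u_{\emptyset,\rho},u_{q,p}]$. That is, $B(2,P)/J(2,P)$ is flat over $B$, and under the map $B\to\Bbbk$ sending all $u$-variables to $0$, the natural map $B(2,P)\to\Bbbk[x_{[2]\times P}]$ induces an isomorphism $(B(2,P)/J(2,P))\otimes_B\Bbbk\cong\Bbbk[x_{[2]\times P}]/L(2,P)$.
   Context: Let $\Bbbk$ be a field and let $P$ be a finite poset whose Hasse diagram is a rooted tree with the root at the bottom: $P$ has a unique minimal element $\rho$ (the root), and every $p\neq\rho$ covers exactly one element, its parent. Write $a\prec b$ if $b$ covers $a$ ($a$ is the parent of $b$, $b$ is a child of $a$). Two elements are siblings if they have the same parent. For $p\in P$ and $i\in\{1,2\}$ there is a variable $x_{i,p}$, written $p_i$; $\Bbbk[x_{[2]\times P}]$ is the polynomial ring in these variables. $L(2,P)$ is the ideal of $\Bbbk[x_{[2]\times P}]$ generated by the monomials $p_1q_2$ for $p\le q$ in $P$. Let $B=\Bbbk[u_{\emptyset,\rho},u_{q,p}]$ be the polynomial ring in a variable $u_{\emptyset,\rho}$ and variables $u_{q,p}$, one for each pair $(q,p)$ in $P$ with $p\ne\rho$ such that the meet of $q$ and $p$ is the parent of $p$ (i.e. $q$ is the parent of $p$ or $q\ge c$ for a sibling $c\neq p$ of $p$). Let $B(2,P)=B\otimes_\Bbbk\Bbbk[x_{[2]\times P}]$. Polynomials $T$: for distinct siblings $b,c$ let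 $T_c(b)=-\sum_{q\ge c}q_2u_{q,b}$; if $a$ is the parent of $b$ let $T_a(b)=-a_2u_{a,b}$; let $T(b)=T_b(b)=-T_a(b)-\sum_cT_c(b)$, summing over siblings $c\ne b$ of $b$; and $T(\rho)=u_{\emptyset,\rho}$. Polynomials $D$ and $S$ in $B(2,P)$ are defined by induction on $\mathrm{depth}(a)$, the length of the longest chain upwards starting from $a$. Each $S_a$ is defined on the variables $b_2$ with $b\ge a$ and extended $B$-linearly to $B$-linear combinations of them; one writes $S_a(b)$ for $S_a(b_2)$. The following expressions are used: $S_bT_b(b):=b_1$; $S_aT_a(b):=-u_{a,b}$ if $a$ is the parent of $b$; $S_cT_c(b):=S_c(T_c(b))=-\sum_{q\ge c}u_{q,b}S_c(q)$ for distinct siblings $b,c$. If $a$ is maximal, $D(a)^a=1$ and $S_a(a)=1$. Otherwise let $b^1,\dots,b^m$ be the children of $a$, put $b^0=a$, and let $M(a)=[S_{b^i}T_{b^i}(b^j)]$ be the $m\times(m+1)$ matrix with column index $i=0,\dots,m$ and row index $j=1,\dots,m$; put $D(a)^{b^i}=(-1)^i|M(a)^{b^i}|$, where $M(a)^{b^i}$ is $M(a)$ with column $i$ deleted. For $a\le b$ let $R(a,b)=\prod_{a\le p\prec q\le b}D(p)^q$ (product over the covering relations between $a$ and $b$; $R(a,a)=1$), and $S_a(b_2)=R(a,b)\,D(b)^b$. $J(2,P)\subseteq B(2,P)$ is the ideal generated by $p_1q_2-T(p)S_p(q)$ for all $p\le q$ in $P$. *)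

theory Defs
  imports
    "HOL-Library.Poly_Mapping"
    "HOL-Algebra.QuotRing"
    "HOL-Algebra.Free_Abelian_Groups"
    "Jordan_Normal_Form.Determinant"
begin

section \<open>Tensor products and flatness\<close>

text \<open>
  The tensor product of two modules over \<open>R\<close> is the free abelian group on pairs modulo the
  usual bilinearity relations. The fields \<open>mult\<close> and \<open>one\<close> of a module record are those of an
  algebra; accordingly, the fields \<open>mult\<close> and \<open>one\<close> of \<open>tensor_product R M N\<close> are only meaningful
  when \<open>M\<close> and \<open>N\<close> are commutative \<open>R\<close>-algebras.
\<close>

definition tensor_free ::
  "('m, 'x) partial_object_scheme \<Rightarrow> ('n, 'y) partial_object_scheme \<Rightarrow> ('m \<times> 'n \<Rightarrow>\<^sub>0 int) monoid"
  where "tensor_free M N = free_Abelian_group (carrier M \<times> carrier N)"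

definition tensor_rel ::
  "('r, 'z) ring_scheme \<Rightarrow> ('r, 'm, 'x) module_scheme \<Rightarrow> ('r, 'n, 'y) module_scheme
    \<Rightarrow> ('m \<times> 'n \<Rightarrow>\<^sub>0 int) set"
  where "tensor_rel R M N = generate (tensor_free M N)
    ({frag_of (x \<oplus>\<^bsub>M\<^esub> x', y) - frag_of (x, y) - frag_of (x', y) | x x' y.
        x \<in> carrier M \<and> x' \<in> carrier M \<and> y \<in> carrier N} \<union>
     {frag_of (x, y \<oplus>\<^bsub>N\<^esub> y') - frag_of (x, y) - frag_of (x, y') | x y y'.
        x \<in> carrier M \<and> y \<in> carrier N \<and> y' \<in> carrier N} \<union>
     {frag_of (r \<odot>\<^bsub>M\<^esub> x, y) - frag_of (x, r \<odot>\<^bsub>N\<^esub> y) | r x y.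
        r \<in> carrier R \<and> x \<in> carrier M \<and> y \<in> carrier N})"

definition tensor_class ::
  "('r, 'z) ring_scheme \<Rightarrow> ('r, 'm, 'x) module_scheme \<Rightarrow> ('r, 'n, 'y) module_scheme
    \<Rightarrow> ('m \<times> 'n \<Rightarrow>\<^sub>0 int) \<Rightarrow> ('m \<times> 'n \<Rightarrow>\<^sub>0 int) set"
  where "tensor_class R M N t = tensor_rel R M N #>\<^bsub>tensor_free M N\<^esub> t"

definition pure_tensor ::
  "('r, 'z) ring_scheme \<Rightarrow> ('r, 'm, 'x) module_scheme \<Rightarrow> ('r, 'n, 'y) module_scheme
    \<Rightarrow> 'm \<Rightarrow> 'n \<Rightarrow> ('m \<times> 'n \<Rightarrow>\<^sub>0 int) set"
  where "pure_tensor R M N x y = tensor_class R M N (frag_of (x, y))"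

text \<open>
  A map of quotients induced by a map of representatives is written as a union over all
  representatives of the classes of their images (as in the definition of \<^const>\<open>rcoset_mult\<close>).
\<close>

definition tensor_product ::
  "('r, 'z) ring_scheme \<Rightarrow> ('r, 'm, 'x) module_scheme \<Rightarrow> ('r, 'n, 'y) module_scheme
    \<Rightarrow> ('r, ('m \<times> 'n \<Rightarrow>\<^sub>0 int) set) module"
  where "tensor_product R M N =
    \<lparr>carrier = carrier (tensor_free M N Mod tensor_rel R M N),
     monoid.mult = (\<lambda>X Y. \<Union>s\<in>X. \<Union>t\<in>Y. tensor_class R M N
       (frag_extend (\<lambda>(x, y). frag_extend (\<lambda>(x', y').
          frag_of (x \<otimes>\<^bsub>M\<^esub> x', y \<otimes>\<^bsub>N\<^esub> y')) t) s)),
     one = pure_tensor R M N \<one>\<^bsub>M\<^esub> \<one>\<^bsub>N\<^esub>,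
     ring.zero = \<one>\<^bsub>tensor_free M N Mod tensor_rel R M N\<^esub>,
     ring.add = (\<lambda>X Y. X \<otimes>\<^bsub>tensor_free M N Mod tensor_rel R M N\<^esub> Y),
     module.smult = (\<lambda>r X. \<Union>s\<in>X. tensor_class R M N
       (frag_extend (\<lambda>(x, y). frag_of (r \<odot>\<^bsub>M\<^esub> x, y)) s))\<rparr>"

definition linear_maps ::
  "('r, 'z) ring_scheme \<Rightarrow> ('r, 'm, 'x) module_scheme \<Rightarrow> ('r, 'n, 'y) module_scheme
    \<Rightarrow> ('m \<Rightarrow> 'n) set"
  where "linear_maps R M N = {f. f \<in> carrier M \<rightarrow> carrier N \<and>
    (\<forall>x\<in>carrier M. \<forall>y\<in>carrier M. f (x \<oplus>\<^bsub>M\<^esub> y) = f x \<oplus>\<^bsub>N\<^esub> f y) \<and>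
    (\<forall>r\<in>carrier R. \<forall>x\<in>carrier M. f (r \<odot>\<^bsub>M\<^esub> x) = r \<odot>\<^bsub>N\<^esub> f x)}"

definition tensor_map_left ::
  "('r, 'z) ring_scheme \<Rightarrow> ('r, 'm, 'x) module_scheme \<Rightarrow> ('r, 'n, 'y) module_scheme
    \<Rightarrow> ('l \<Rightarrow> 'm) \<Rightarrow> ('l \<times> 'n \<Rightarrow>\<^sub>0 int) set \<Rightarrow> ('m \<times> 'n \<Rightarrow>\<^sub>0 int) set"
  where "tensor_map_left R M N f X =
    (\<Union>s\<in>X. tensor_class R M N (frag_extend (\<lambda>(x, y). frag_of (f x, y)) s))"

text \<open>
  The functor \<open>_ \<otimes> M\<close> preserves injectivity of linear maps \<open>K \<rightarrow> N\<close>. As types cannot be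
  quantified inside a definition, the types \<open>'a\<close>, \<open>'b\<close> containing the carriers of \<open>K\<close> and \<open>N\<close> are
  parameters. Flatness of \<open>M\<close> is \<open>flat_module TYPE('a) TYPE('b) R M\<close> for arbitrary \<open>'a\<close> and \<open>'b\<close>,
  i.e. with these type variables free in the theorem.
\<close>

definition flat_module ::
  "'a itself \<Rightarrow> 'b itself \<Rightarrow> ('r, 'z) ring_scheme \<Rightarrow> ('r, 'm, 'x) module_scheme \<Rightarrow> bool"
  where "flat_module _ _ R M \<longleftrightarrow> module R M \<and>
    (\<forall>(K :: ('r, 'a) module) (N :: ('r, 'b) module). \<forall>f \<in> linear_maps R K N.
      module R K \<longrightarrow> module R N \<longrightarrow> inj_on f (carrier K) \<longrightarrow>
      inj_on (tensor_map_left R N M f) (carrier (tensor_product R K M)))"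

definition algebra_via :: "('r \<Rightarrow> 'a) \<Rightarrow> ('a, 'x) ring_scheme \<Rightarrow> ('r, 'a) module"
  where "algebra_via h A =
    \<lparr>carrier = carrier A, monoid.mult = (\<lambda>x y. x \<otimes>\<^bsub>A\<^esub> y), one = \<one>\<^bsub>A\<^esub>,
     ring.zero = \<zero>\<^bsub>A\<^esub>, ring.add = (\<lambda>x y. x \<oplus>\<^bsub>A\<^esub> y), module.smult = (\<lambda>r x. h r \<otimes>\<^bsub>A\<^esub> x)\<rparr>"


section \<open>Polynomials\<close>

type_synonym ('v, 'k) mpoly = "('v \<Rightarrow>\<^sub>0 nat) \<Rightarrow>\<^sub>0 'k"

definition Const :: "'k::comm_ring_1 \<Rightarrow> ('v, 'k) mpoly"
  where "Const c = Poly_Mapping.single 0 c"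

definition Var :: "'v \<Rightarrow> ('v, 'k::comm_ring_1) mpoly"
  where "Var v = Poly_Mapping.single (Poly_Mapping.single v 1) 1"

definition poly_eval ::
  "('k \<Rightarrow> 'r) \<Rightarrow> ('v \<Rightarrow> 'r) \<Rightarrow> ('v, 'k::comm_ring_1) mpoly \<Rightarrow> 'r::comm_ring_1"
  where "poly_eval h \<sigma> f = (\<Sum>m\<in>Poly_Mapping.keys f. h (Poly_Mapping.lookup f m) *
    (\<Prod>v\<in>Poly_Mapping.keys m. \<sigma> v ^ Poly_Mapping.lookup m v))"

definition ring_on :: "'a::comm_ring_1 set \<Rightarrow> 'a ring"
  where "ring_on C =
    \<lparr>carrier = C, monoid.mult = (\<lambda>x y. x * y), one = 1, ring.zero = 0, ring.add = (\<lambda>x y. x + y)\<rparr>"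

text \<open>The polynomial ring in the variables from the set \<open>V\<close>.\<close>

definition poly_ring :: "'v set \<Rightarrow> ('v, 'k::comm_ring_1) mpoly ring"
  where "poly_ring V = ring_on {f. \<forall>m\<in>Poly_Mapping.keys f. Poly_Mapping.keys m \<subseteq> V}"


section \<open>The deformation\<close>

definition covers :: "'p::order \<Rightarrow> 'p \<Rightarrow> bool" (infix \<open>\<lessdot>\<close> 50)
  where "a \<lessdot> b \<longleftrightarrow> a < b \<and> \<not> (\<exists>c. a < c \<and> c < b)"

text \<open>
  \<open>X1 p\<close> and \<open>X2 p\<close> are the variables $p_1$ and $p_2$, \<open>U_root\<close> is $u_{\emptyset,\rho}$ and \<open>U q p\<close>
  is $u_{q,p}$. Only the \<open>U q p\<close> with \<open>(q, p)\<close> admissible belong to the rings below.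
\<close>

datatype 'p tree_var = X1 'p | X2 'p | U_root | U 'p 'p

type_synonym ('p, 'k) tree_poly = "('p tree_var, 'k) mpoly"

definition x_vars :: "'p tree_var set"
  where "x_vars = range X1 \<union> range X2"

definition set_u_zero :: "('p, 'k::comm_ring_1) tree_poly \<Rightarrow> ('p, 'k) tree_poly"
  where "set_u_zero = poly_eval Const (\<lambda>v. if v \<in> x_vars then Var v else 0)"

definition L_ideal :: "('p::order, 'k::comm_ring_1) tree_poly set"
  where "L_ideal = Idl\<^bsub>poly_ring x_vars\<^esub> {Var (X1 p) * Var (X2 q) | p q. p \<le> q}"

definition det_fun :: "nat \<Rightarrow> (nat \<Rightarrow> nat \<Rightarrow> 'a) \<Rightarrow> 'a::comm_ring_1"
  where "det_fun n A = det (mat n n (\<lambda>(j, k). A j k))"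

lemma det_fun_cong [fundef_cong]:
  assumes "n = n'" and "\<And>j k. j < n' \<Longrightarrow> k < n' \<Longrightarrow> A j k = A' j k"
  shows "det_fun n A = det_fun n' A'"
  unfolding det_fun_def using assms by (intro arg_cong[where f = det] cong_mat) auto

text \<open>The list \<open>ch a\<close> enumerates the children of \<open>a\<close>, in any order.\<close>

locale rooted_tree =
  fixes \<rho> :: "'p::{finite, order}" and ch :: "'p \<Rightarrow> 'p list"
  assumes minimal_iff: "(\<nexists>q. q < p) \<longleftrightarrow> p = \<rho>"
    and ex1_parent: "p \<noteq> \<rho> \<Longrightarrow> \<exists>!a. a \<lessdot> p"
    and set_ch: "set (ch a) = {b. a \<lessdot> b}"
    and distinct_ch: "distinct (ch a)"
begin

definition parent :: "'p \<Rightarrow> 'p"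
  where "parent p = (THE a. a \<lessdot> p)"

definition siblings :: "'p \<Rightarrow> 'p set"
  where "siblings b = {c. parent b \<lessdot> c \<and> c \<noteq> b}"

text \<open>A pair \<open>(q, p)\<close> indexes a variable if \<open>p \<noteq> \<rho>\<close> and the meet of \<open>q\<close> and \<open>p\<close> is the parent of \<open>p\<close>.\<close>

definition u_vars :: "'p tree_var set"
  where "u_vars = insert U_root
    {U q p | q p. p \<noteq> \<rho> \<and> (\<forall>z. z \<le> parent p \<longleftrightarrow> z \<le> q \<and> z \<le> p)}"

lemma parent_covers: "p \<noteq> \<rho> \<Longrightarrow> parent p \<lessdot> p"
  unfolding parent_def by (rule theI') (rule ex1_parent)

lemma parent_eqI: "a \<lessdot> p \<Longrightarrow> parent p = a"
  using ex1_parent[of p] parent_covers[of p] minimal_iff[of p] unfolding covers_def by blast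

lemma le_parent:
  assumes "z < p"
  shows "z \<le> parent p"
proof -
  let ?A = "{d. z \<le> d \<and> d < p}"
  have "finite ?A" "?A \<noteq> {}" using assms by auto
  then obtain d where d: "d \<in> ?A" "\<And>e. e \<in> ?A \<Longrightarrow> d \<le> e \<Longrightarrow> d = e"
    using finite_has_maximal[of ?A] by blast
  have "\<not> (\<exists>e. d < e \<and> e < p)"
  proof
    assume "\<exists>e. d < e \<and> e < p"
    then obtain e where e: "d < e" "e < p" by blast
    have "e \<in> ?A" using d(1) e by auto
    then show False using d(2)[of e] e(1) by (simp add: less_imp_le)
  qed
  then have "d \<lessdot> p" using d(1) unfolding covers_def by auto
  then show ?thesis using parent_eqI d(1) by blast
qed

lemma covers_between:
  fixes a q :: 'p
  assumes "a < q"
  obtains c where "a \<lessdot> c" "c \<le> q"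
proof -
  let ?A = "{d. a < d \<and> d \<le> q}"
  have "finite ?A" "?A \<noteq> {}" using assms by auto
  then obtain c where c: "c \<in> ?A" "\<And>e. e \<in> ?A \<Longrightarrow> e \<le> c \<Longrightarrow> c = e"
    using finite_has_minimal[of ?A] by blast
  have "\<not> (\<exists>e. a < e \<and> e < c)"
  proof
    assume "\<exists>e. a < e \<and> e < c"
    then obtain e where e: "a < e" "e < c" by blast
    have "e \<in> ?A" using c(1) e by auto
    then show False using c(2)[of e] e(2) by (simp add: less_imp_le)
  qed
  then show ?thesis using that[of c] c(1) unfolding covers_def by auto
qed

lemma comparable_below:
  fixes q :: 'p
  shows "x \<le> q \<Longrightarrow> y \<le> q \<Longrightarrow> x \<le> y \<or> y \<le> x"
proof (induction "card {..q}" arbitrary: q rule: less_induct)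
  case less
  show ?case
  proof (cases "x = q \<or> y = q")
    case False
    then have "x < q" "y < q" using less.prems by auto
    then have le: "x \<le> parent q" "y \<le> parent q" using le_parent by auto
    have "parent q < q"
      using parent_covers[of q] minimal_iff[of q] \<open>x < q\<close> unfolding covers_def by blast
    then have "{..parent q} \<subset> {..q}" by (auto intro: less_imp_le)
    then have "card {..parent q} < card {..q}" by (intro psubset_card_mono) auto
    then show ?thesis using less.hyps le by blast
  qed (use less.prems in auto)
qed

lemma u_vars_iff_sibling:
  assumes "p \<noteq> \<rho>"
  shows "U q p \<in> u_vars \<longleftrightarrow> q = parent p \<or> (\<exists>c\<in>siblings p. c \<le> q)"
proof -
  have par: "parent p \<lessdot> p" using parent_covers assms .
  then have lt: "parent p < p" unfolding covers_def by blast
  have "(\<forall>z. z \<le> parent p \<longleftrightarrow> z \<le> q \<and> z \<le> p) \<longleftrightarrow> q = parent p \<or> (\<exists>c\<in>siblings p. c \<le> q)"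
  proof (intro iffI)
    assume meet: "\<forall>z. z \<le> parent p \<longleftrightarrow> z \<le> q \<and> z \<le> p"
    show "q = parent p \<or> (\<exists>c\<in>siblings p. c \<le> q)"
    proof (cases "q = parent p")
      case False
      then have "parent p < q" using meet by (metis order_refl order_less_le)
      then obtain c where c: "parent p \<lessdot> c" "c \<le> q" using covers_between by blast
      have "c \<noteq> p" using c(2) meet lt by (metis order_refl leD)
      then show ?thesis using c unfolding siblings_def by blast
    qed blast
  next
    assume "q = parent p \<or> (\<exists>c\<in>siblings p. c \<le> q)"
    then show "\<forall>z. z \<le> parent p \<longleftrightarrow> z \<le> q \<and> z \<le> p"
    proof
      assume "q = parent p"
      then show ?thesis using lt by (auto intro: order_trans)
    next
      assume "\<exists>c\<in>siblings p. c \<le> q"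
      then obtain c where c: "parent p \<lessdot> c" "c \<noteq> p" "c \<le> q" unfolding siblings_def by blast
      have "\<not> p \<le> q"
      proof
        assume "p \<le> q"
        then have "c < p \<or> p < c" using comparable_below[OF c(3), of p] c(2) by (auto simp: order_less_le)
        then show False using par c(1) unfolding covers_def by blast
      qed
      moreover have "parent p \<le> q" using c unfolding covers_def by auto
      ultimately show ?thesis using lt le_parent
        by (metis order_less_le order_trans)
    qed
  qed
  then show ?thesis using assms unfolding u_vars_def by auto
qed

text \<open>\<open>T_part c b\<close> is $T_c(b)$ for \<open>c\<close> the parent or a sibling of \<open>b\<close>.\<close>

definition T_part :: "'p \<Rightarrow> 'p \<Rightarrow> ('p, 'k::comm_ring_1) tree_poly"
  where "T_part c b =
    (if c = parent b then - Var (X2 c) * Var (U c b)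
     else - (\<Sum>q\<in>{c..}. Var (X2 q) * Var (U q b)))"

definition T :: "'p \<Rightarrow> ('p, 'k::comm_ring_1) tree_poly"
  where "T b =
    (if b = \<rho> then Var U_root
     else - T_part (parent b) b - (\<Sum>c\<in>siblings b. T_part c b))"

text \<open>
  \<open>D a b\<close> is $D(a)^b$ for \<open>b = a\<close> or \<open>b\<close> a child of \<open>a\<close>, and \<open>S a b\<close> is $S_a(b)$, for \<open>a \<le> b\<close>.
  With $(b^0,\dots,b^m)$ the list \<open>a # ch a\<close>, the row index $j=1,\dots,m$ is shifted to \<open>0..<m\<close>
  and column \<open>i\<close> is skipped. The entry in column \<open>c\<close> of the row of \<open>b'\<close> is $S_cT_c(b')$.
\<close>

function D :: "'p \<Rightarrow> 'p \<Rightarrow> ('p, 'k::comm_ring_1) tree_poly"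
  and S :: "'p \<Rightarrow> 'p \<Rightarrow> ('p, 'k) tree_poly"
  where
    "D a b = (if ch a = [] then 1 else
      (let i = (LEAST i. (a # ch a) ! i = b) in
        (-1) ^ i * det_fun (length (ch a)) (\<lambda>j k.
          (let c = (a # ch a) ! (if k < i then k else Suc k); b' = ch a ! j in
            if c = b' then Var (X1 b')
            else if c = a then - Var (U a b')
            else - (\<Sum>q\<in>{c..}. Var (U q b') * S c q)))))"
  | "S a b = (if a \<le> b
      then (\<Prod>(p, q)\<in>{(p, q). a \<le> p \<and> p \<lessdot> q \<and> q \<le> b}. D p q) * D b b
      else 0)"
  by pat_completeness auto
termination
proof (relation "measure (case_sum (\<lambda>(a, b). 2 * card {a..}) (\<lambda>(a, b). 2 * card {a..} + 1))")
  have less: "card {c..} < card {a..}" if "a < c" for a c :: 'p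
    using that by (intro psubset_card_mono) (auto intro: order_trans less_imp_le)
  have le: "card {c..} \<le> card {a..}" if "a \<le> c" for a c :: 'p
    using that by (intro card_mono) (auto intro: order_trans)
  show "(Inr (c, q), Inl (a, b))
      \<in> measure (case_sum (\<lambda>(a, b). 2 * card {a..}) (\<lambda>(a, b). 2 * card {a..} + 1))"
    if "ch a \<noteq> []" "i = (LEAST i. (a # ch a) ! i = b)" "k < length (ch a)"
      "c = (a # ch a) ! (if k < i then k else Suc k)" "c \<noteq> a"
    for a b c q :: 'p and i k
  proof -
    have "c \<in> set (a # ch a)" using that(3,4) by (auto simp: nth_Cons split: nat.split)
    then have "a < c" using that(5) set_ch unfolding covers_def by auto
    then have "card {c..} < card {a..}" by (rule less)
    then show ?thesis by simp
  qed
  show "(Inl (p, q), Inr (a, b))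
      \<in> measure (case_sum (\<lambda>(a, b). 2 * card {a..}) (\<lambda>(a, b). 2 * card {a..} + 1))"
    if "x \<in> {(p, q). a \<le> p \<and> p \<lessdot> q \<and> q \<le> b}" "(p, q) = x" for a b p q :: 'p and x
    using that le[of a p] by auto
  show "(Inl (b, b), Inr (a, b))
      \<in> measure (case_sum (\<lambda>(a, b). 2 * card {a..}) (\<lambda>(a, b). 2 * card {a..} + 1))"
    if "a \<le> b" for a b :: 'p
    using le[OF that] by simp
qed simp

definition J_ideal :: "('p, 'k::comm_ring_1) tree_poly set"
  where "J_ideal = Idl\<^bsub>poly_ring (u_vars \<union> x_vars)\<^esub>
    {Var (X1 p) * Var (X2 q) - T p * S p q | p q. p \<le> q}"

definition B_ring :: "('p, 'k::comm_ring_1) tree_poly ring"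
  where "B_ring = poly_ring u_vars"

text \<open>$B(2,P)/J(2,P)$ and the base field as algebras over $B$.\<close>

definition deformation :: "(('p, 'k::comm_ring_1) tree_poly, ('p, 'k) tree_poly set) module"
  where "deformation =
    algebra_via (\<lambda>b. J_ideal +>\<^bsub>poly_ring (u_vars \<union> x_vars)\<^esub> b)
      (poly_ring (u_vars \<union> x_vars) Quot J_ideal)"

definition residue_field :: "(('p, 'k::comm_ring_1) tree_poly, 'k) module"
  where "residue_field = algebra_via (poly_eval (\<lambda>c. c) (\<lambda>_. 0)) (ring_on UNIV)"

end

end

theory Submission
  imports Defs
begin

text \<open>
  Call a monomial standard if it is divisible by no $p_1q_2$ with \<open>p \<le> q\<close>. The reason for flatness is
  that the standard monomials in the \<open>x\<close>-variables form a basis of $B(2,P)/J(2,P)$ over \<open>B\<close>; in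
  particular coordinates exist, and a module with coordinates is flat (\<open>dual_basis_imp_flat\<close>). The
  special fibre is easier: every $T(p)$ lies in the ideal of the \<open>u\<close>-variables, so setting these to
  zero turns the generators $p_1q_2 - T(p)S_p(q)$ into $p_1q_2$, and everything divisible by a
  \<open>u\<close>-variable dies in the tensor product with the base field (\<open>special_fibre\<close>).

  The basis comes from rewriting $p_1q_2$ to $T(p)S_p(q)$. Give $q_2$ and $u_{q,p}$ degree 1,
  $u_{\emptyset,\rho}$ degree 2, and $p_1$ the number of elements above \<open>p\<close>, including \<open>p\<close>, as its degree.
  Then column \<open>c\<close> of the matrix $M(a)$ is homogeneous, of the degree of $c_1$ if \<open>c\<close> is a child of \<open>a\<close> and
  of degree 1 if \<open>c = a\<close>, and it follows that all generators are homogeneous (\<open>hom_D_S\<close>, \<open>gen_hom\<close>).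
  As each term of $T(p)S_p(q)$ contains a \<open>u\<close>-variable, rewriting lowers the degree in the
  \<open>x\<close>-variables. So it terminates, and the standard monomials span (\<open>std_exists\<close>).

  They are independent by an argument in the style of Buchberger
  (\<open>standard_monomials_independent\<close>): it suffices that each S-polynomial of two generators is a
  combination of products of generators with monomials whose leading terms have lower degree in the
  \<open>x\<close>-variables. By homogeneity this holds for every combination whose coefficients lie in the ideal
  of the \<open>u\<close>-variables (\<open>JU_lower\<close>), which leaves purely algebraic claims. There are three kinds of
  S-polynomials.

  \<^item> Coprime leading monomials are trivial, again because $T(p)$ lies in that ideal.

  \<^item> For $p_1q_2$ and $p'_1q_2$ with \<open>p < p'\<close>, use that $S_p$ is a multiple of $S_{p'}$ above \<open>p'\<close>, and that
    $S_a(T(b)) = b_1 D(a)^b$ for \<open>b\<close> a child of \<open>a\<close> (\<open>S_T\<close>). The latter says that \<open>M(a)\<close> kills the vector of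
    its signed maximal minors.

  \<^item> For $p_1q_2$ and $p_1q'_2$ the S-polynomial is $T(p)$ times $q_2S_p(q') - q'_2S_p(q)$, and the second
    factor lies in the ideal \<open>J\<close> of the generators (\<open>S_exchange\<close>). By induction on the tree, each column
    of \<open>M(p)\<close> is proportional modulo \<open>J\<close> to the column of the $T_c(b)$, which add up to zero over \<open>c\<close>
    because $T(b) = -\sum_{c \neq b} T_c(b)$. A lemma on determinants (\<open>signed_minor_exchange\<close>) turns this
    into the proportionality of the minors.
\<close>

abbreviation keys :: "('a \<Rightarrow>\<^sub>0 'b::zero) \<Rightarrow> 'a set"
  where "keys \<equiv> Poly_Mapping.keys"

abbreviation lookup :: "('a \<Rightarrow>\<^sub>0 'b::zero) \<Rightarrow> 'a \<Rightarrow> 'b"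
  where "lookup \<equiv> Poly_Mapping.lookup"

section \<open>Tensor products and flatness\<close>

locale module_pair = M: module R M + N: module R N
  for R :: "('r, 'z) ring_scheme" and M :: "('r, 'm, 'x) module_scheme"
    and N :: "('r, 'n, 'y) module_scheme"
begin

abbreviation "rel \<equiv> tensor_rel R M N"
abbreviation "cls \<equiv> tensor_class R M N"
abbreviation "frags \<equiv> {t :: 'm \<times> 'n \<Rightarrow>\<^sub>0 int. keys t \<subseteq> carrier M \<times> carrier N}"

lemma frags_add: "s \<in> frags \<Longrightarrow> t \<in> frags \<Longrightarrow> s + t \<in> frags"
  using Poly_Mapping.keys_add[of s t] by blast

lemma frags_uminus: "s \<in> frags \<Longrightarrow> - s \<in> frags"
  by simp

lemma frags_diff: "s \<in> frags \<Longrightarrow> t \<in> frags \<Longrightarrow> s - t \<in> frags"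
  using keys_diff[of s t] by blast

lemma frags_frag_of: "x \<in> carrier M \<Longrightarrow> y \<in> carrier N \<Longrightarrow> frag_of (x, y) \<in> frags"
  by simp

lemma carrier_tensor_free: "carrier (tensor_free M N) = frags"
  unfolding tensor_free_def free_Abelian_group_def by simp

lemma mult_tensor_free: "s \<otimes>\<^bsub>tensor_free M N\<^esub> t = s + t"
  unfolding tensor_free_def free_Abelian_group_def by simp

definition gens :: "('m \<times> 'n \<Rightarrow>\<^sub>0 int) set"
  where "gens =
    {frag_of (x \<oplus>\<^bsub>M\<^esub> x', y) - frag_of (x, y) - frag_of (x', y) | x x' y.
        x \<in> carrier M \<and> x' \<in> carrier M \<and> y \<in> carrier N} \<union>
     {frag_of (x, y \<oplus>\<^bsub>N\<^esub> y') - frag_of (x, y) - frag_of (x, y') | x y y'.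
        x \<in> carrier M \<and> y \<in> carrier N \<and> y' \<in> carrier N} \<union>
     {frag_of (r \<odot>\<^bsub>M\<^esub> x, y) - frag_of (x, r \<odot>\<^bsub>N\<^esub> y) | r x y.
        r \<in> carrier R \<and> x \<in> carrier M \<and> y \<in> carrier N}"

lemma rel_eq: "rel = generate (tensor_free M N) gens"
  unfolding gens_def tensor_rel_def ..

lemma gens_cases [consumes 1, case_names add_left add_right smult]:
  assumes "h \<in> gens"
  obtains
      x x' y where "h = frag_of (x \<oplus>\<^bsub>M\<^esub> x', y) - frag_of (x, y) - frag_of (x', y)"
        "x \<in> carrier M" "x' \<in> carrier M" "y \<in> carrier N"
    | x y y' where "h = frag_of (x, y \<oplus>\<^bsub>N\<^esub> y') - frag_of (x, y) - frag_of (x, y')"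
        "x \<in> carrier M" "y \<in> carrier N" "y' \<in> carrier N"
    | r x y where "h = frag_of (r \<odot>\<^bsub>M\<^esub> x, y) - frag_of (x, r \<odot>\<^bsub>N\<^esub> y)"
        "r \<in> carrier R" "x \<in> carrier M" "y \<in> carrier N"
  using assms unfolding gens_def by (elim UnE CollectE exE conjE) blast+

lemma gens_subset: "gens \<subseteq> frags"
proof
  fix h assume "h \<in> gens"
  then show "h \<in> frags"
  proof (cases rule: gens_cases)
    case (add_left x x' y)
    show ?thesis unfolding add_left(1)
      by (intro frags_diff frags_frag_of M.add.m_closed add_left)
  next
    case (add_right x y y')
    show ?thesis unfolding add_right(1)
      by (intro frags_diff frags_frag_of N.add.m_closed add_right)
  next
    case (smult r x y)
    show ?thesis unfolding smult(1)
      by (intro frags_diff frags_frag_of M.smult_closed N.smult_closed smult)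
  qed
qed

text \<open>
  The relations are a subgroup given by generators; most facts about them need only be checked on the
  three kinds of generators.
\<close>

lemma rel_induct [consumes 1, case_names gen zero add uminus]:
  assumes "t \<in> rel"
    and "\<And>h. h \<in> gens \<Longrightarrow> P h"
    and "P 0"
    and "\<And>s t. s \<in> frags \<Longrightarrow> t \<in> frags \<Longrightarrow> P s \<Longrightarrow> P t \<Longrightarrow> P (s + t)"
    and "\<And>s. s \<in> frags \<Longrightarrow> P s \<Longrightarrow> P (- s)"
  shows "P t \<and> t \<in> frags"
  using assms(1) unfolding rel_eq
proof (induction rule: generate.induct)
  case one
  then show ?case using assms(3) by (simp add: tensor_free_def)
next
  case (incl h)
  then show ?case using assms(2) gens_subset by blast
next
  case (inv h)
  then have "h \<in> frags" using gens_subset by blast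
  moreover then have "inv\<^bsub>tensor_free M N\<^esub> h = - h" unfolding tensor_free_def by simp
  ultimately show ?case using inv assms(2,5) frags_uminus by metis
next
  case (eng s t)
  then show ?case using assms(4) frags_add unfolding mult_tensor_free by blast
qed

lemma rel_subset: "t \<in> rel \<Longrightarrow> t \<in> frags"
  using rel_induct[of t "\<lambda>_. True"] by blast

lemma rel_zero: "0 \<in> rel"
  using generate.one[of "tensor_free M N"] unfolding tensor_rel_def by (simp add: tensor_free_def)

lemma rel_add: "s \<in> rel \<Longrightarrow> t \<in> rel \<Longrightarrow> s + t \<in> rel"
  using generate.eng[of s "tensor_free M N" gens t] unfolding mult_tensor_free rel_eq .

lemma rel_subgroup: "subgroup rel (tensor_free M N)"
  unfolding rel_eq
  by (rule group.generate_is_subgroup)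
    (use gens_subset in \<open>simp_all only: carrier_tensor_free, simp add: tensor_free_def\<close>)

lemma rel_uminus: "s \<in> rel \<Longrightarrow> - s \<in> rel"
  using subgroup.m_inv_closed[OF rel_subgroup, of s] rel_subset[of s] by (simp add: tensor_free_def)

lemma rel_diff: "s \<in> rel \<Longrightarrow> t \<in> rel \<Longrightarrow> s - t \<in> rel"
  using rel_add[of s "- t"] rel_uminus by simp

lemma rel_sum: "(\<And>i. i \<in> I \<Longrightarrow> f i \<in> rel) \<Longrightarrow> (\<Sum>i\<in>I. f i) \<in> rel"
  by (induction I rule: infinite_finite_induct) (auto intro: rel_add rel_zero)

lemma rel_gens: "h \<in> gens \<Longrightarrow> h \<in> rel"
  unfolding rel_eq by (rule generate.incl)

lemma rel_add_left:
  "x \<in> carrier M \<Longrightarrow> x' \<in> carrier M \<Longrightarrow> y \<in> carrier N \<Longrightarrow>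
    frag_of (x \<oplus>\<^bsub>M\<^esub> x', y) - frag_of (x, y) - frag_of (x', y) \<in> rel"
  by (rule rel_gens) (unfold gens_def, blast)

lemma rel_add_right:
  "x \<in> carrier M \<Longrightarrow> y \<in> carrier N \<Longrightarrow> y' \<in> carrier N \<Longrightarrow>
    frag_of (x, y \<oplus>\<^bsub>N\<^esub> y') - frag_of (x, y) - frag_of (x, y') \<in> rel"
  by (rule rel_gens) (unfold gens_def, blast)

lemma rel_smult:
  "r \<in> carrier R \<Longrightarrow> x \<in> carrier M \<Longrightarrow> y \<in> carrier N \<Longrightarrow>
    frag_of (r \<odot>\<^bsub>M\<^esub> x, y) - frag_of (x, r \<odot>\<^bsub>N\<^esub> y) \<in> rel"
  by (rule rel_gens) (unfold gens_def, blast)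

lemma rel_zero_left: "y \<in> carrier N \<Longrightarrow> frag_of (\<zero>\<^bsub>M\<^esub>, y) \<in> rel"
  using rel_uminus[OF rel_add_left[of "\<zero>\<^bsub>M\<^esub>" "\<zero>\<^bsub>M\<^esub>" y]] by simp

lemma rel_zero_right: "x \<in> carrier M \<Longrightarrow> frag_of (x, \<zero>\<^bsub>N\<^esub>) \<in> rel"
  using rel_uminus[OF rel_add_right[of x "\<zero>\<^bsub>N\<^esub>" "\<zero>\<^bsub>N\<^esub>"]] by simp

lemma mem_cls_iff: "s \<in> cls t \<longleftrightarrow> s - t \<in> rel"
  unfolding tensor_class_def r_coset_def mult_tensor_free
  by (metis (no_types, lifting) UN_iff add_diff_cancel diff_add_cancel singleton_iff)

lemma cls_eqI:
  assumes "s - t \<in> rel"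
  shows "cls s = cls t"
proof -
  have "u - s \<in> rel \<longleftrightarrow> u - t \<in> rel" for u
    using rel_add[of "u - s" "s - t"] rel_diff[of "u - t" "s - t"] assms by auto
  then show ?thesis by (auto simp: mem_cls_iff)
qed

lemma cls_eq_iff: "cls s = cls t \<longleftrightarrow> s - t \<in> rel"
  using cls_eqI mem_cls_iff[of s s] rel_zero by (auto simp: mem_cls_iff)

lemma carrier_tensor_product: "carrier (tensor_product R M N) = cls ` frags"
  unfolding tensor_product_def FactGroup_def RCOSETS_def tensor_class_def
  by (auto simp: carrier_tensor_free)

text \<open>
  Maps out of a tensor product are unions over all representatives of a class; if the class of the
  image does not depend on the representative, a single one suffices.
\<close>

lemma UN_cls:
  assumes "\<And>s. s \<in> cls t \<Longrightarrow> F s = F t"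
  shows "(\<Union>s\<in>cls t. F s) = F t"
proof -
  have "t \<in> cls t" using rel_zero by (simp add: mem_cls_iff)
  then show ?thesis using assms by blast
qed

lemma add_tensor_product: "cls s \<oplus>\<^bsub>tensor_product R M N\<^esub> cls t = cls (s + t)"
proof -
  have "u \<in> cls s <#>\<^bsub>tensor_free M N\<^esub> cls t \<longleftrightarrow> u \<in> cls (s + t)" for u
    unfolding set_mult_def mult_tensor_free
  proof
    assume "u \<in> cls (s + t)"
    then have "u - t \<in> cls s" "t \<in> cls t" using rel_zero by (auto simp: mem_cls_iff algebra_simps)
    then show "u \<in> (\<Union>h\<in>cls s. \<Union>k\<in>cls t. {h + k})" by force
  next
    assume "u \<in> (\<Union>h\<in>cls s. \<Union>k\<in>cls t. {h + k})"
    then obtain h k where "h \<in> cls s" "k \<in> cls t" "u = h + k" by blast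
    then show "u \<in> cls (s + t)" using rel_add[of "h - s" "k - t"]
      by (simp add: mem_cls_iff algebra_simps)
  qed
  then show ?thesis unfolding tensor_product_def FactGroup_def by auto
qed


text \<open>
  The universal property of the tensor product. It is the only way in which elements of a tensor
  product will be shown to be distinct.
\<close>

lemma balanced_map_extends:
  assumes "comm_group G"
    and closed: "\<And>x y. x \<in> carrier M \<Longrightarrow> y \<in> carrier N \<Longrightarrow> f x y \<in> carrier G"
    and left: "\<And>x x' y. x \<in> carrier M \<Longrightarrow> x' \<in> carrier M \<Longrightarrow> y \<in> carrier N \<Longrightarrow>
      f (x \<oplus>\<^bsub>M\<^esub> x') y = f x y \<otimes>\<^bsub>G\<^esub> f x' y"
    and right: "\<And>x y y'. x \<in> carrier M \<Longrightarrow> y \<in> carrier N \<Longrightarrow> y' \<in> carrier N \<Longrightarrow>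
      f x (y \<oplus>\<^bsub>N\<^esub> y') = f x y \<otimes>\<^bsub>G\<^esub> f x y'"
    and balanced: "\<And>r x y. r \<in> carrier R \<Longrightarrow> x \<in> carrier M \<Longrightarrow> y \<in> carrier N \<Longrightarrow>
      f (r \<odot>\<^bsub>M\<^esub> x) y = f x (r \<odot>\<^bsub>N\<^esub> y)"
  obtains h where "group_hom (tensor_free M N) G h"
    and "\<And>x y. x \<in> carrier M \<Longrightarrow> y \<in> carrier N \<Longrightarrow> h (frag_of (x, y)) = f x y"
    and "\<And>t. t \<in> rel \<Longrightarrow> h t = \<one>\<^bsub>G\<^esub>"
proof -
  interpret G: comm_group G by fact
  obtain h where hom: "h \<in> hom (tensor_free M N) G"
    and h: "\<And>z. z \<in> carrier M \<times> carrier N \<Longrightarrow> h (frag_of z) = case_prod f z"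
  proof (rule G.free_Abelian_group_universal)
    show "case_prod f ` (carrier M \<times> carrier N) \<subseteq> carrier G" using closed by auto
  qed (simp add: tensor_free_def)
  interpret h: group_hom "tensor_free M N" G h
    using hom G.is_group by (simp add: group_hom_def group_hom_axioms_def tensor_free_def)
  have add: "h (s + t) = h s \<otimes>\<^bsub>G\<^esub> h t" if "s \<in> frags" "t \<in> frags" for s t
    using h.hom_mult[of s t] that unfolding carrier_tensor_free mult_tensor_free by blast
  have uminus: "h (- s) = inv\<^bsub>G\<^esub> h s" if "s \<in> frags" for s
    using h.hom_inv[of s] that by (simp add: tensor_free_def)
  have diff: "h (s - t) = h s \<otimes>\<^bsub>G\<^esub> inv\<^bsub>G\<^esub> h t" if "s \<in> frags" "t \<in> frags" for s t
    using add[of s "- t"] uminus[of t] that by simp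
  have cancel: "a \<otimes>\<^bsub>G\<^esub> b \<otimes>\<^bsub>G\<^esub> inv\<^bsub>G\<^esub> a \<otimes>\<^bsub>G\<^esub> inv\<^bsub>G\<^esub> b = \<one>\<^bsub>G\<^esub>" if "a \<in> carrier G" "b \<in> carrier G" for a b
    using that by (simp add: G.m_comm[of a b] G.m_assoc)
  have "h t = \<one>\<^bsub>G\<^esub>" if "t \<in> rel" for t
  proof -
    have "h t = \<one>\<^bsub>G\<^esub> \<and> t \<in> frags"
      using that
    proof (induction rule: rel_induct)
      case (gen g)
      then show ?case
      proof (cases rule: gens_cases)
        case (add_left x x' y)
        then show ?thesis
          by (simp only: diff frags_diff frags_frag_of h M.add.m_closed SigmaI case_prod_conv left)
            (simp add: closed cancel)
      next
        case (add_right x y y')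
        then show ?thesis
          by (simp only: diff frags_diff frags_frag_of h N.add.m_closed SigmaI case_prod_conv right)
            (simp add: closed cancel)
      next
        case (smult r x y)
        then show ?thesis
          by (simp only: diff frags_diff frags_frag_of h M.smult_closed N.smult_closed SigmaI
              case_prod_conv balanced) (simp add: closed)
      qed
    qed (use h.hom_one in \<open>simp_all add: tensor_free_def add uminus\<close>)
    then show ?thesis ..
  qed
  then show ?thesis using that[of h] h h.group_hom_axioms by auto
qed

lemma rel_finsum_right:
  assumes "finite A" "f \<in> A \<rightarrow> carrier N" "x \<in> carrier M"
  shows "frag_of (x, \<Oplus>\<^bsub>N\<^esub>i\<in>A. f i) - (\<Sum>i\<in>A. frag_of (x, f i)) \<in> rel"
  using assms
proof (induction A)
  case empty
  then show ?case using rel_zero_right by simp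
next
  case (insert i A)
  have f: "f i \<in> carrier N" "f \<in> A \<rightarrow> carrier N" using insert.prems by auto
  have "frag_of (x, f i \<oplus>\<^bsub>N\<^esub> (\<Oplus>\<^bsub>N\<^esub>i\<in>A. f i)) - frag_of (x, f i) - frag_of (x, \<Oplus>\<^bsub>N\<^esub>i\<in>A. f i) \<in> rel"
    using insert.prems f by (intro rel_add_right N.finsum_closed)
  from rel_add[OF this insert.IH[OF f(2) insert.prems(2)]]
  show ?case using insert.hyps f by (simp add: N.finsum_insert algebra_simps)
qed

end

text \<open>
  Coordinates \<open>c i\<close> on \<open>M\<close> induce coordinates \<open>K \<otimes> M \<rightarrow> K\<close>, \<open>k \<otimes> x \<mapsto> c i x \<odot> k\<close>, and likewise for \<open>N\<close>. These
  commute with \<open>f : K \<rightarrow> N\<close>, and an element of \<open>K \<otimes> M\<close> is the sum of its coordinates times the \<open>e i\<close>. So if its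
  image is zero, then its coordinates vanish by the injectivity of \<open>f\<close>, and so does the element itself.
  The hypotheses are those of the dual basis lemma, so they say that \<open>M\<close> is projective.
\<close>

theorem dual_basis_imp_flat:
  fixes R :: "('r, 'z) ring_scheme" and M :: "('r, 'm, 'x) module_scheme"
  assumes "module R M"
    and e: "\<And>i. i \<in> I \<Longrightarrow> e i \<in> carrier M"
    and c: "\<And>i x. i \<in> I \<Longrightarrow> x \<in> carrier M \<Longrightarrow> c i x \<in> carrier R"
    and c_add: "\<And>i x y. i \<in> I \<Longrightarrow> x \<in> carrier M \<Longrightarrow> y \<in> carrier M \<Longrightarrow>
      c i (x \<oplus>\<^bsub>M\<^esub> y) = c i x \<oplus>\<^bsub>R\<^esub> c i y"
    and c_smult: "\<And>i r x. i \<in> I \<Longrightarrow> r \<in> carrier R \<Longrightarrow> x \<in> carrier M \<Longrightarrow>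
      c i (r \<odot>\<^bsub>M\<^esub> x) = r \<otimes>\<^bsub>R\<^esub> c i x"
    and fin: "\<And>x. x \<in> carrier M \<Longrightarrow> finite {i \<in> I. c i x \<noteq> \<zero>\<^bsub>R\<^esub>}"
    and expand: "\<And>x. x \<in> carrier M \<Longrightarrow>
      x = (\<Oplus>\<^bsub>M\<^esub>i\<in>{i \<in> I. c i x \<noteq> \<zero>\<^bsub>R\<^esub>}. c i x \<odot>\<^bsub>M\<^esub> e i)"
  shows "flat_module TYPE('a) TYPE('b) R M"
  unfolding flat_module_def
proof (intro conjI allI ballI impI)
  fix K :: "('r, 'a) module" and N :: "('r, 'b) module" and f
  assume f: "f \<in> linear_maps R K N" and K: "module R K" and N: "module R N"
    and inj: "inj_on f (carrier K)"
  interpret KM: module_pair R K M using assms(1) K by (simp add: module_pair_def)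
  interpret NM: module_pair R N M using assms(1) N by (simp add: module_pair_def)
  have f_closed: "f x \<in> carrier N" if "x \<in> carrier K" for x
    using f that unfolding linear_maps_def by blast
  have f_add: "f (x \<oplus>\<^bsub>K\<^esub> y) = f x \<oplus>\<^bsub>N\<^esub> f y" if "x \<in> carrier K" "y \<in> carrier K" for x y
    using f that unfolding linear_maps_def by blast
  have f_smult: "f (r \<odot>\<^bsub>K\<^esub> x) = r \<odot>\<^bsub>N\<^esub> f x" if "r \<in> carrier R" "x \<in> carrier K" for r x
    using f that unfolding linear_maps_def by blast
  have f_zero: "f \<zero>\<^bsub>K\<^esub> = \<zero>\<^bsub>N\<^esub>"
    using f_add[of "\<zero>\<^bsub>K\<^esub>" "\<zero>\<^bsub>K\<^esub>"] f_closed[of "\<zero>\<^bsub>K\<^esub>"] by simp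
  have coord: "\<exists>h. group_hom (tensor_free L M) (add_monoid L) h \<and>
      (\<forall>k\<in>carrier L. \<forall>x\<in>carrier M. h (frag_of (k, x)) = c i x \<odot>\<^bsub>L\<^esub> k) \<and>
      (\<forall>t\<in>tensor_rel R L M. h t = \<zero>\<^bsub>L\<^esub>)" if L: "module R L" and i: "i \<in> I"
    for L :: "('r, 'l) module" and i
  proof -
    interpret LM: module_pair R L M using assms(1) L by (simp add: module_pair_def)
    show ?thesis
    proof (rule LM.balanced_map_extends[where f = "\<lambda>k x. c i x \<odot>\<^bsub>L\<^esub> k" and G = "add_monoid L"])
      show "comm_group (add_monoid L)" by (rule LM.M.a_comm_group)
    next
      fix r k x assume *: "r \<in> carrier R" "k \<in> carrier L" "x \<in> carrier M"
      then have cx: "c i x \<in> carrier R" using c i by blast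
      have "c i x \<odot>\<^bsub>L\<^esub> (r \<odot>\<^bsub>L\<^esub> k) = (c i x \<otimes>\<^bsub>R\<^esub> r) \<odot>\<^bsub>L\<^esub> k"
        using LM.M.smult_assoc1[OF cx *(1,2)] by simp
      also have "c i x \<otimes>\<^bsub>R\<^esub> r = c i (r \<odot>\<^bsub>M\<^esub> x)"
        using KM.M.m_comm[OF cx *(1)] c_smult[OF i *(1,3)] by simp
      finally show "c i x \<odot>\<^bsub>L\<^esub> (r \<odot>\<^bsub>L\<^esub> k) = c i (r \<odot>\<^bsub>M\<^esub> x) \<odot>\<^bsub>L\<^esub> k" .
    qed (use i in \<open>simp_all add: c c_add LM.M.smult_r_distr LM.M.smult_l_distr, blast\<close>)
  qed
  have "\<exists>h. group_hom (tensor_free K M) (add_monoid K) h \<and>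
      (\<forall>k\<in>carrier K. \<forall>x\<in>carrier M. h (frag_of (k, x)) = c i x \<odot>\<^bsub>K\<^esub> k)" if "i \<in> I" for i
    using coord[OF K that] by blast
  then obtain \<kappa> where \<kappa>: "\<And>i. i \<in> I \<Longrightarrow> group_hom (tensor_free K M) (add_monoid K) (\<kappa> i)"
    "\<And>i k x. i \<in> I \<Longrightarrow> k \<in> carrier K \<Longrightarrow> x \<in> carrier M \<Longrightarrow> \<kappa> i (frag_of (k, x)) = c i x \<odot>\<^bsub>K\<^esub> k"
    by metis
  have "\<exists>h. group_hom (tensor_free N M) (add_monoid N) h \<and>
      (\<forall>k\<in>carrier N. \<forall>x\<in>carrier M. h (frag_of (k, x)) = c i x \<odot>\<^bsub>N\<^esub> k) \<and>
      (\<forall>t\<in>NM.rel. h t = \<zero>\<^bsub>N\<^esub>)" if "i \<in> I" for i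
    using coord[OF N that] by blast
  then obtain \<nu> where \<nu>: "\<And>i. i \<in> I \<Longrightarrow> group_hom (tensor_free N M) (add_monoid N) (\<nu> i)"
    "\<And>i k x. i \<in> I \<Longrightarrow> k \<in> carrier N \<Longrightarrow> x \<in> carrier M \<Longrightarrow> \<nu> i (frag_of (k, x)) = c i x \<odot>\<^bsub>N\<^esub> k"
    "\<And>i t. i \<in> I \<Longrightarrow> t \<in> NM.rel \<Longrightarrow> \<nu> i t = \<zero>\<^bsub>N\<^esub>"
    by metis
  have \<kappa>_closed: "\<kappa> i t \<in> carrier K" if "i \<in> I" "t \<in> KM.frags" for i t
    using group_hom.hom_closed[OF \<kappa>(1)[OF that(1)], of t] that unfolding KM.carrier_tensor_free by simp
  have \<kappa>_zero: "\<kappa> i 0 = \<zero>\<^bsub>K\<^esub>" if "i \<in> I" for i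
    using group_hom.hom_one[OF \<kappa>(1)[OF that(1)]] by (simp add: tensor_free_def)
  have \<nu>_zero: "\<nu> i 0 = \<zero>\<^bsub>N\<^esub>" if "i \<in> I" for i
    using group_hom.hom_one[OF \<nu>(1)[OF that(1)]] by (simp add: tensor_free_def)
  have \<kappa>_diff: "\<kappa> i s = \<kappa> i (s - t) \<oplus>\<^bsub>K\<^esub> \<kappa> i t" if "i \<in> I" "s \<in> KM.frags" "t \<in> KM.frags" for i s t
    using group_hom.hom_mult[OF \<kappa>(1)[OF that(1)], of "s - t" t] that(2,3) KM.frags_diff[OF that(2,3)]
    unfolding KM.carrier_tensor_free KM.mult_tensor_free by simp
  have \<nu>_diff: "\<nu> i s = \<nu> i (s - t) \<oplus>\<^bsub>N\<^esub> \<nu> i t" if "i \<in> I" "s \<in> NM.frags" "t \<in> NM.frags" for i s t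
    using group_hom.hom_mult[OF \<nu>(1)[OF that(1)], of "s - t" t] that(2,3) NM.frags_diff[OF that(2,3)]
    unfolding NM.carrier_tensor_free NM.mult_tensor_free by simp
  have \<nu>_closed: "\<nu> i t \<in> carrier N" if "i \<in> I" "t \<in> NM.frags" for i t
    using group_hom.hom_closed[OF \<nu>(1)[OF that(1)], of t] that unfolding NM.carrier_tensor_free by simp
  define F :: "('a \<times> 'm \<Rightarrow>\<^sub>0 int) \<Rightarrow> ('b \<times> 'm \<Rightarrow>\<^sub>0 int)"
    where "F = frag_extend (\<lambda>(x, y). frag_of (f x, y))"
  have F_of: "F (frag_of (x, y)) = frag_of (f x, y)" for x y by (simp add: F_def)
  have F_diff: "F (s - t) = F s - F t" and F_add: "F (s + t) = F s + F t"
    and F_minus: "F (- s) = - F s" and F_zero: "F 0 = 0" for s t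
    by (simp_all add: F_def frag_extend_diff frag_extend_add frag_extend_minus)
  have F_closed: "F t \<in> NM.frags" if "t \<in> KM.frags" for t
  proof -
    have "keys (F t) \<subseteq> (\<Union>z\<in>keys t. {(f (fst z), snd z)})"
      using keys_frag_extend[of "\<lambda>(x, y). frag_of (f x, y)" t]
      unfolding F_def by (simp add: case_prod_unfold)
    also have "\<dots> \<subseteq> carrier N \<times> carrier M" using that f_closed by auto
    finally show ?thesis by simp
  qed
  have nat: "\<nu> i (F t) = f (\<kappa> i t)" if i: "i \<in> I" and t: "t \<in> KM.frags" for i t
  proof -
    have "keys t \<subseteq> carrier K \<times> carrier M" using t by simp
    then have "\<nu> i (F t) = f (\<kappa> i t) \<and> t \<in> KM.frags"
    proof (induction t rule: frag_induction)
      case (one x)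
      then show ?case using i by (auto simp: F_of \<nu> \<kappa> f_closed f_smult c)
    next
      case (diff s t)
      then have st: "s \<in> KM.frags" "t \<in> KM.frags" "s - t \<in> KM.frags" using KM.frags_diff by blast+
      have "f (\<kappa> i s) = f (\<kappa> i (s - t)) \<oplus>\<^bsub>N\<^esub> f (\<kappa> i t)"
        unfolding \<kappa>_diff[OF i st(1,2)] by (intro f_add \<kappa>_closed i st)
      moreover have "\<nu> i (F s) = \<nu> i (F (s - t)) \<oplus>\<^bsub>N\<^esub> \<nu> i (F t)"
        unfolding F_diff by (intro \<nu>_diff i F_closed st)
      ultimately have "\<nu> i (F (s - t)) \<oplus>\<^bsub>N\<^esub> f (\<kappa> i t) = f (\<kappa> i (s - t)) \<oplus>\<^bsub>N\<^esub> f (\<kappa> i t)"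
        using diff by simp
      then show ?case
        using \<nu>_closed[OF i F_closed[OF st(3)]] f_closed[OF \<kappa>_closed[OF i st(2)]]
          f_closed[OF \<kappa>_closed[OF i st(3)]] NM.M.add.right_cancel st(3) by blast
    qed (simp add: F_zero \<nu>_zero \<kappa>_zero i f_zero)
    then show ?thesis ..
  qed
  \<comment> \<open>The representation of \<open>t\<close> by its coordinates must hold for all sufficiently large index sets: for
    a difference, two of them are joined.\<close>
  define good where "good A t \<longleftrightarrow> finite A \<and> A \<subseteq> I \<and> (\<forall>A'. finite A' \<longrightarrow> A \<subseteq> A' \<longrightarrow> A' \<subseteq> I \<longrightarrow>
      t - (\<Sum>i\<in>A'. frag_of (\<kappa> i t, e i)) \<in> KM.rel)" for A t
  have repr: "\<exists>A. good A t" if "t \<in> KM.frags" for t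
  proof -
    have "keys t \<subseteq> carrier K \<times> carrier M" using that by simp
    then have "t \<in> KM.frags \<and> (\<exists>A. good A t)"
    proof (induction t rule: frag_induction)
      case zero
      have "- (\<Sum>i\<in>A'. frag_of (\<kappa> i 0, e i)) \<in> KM.rel" if "A' \<subseteq> I" for A'
      proof (intro KM.rel_uminus KM.rel_sum)
        fix i assume "i \<in> A'"
        then have i: "i \<in> I" using that by blast
        show "frag_of (\<kappa> i 0, e i) \<in> KM.rel"
          unfolding \<kappa>_zero[OF i] using e[OF i] by (rule KM.rel_zero_left)
      qed
      then have "good {} 0" unfolding good_def by simp
      then show ?case by auto
    next
      case (one z)
      then obtain k x where z: "z = (k, x)" "k \<in> carrier K" "x \<in> carrier M" by blast
      let ?A = "{i \<in> I. c i x \<noteq> \<zero>\<^bsub>R\<^esub>}"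
      have "frag_of z - (\<Sum>i\<in>A'. frag_of (\<kappa> i (frag_of z), e i)) \<in> KM.rel"
        if A': "finite A'" "?A \<subseteq> A'" "A' \<subseteq> I" for A'
      proof -
        have ce: "(\<lambda>i. c i x \<odot>\<^bsub>M\<^esub> e i) \<in> A' \<rightarrow> carrier M"
          using A'(3) z c e by (intro Pi_I KM.N.smult_closed) blast+
        have x: "x = (\<Oplus>\<^bsub>M\<^esub>i\<in>A'. c i x \<odot>\<^bsub>M\<^esub> e i)"
          by (rule trans[OF expand[OF z(3)]], rule KM.N.add.finprod_mono_neutral_cong_left)
            (use A' ce e KM.N.smult_l_null in auto)
        have "frag_of z - (\<Sum>i\<in>A'. frag_of (k, c i x \<odot>\<^bsub>M\<^esub> e i)) \<in> KM.rel"
          using KM.rel_finsum_right[OF A'(1) ce z(2)] unfolding x[symmetric] z(1) .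
        moreover have "(\<Sum>i\<in>A'. frag_of (c i x \<odot>\<^bsub>K\<^esub> k, e i) - frag_of (k, c i x \<odot>\<^bsub>M\<^esub> e i)) \<in> KM.rel"
          using A'(3) z c e by (intro KM.rel_sum KM.rel_smult) blast+
        ultimately have "frag_of z - (\<Sum>i\<in>A'. frag_of (c i x \<odot>\<^bsub>K\<^esub> k, e i)) \<in> KM.rel"
          by (drule_tac KM.rel_diff) (assumption, simp add: sum_subtractf)
        moreover have "(\<Sum>i\<in>A'. frag_of (\<kappa> i (frag_of z), e i)) = (\<Sum>i\<in>A'. frag_of (c i x \<odot>\<^bsub>K\<^esub> k, e i))"
          unfolding z(1) using A'(3) \<kappa>(2)[OF _ z(2,3)] by (intro sum.cong) auto
        ultimately show ?thesis by simp
      qed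
      then have "good ?A (frag_of z)" unfolding good_def using fin[OF z(3)] by blast
      then show ?case using z by auto
    next
      case (diff s t)
      then obtain A B where s: "s \<in> KM.frags" "good A s" and t: "t \<in> KM.frags" "good B t" by blast
      have "s - t - (\<Sum>i\<in>A'. frag_of (\<kappa> i (s - t), e i)) \<in> KM.rel"
        if A': "finite A'" "A \<union> B \<subseteq> A'" "A' \<subseteq> I" for A'
      proof -
        have "(\<Sum>i\<in>A'. frag_of (\<kappa> i s, e i) - frag_of (\<kappa> i (s - t), e i) - frag_of (\<kappa> i t, e i)) \<in> KM.rel"
          (is "?d \<in> _")
        proof (intro KM.rel_sum)
          fix i assume "i \<in> A'"
          then have i: "i \<in> I" using A' by blast
          show "frag_of (\<kappa> i s, e i) - frag_of (\<kappa> i (s - t), e i) - frag_of (\<kappa> i t, e i) \<in> KM.rel"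
            unfolding \<kappa>_diff[OF i s(1) t(1)]
            by (intro KM.rel_add_left \<kappa>_closed[OF i] e[OF i] KM.frags_diff s(1) t(1))
        qed
        moreover have "s - (\<Sum>i\<in>A'. frag_of (\<kappa> i s, e i)) \<in> KM.rel" (is "?ds \<in> _")
          and "t - (\<Sum>i\<in>A'. frag_of (\<kappa> i t, e i)) \<in> KM.rel" (is "?dt \<in> _")
          using s(2) t(2) A' unfolding good_def by auto
        ultimately have "?ds - ?dt + ?d \<in> KM.rel" using KM.rel_add[OF KM.rel_diff] by blast
        then show ?thesis by (simp add: sum_subtractf sum.distrib algebra_simps)
      qed
      moreover have "finite (A \<union> B)" "A \<union> B \<subseteq> I" using s(2) t(2) unfolding good_def by auto
      ultimately have "good (A \<union> B) (s - t)" unfolding good_def by blast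
      then show ?case using KM.frags_diff[OF s(1) t(1)] by blast
    qed
    then show ?thesis ..
  qed
  have reflect: "t \<in> KM.rel" if t: "t \<in> KM.frags" and Ft: "F t \<in> NM.rel" for t
  proof -
    obtain A where A: "A \<subseteq> I" "t - (\<Sum>i\<in>A. frag_of (\<kappa> i t, e i)) \<in> KM.rel"
      using repr[OF t] unfolding good_def by blast
    have "\<kappa> i t = \<zero>\<^bsub>K\<^esub>" if "i \<in> A" for i
    proof -
      have "f (\<kappa> i t) = f \<zero>\<^bsub>K\<^esub>" using nat[of i t] t \<nu>(3)[OF _ Ft] that A f_zero by auto
      then show ?thesis using inj \<kappa>_closed that A t unfolding inj_on_def by blast
    qed
    then have "(\<Sum>i\<in>A. frag_of (\<kappa> i t, e i)) \<in> KM.rel"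
      using A e by (intro KM.rel_sum) (auto intro: KM.rel_zero_left)
    from KM.rel_add[OF A(2) this] show ?thesis by simp
  qed
  have preserve: "F t \<in> NM.rel" if "t \<in> KM.rel" for t
  proof -
    have "F t \<in> NM.rel \<and> t \<in> KM.frags"
      using that
    proof (induction rule: KM.rel_induct)
      case (gen g)
      then show ?case
      proof (cases rule: KM.gens_cases)
        case (add_left x x' y)
        show ?thesis unfolding add_left(1) F_diff F_of f_add[OF add_left(2,3)]
          by (intro NM.rel_add_left f_closed add_left)
      next
        case (add_right x y y')
        show ?thesis unfolding add_right(1) F_diff F_of
          by (intro NM.rel_add_right f_closed add_right)
      next
        case (smult r x y)
        show ?thesis unfolding smult(1) F_diff F_of f_smult[OF smult(2,3)]
          by (intro NM.rel_smult f_closed smult)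
      qed
    next
      case zero
      show ?case unfolding F_zero by (rule NM.rel_zero)
    next
      case (add s t)
      show ?case unfolding F_add by (intro NM.rel_add add)
    next
      case (uminus s)
      show ?case unfolding F_minus by (intro NM.rel_uminus uminus)
    qed
    then show ?thesis ..
  qed
  have map: "tensor_map_left R N M f (KM.cls t) = NM.cls (F t)" for t
  proof -
    have "NM.cls (F s) = NM.cls (F t)" if "s \<in> KM.cls t" for s
      using preserve[of "s - t"] that unfolding KM.mem_cls_iff F_diff NM.cls_eq_iff by blast
    then show ?thesis unfolding tensor_map_left_def F_def[symmetric] by (rule KM.UN_cls)
  qed
  show "inj_on (tensor_map_left R N M f) (carrier (tensor_product R K M))"
    unfolding KM.carrier_tensor_product
  proof (rule inj_onI, elim imageE)
    fix X Y s t
    assume st: "s \<in> KM.frags" "t \<in> KM.frags" and XY: "X = KM.cls s" "Y = KM.cls t"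
      and "tensor_map_left R N M f X = tensor_map_left R N M f Y"
    then have "F (s - t) \<in> NM.rel" unfolding XY map NM.cls_eq_iff F_diff by simp
    then show "X = Y" unfolding XY KM.cls_eq_iff using st by (intro reflect KM.frags_diff)
  qed
qed fact

section \<open>Maximal minors modulo an ideal\<close>

text \<open>
  Ideals of a ring given by a type class, so that determinants over the ring and congruences modulo
  the ideal can be handled with the usual algebraic automation.
\<close>

locale ideal_set =
  fixes J :: "'a::comm_ring_1 set"
  assumes zero: "0 \<in> J"
    and add: "x \<in> J \<Longrightarrow> y \<in> J \<Longrightarrow> x + y \<in> J"
    and mult: "x \<in> J \<Longrightarrow> r * x \<in> J"
begin

lemma uminus: "x \<in> J \<Longrightarrow> - x \<in> J"
  using mult[of x "- 1"] by simp

lemma diff: "x \<in> J \<Longrightarrow> y \<in> J \<Longrightarrow> x - y \<in> J"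
  using add[of x "- y"] uminus by simp

lemma sum: "(\<And>i. i \<in> A \<Longrightarrow> f i \<in> J) \<Longrightarrow> (\<Sum>i\<in>A. f i) \<in> J"
  by (induction A rule: infinite_finite_induct) (auto intro: zero add)

lemma mult_right: "x \<in> J \<Longrightarrow> x * r \<in> J"
  using mult[of x r] by (simp add: mult.commute)

lemma symmetric_double_sum:
  fixes n :: nat
  assumes "\<And>r s. r < n \<Longrightarrow> s < n \<Longrightarrow> f r s + f s r \<in> J" and "\<And>r. r < n \<Longrightarrow> f r r \<in> J"
  shows "(\<Sum>r<n. \<Sum>s<n. f r s) \<in> J"
  using assms
proof (induction n)
  case (Suc n)
  have "(\<Sum>r<Suc n. \<Sum>s<Suc n. f r s)
      = (\<Sum>r<n. \<Sum>s<n. f r s) + (\<Sum>r<n. f r n + f n r) + f n n"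
    by (simp add: sum.distrib algebra_simps)
  moreover have "(\<Sum>r<n. \<Sum>s<n. f r s) \<in> J" using Suc.prems by (intro Suc.IH) auto
  moreover have "(\<Sum>r<n. f r n + f n r) \<in> J" using Suc.prems(1) by (intro sum) auto
  moreover have "f n n \<in> J" using Suc.prems(2) by simp
  ultimately show ?case by (simp only: add)
qed (simp add: zero)

end

text \<open>
  The determinant as a function of the family of its columns, whose values are functions of the row.
  Replacing a column is then a function update.
\<close>

definition det_cols :: "nat \<Rightarrow> (nat \<Rightarrow> nat \<Rightarrow> 'a) \<Rightarrow> 'a::comm_ring_1"
  where "det_cols n C = det_fun n (\<lambda>r k. C k r)"

lemma det_cols_cong:
  "(\<And>r k. r < n \<Longrightarrow> k < n \<Longrightarrow> C k r = C' k r) \<Longrightarrow> det_cols n C = det_cols n C'"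
  unfolding det_cols_def by (rule det_fun_cong) auto

text \<open>
  Linearity in column \<open>i\<close> in its most useful form: by Laplace expansion the determinant is a linear
  form in the entries of that column, with coefficients that depend on the other columns only.
\<close>

lemma det_cols_linear:
  assumes "i < n"
  obtains w where "\<And>v. det_cols n (C(i := v)) = (\<Sum>r<n. v r * w r)"
proof
  fix v
  let ?A = "\<lambda>v. mat n n (\<lambda>(r, k). (C(i := v)) k r)"
  have "mat_delete (?A v) r i = mat_delete (?A (\<lambda>_. 0)) r i" if "r < n" for r
    unfolding mat_delete_def using that assms by (intro eq_matI) auto
  then show "det_cols n (C(i := v)) = (\<Sum>r<n. v r * cofactor (?A (\<lambda>_. 0)) r i)"
    unfolding det_cols_def det_fun_def
    by (subst laplace_expansion_column[of _ n i]) (use assms in \<open>auto simp: cofactor_def intro!: sum.cong\<close>)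
qed

lemma det_cols_smult: "i < n \<Longrightarrow> det_cols n (C(i := \<lambda>r. c * v r)) = c * det_cols n (C(i := v))"
  by (rule det_cols_linear[of i n C]) (simp_all add: sum_distrib_left algebra_simps)

lemma det_cols_sum:
  assumes "i < n"
  shows "det_cols n (C(i := \<lambda>r. \<Sum>l\<in>A. v l r)) = (\<Sum>l\<in>A. det_cols n (C(i := v l)))"
proof -
  obtain w where w: "\<And>v. det_cols n (C(i := v)) = (\<Sum>r<n. v r * w r)"
    using det_cols_linear[OF assms] by blast
  show ?thesis unfolding w sum_distrib_right by (rule sum.swap)
qed

lemma (in ideal_set) det_cols_cong_mod:
  assumes "i < n" "\<And>r. r < n \<Longrightarrow> v r - v' r \<in> J"
  shows "det_cols n (C(i := v)) - det_cols n (C(i := v')) \<in> J"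
proof -
  obtain w where w: "\<And>v. det_cols n (C(i := v)) = (\<Sum>r<n. v r * w r)"
    using det_cols_linear[OF assms(1)] by blast
  show ?thesis unfolding w sum_subtractf[symmetric] left_diff_distrib[symmetric]
    using assms(2) by (intro sum mult_right) auto
qed

lemma det_cols_swap:
  assumes "i < n" "k < n" "i \<noteq> k"
  shows "det_cols n (C(i := a, k := b)) = - det_cols n (C(i := b, k := a))"
proof -
  have eq: "swapcols i k (mat n n (\<lambda>(r, l). (C(i := b, k := a)) l r)) = mat n n (\<lambda>(r, l). (C(i := a, k := b)) l r)"
    using assms by (intro eq_matI) (auto simp: mat_swapcols_def)
  show ?thesis unfolding det_cols_def det_fun_def
    unfolding eq[symmetric] by (rule det_swapcols[OF assms mat_carrier])
qed

lemma det_cols_identical: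
  assumes "i < n" "k < n" "i \<noteq> k"
  shows "det_cols n (C(i := a, k := a)) = 0"
  unfolding det_cols_def det_fun_def
  by (rule det_identical_columns[OF _ assms(3,1,2)]) (use assms in \<open>auto intro!: eq_vecI\<close>)

text \<open>
  Two columns whose \<open>2 \<times> 2\<close> minors lie in the ideal are proportional modulo the ideal. Expanding in both
  columns, the terms for the pairs of rows \<open>(r, s)\<close> and \<open>(s, r)\<close> combine to a multiple of such a minor.
\<close>

lemma (in ideal_set) det_cols_proportional:
  assumes ik: "i < n" "k < n" "i \<noteq> k"
    and minors: "\<And>r s. r < n \<Longrightarrow> s < n \<Longrightarrow> a r * b s - a s * b r \<in> J"
  shows "det_cols n (C(i := a, k := b)) \<in> J"
proof -
  define u :: "nat \<Rightarrow> nat \<Rightarrow> 'a" where "u r = (\<lambda>j. if j = r then 1 else 0)" for r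
  define W where "W r s = det_cols n (C(i := u r, k := u s))" for r s
  have expand: "(v :: nat \<Rightarrow> 'a) x = (\<Sum>r<n. v r * u r x)" if "x < n" for v x
    using that by (simp add: u_def if_distrib cong: if_cong)
  have k: "det_cols n (C(i := v, k := b)) = (\<Sum>s<n. b s * det_cols n (C(i := v, k := u s)))" for v
    unfolding det_cols_smult[OF ik(2), symmetric] det_cols_sum[OF ik(2), symmetric]
    by (rule det_cols_cong) (use expand in auto)
  have comm: "C(i := v, k := v') = C(k := v', i := v)" for v v' using ik(3) by auto
  have i: "det_cols n (C(i := a, k := v)) = (\<Sum>r<n. a r * det_cols n (C(i := u r, k := v)))" for v
    unfolding comm det_cols_smult[OF ik(1), symmetric] det_cols_sum[OF ik(1), symmetric]
    by (rule det_cols_cong) (use expand in auto)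
  have "det_cols n (C(i := a, k := b)) = (\<Sum>r<n. \<Sum>s<n. a r * b s * W r s)"
    by (subst i, subst k) (simp add: W_def sum_distrib_left mult.assoc)
  also have "\<dots> \<in> J"
  proof (rule symmetric_double_sum)
    fix r s assume rs: "r < n" "s < n"
    have "W s r = - W r s" unfolding W_def by (rule det_cols_swap[OF ik])
    then have "a r * b s * W r s + a s * b r * W s r = W r s * (a r * b s - a s * b r)"
      by (simp add: algebra_simps)
    then show "a r * b s * W r s + a s * b r * W s r \<in> J" using mult minors[OF rs] by metis
  qed (simp add: W_def det_cols_identical[OF ik] zero)
  finally show ?thesis .
qed

definition below_zero :: "(nat \<Rightarrow> 'a) \<Rightarrow> nat \<Rightarrow> 'a::zero"
  where "below_zero v = case_nat 0 v"

text \<open>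
  The minor of the $n \times (n+1)$ matrix \<open>M\<close> with column \<open>i\<close> deleted, with the sign $(-1)^i$. It is encoded as
  the determinant of the square matrix which has a zero row on top of \<open>M\<close> and whose column \<open>i\<close> is
  replaced by the first unit vector. In this form no signs or index shifts are visible.
\<close>

definition signed_minor :: "nat \<Rightarrow> (nat \<Rightarrow> nat \<Rightarrow> 'a) \<Rightarrow> nat \<Rightarrow> 'a::comm_ring_1"
  where "signed_minor n M i =
    det_cols (Suc n) ((\<lambda>k. below_zero (\<lambda>j. M j k))(i := case_nat 1 (\<lambda>_. 0)))"

lemma signed_minor_eq:
  assumes "i \<le> n"
  shows "signed_minor n M i = (-1) ^ i * det_fun n (\<lambda>j k. M j (if k < i then k else Suc k))"
proof -
  let ?A = "mat (Suc n) (Suc n) (\<lambda>(r, k). ((\<lambda>k. below_zero (\<lambda>j. M j k))(i := case_nat 1 (\<lambda>_. 0))) k r)"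
  have del: "mat_delete ?A 0 i = mat n n (\<lambda>(j, k). M j (if k < i then k else Suc k))"
    unfolding mat_delete_def using assms by (intro eq_matI) (auto simp: below_zero_def)
  have "det ?A = (\<Sum>k<Suc n. ?A $$ (0, k) * cofactor ?A 0 k)"
    by (rule laplace_expansion_row) auto
  also have "\<dots> = (\<Sum>k<Suc n. if k = i then cofactor ?A 0 i else 0)"
    by (intro sum.cong) (auto simp: below_zero_def)
  also have "\<dots> = cofactor ?A 0 i" using assms by simp
  also have "\<dots> = (- 1) ^ i * det (mat_delete ?A 0 i)" by (simp only: cofactor_def add_0)
  finally show ?thesis unfolding del unfolding signed_minor_def det_cols_def det_fun_def .
qed

text \<open>
  The sum is the expansion of a determinant in which row \<open>j\<close> of \<open>M\<close> occurs twice.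
\<close>

lemma sum_signed_minor:
  assumes "j < n"
  shows "(\<Sum>i\<le>n. signed_minor n M i * M j i) = 0"
proof -
  let ?A = "mat (Suc n) (Suc n) (\<lambda>(r, k). case r of 0 \<Rightarrow> M j k | Suc j' \<Rightarrow> M j' k)"
  have del: "mat_delete ?A 0 i = mat n n (\<lambda>(j, k). M j (if k < i then k else Suc k))" if "i \<le> n" for i
    unfolding mat_delete_def using that by (intro eq_matI) auto
  have "0 = det ?A"
    by (rule det_identical_rows[symmetric, of _ "Suc n" 0 "Suc j"]) (use assms in \<open>auto intro!: eq_vecI\<close>)
  also have "\<dots> = (\<Sum>k<Suc n. ?A $$ (0, k) * cofactor ?A 0 k)"
    by (rule laplace_expansion_row) auto
  also have "\<dots> = (\<Sum>i\<le>n. signed_minor n M i * M j i)"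
    unfolding lessThan_Suc_atMost
    by (intro sum.cong) (auto simp: signed_minor_eq cofactor_def del det_fun_def)
  finally show ?thesis ..
qed

text \<open>
  Suppose that the columns of \<open>T\<close> add up to zero and are proportional to those of \<open>M\<close> modulo the ideal,
  where the factors of proportionality are only known for the columns \<open>i\<close> and \<open>k\<close>: these satisfy
  \<open>y M\<^sub>i \<equiv> s T\<^sub>i\<close> and \<open>z M\<^sub>k \<equiv> t T\<^sub>k\<close>. If all factors were invertible, the vector of the quotients \<open>y / s\<close> would
  be a kernel vector of \<open>M\<close>, hence proportional to the vector of minors. Without division, one replaces
  $M_i$ by $T_i$ in one minor and $M_k$ by $T_k$ in the other; the remaining columns of \<open>T\<close> do not contribute
  since each is proportional to a column of \<open>M\<close> that is still present.
\<close>

lemma (in ideal_set) signed_minor_exchange: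
  fixes M T :: "nat \<Rightarrow> nat \<Rightarrow> 'a"
  assumes ik: "i \<le> n" "k \<le> n" "i \<noteq> k"
    and rows: "\<And>j. j < n \<Longrightarrow> (\<Sum>l\<le>n. T j l) = 0"
    and cols: "\<And>l j j'. l \<le> n \<Longrightarrow> j < n \<Longrightarrow> j' < n \<Longrightarrow> T j l * M j' l - T j' l * M j l \<in> J"
    and i: "\<And>j. j < n \<Longrightarrow> y * M j i - s * T j i \<in> J"
    and k: "\<And>j. j < n \<Longrightarrow> z * M j k - t * T j k \<in> J"
  shows "y * (t * signed_minor n M k) - z * (s * signed_minor n M i) \<in> J"
proof -
  define C where "C k = below_zero (\<lambda>j. M j k)" for k
  define T' where "T' k = below_zero (\<lambda>j. T j k)" for k
  define e :: "nat \<Rightarrow> 'a" where "e = case_nat 1 (\<lambda>_. 0)"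
  define \<Delta> where "\<Delta> v w = det_cols (Suc n) (C(i := v, k := w))" for v w
  have i': "i < Suc n" and k': "k < Suc n" using ik by auto
  have swap: "\<Delta> v w = - \<Delta> w v" for v w
    unfolding \<Delta>_def by (rule det_cols_swap[OF i' k' ik(3)])
  have \<Delta>_mod: "\<Delta> v w - \<Delta> v w' \<in> J" if "\<And>r. r < Suc n \<Longrightarrow> w r - w' r \<in> J" for v w w'
    unfolding \<Delta>_def by (rule det_cols_cong_mod[OF k' that])
  have \<Delta>_smult: "\<Delta> v (\<lambda>r. c * w r) = c * \<Delta> v w" for c v w
    unfolding \<Delta>_def by (rule det_cols_smult[OF k'])
  have Mk: "signed_minor n M k = - \<Delta> e (C i)"
    unfolding swap[of e] unfolding \<Delta>_def signed_minor_def C_def e_def by (simp add: fun_upd_idem)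
  have Mi: "signed_minor n M i = \<Delta> e (C k)"
    unfolding \<Delta>_def signed_minor_def C_def e_def using ik(3) by (simp add: fun_upd_idem)
  \<comment> \<open>The factors \<open>y\<close> and \<open>z\<close> are moved into a column of \<open>M\<close>, which is then exchanged for one of \<open>T\<close>.\<close>
  have "y * \<Delta> e (C i) - s * \<Delta> e (T' i) \<in> J"
    unfolding \<Delta>_smult[symmetric] by (rule \<Delta>_mod)
      (use i in \<open>auto simp: C_def T'_def below_zero_def zero split: nat.split\<close>)
  from mult[OF this, of t] have 1: "t * (y * \<Delta> e (C i)) - t * (s * \<Delta> e (T' i)) \<in> J"
    by (simp add: algebra_simps)
  have "z * \<Delta> e (C k) - t * \<Delta> e (T' k) \<in> J"
    unfolding \<Delta>_smult[symmetric] by (rule \<Delta>_mod)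
      (use k in \<open>auto simp: C_def T'_def below_zero_def zero split: nat.split\<close>)
  from mult[OF this, of s] have 2: "s * (z * \<Delta> e (C k)) - s * (t * \<Delta> e (T' k)) \<in> J"
    by (simp add: algebra_simps)
  \<comment> \<open>Column \<open>l\<close> of \<open>M\<close> is still there and proportional to the new column.\<close>
  have "\<Delta> e (T' l) \<in> J" if l: "l \<le> n" "l \<noteq> i" "l \<noteq> k" for l
  proof -
    have "C(i := e, k := T' l) = (C(i := e))(l := C l, k := T' l)" using l by auto
    then have "\<Delta> e (T' l) = det_cols (Suc n) ((C(i := e))(l := C l, k := T' l))"
      unfolding \<Delta>_def by simp
    also have "\<dots> \<in> J"
    proof (rule det_cols_proportional)
      fix r s assume "r < Suc n" "s < Suc n"
      then have "- (T' l r * C l s - T' l s * C l r) \<in> J"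
        using cols[OF l(1)] by (intro uminus) (auto simp: C_def T'_def below_zero_def zero split: nat.split)
      then show "C l r * T' l s - C l s * T' l r \<in> J" by (simp add: algebra_simps)
    qed (use l k' in auto)
    finally show ?thesis .
  qed
  then have "(\<Sum>l\<in>{..n} - {i, k}. \<Delta> e (T' l)) \<in> J" by (intro sum) auto
  moreover have "(\<Sum>l\<le>n. \<Delta> e (T' l)) = 0"
  proof -
    have "(\<Sum>l\<le>n. \<Delta> e (T' l)) = \<Delta> e (\<lambda>r. 0 * (0 :: 'a))"
      unfolding \<Delta>_def det_cols_sum[OF k', symmetric]
    proof (rule det_cols_cong)
      fix r l assume "r < Suc n"
      then have "(\<Sum>l\<le>n. T' l r) = 0" using rows by (cases r) (simp_all add: T'_def below_zero_def)
      then show "(C(i := e, k := \<lambda>r. \<Sum>l\<le>n. T' l r)) l r = (C(i := e, k := \<lambda>r. 0 * 0)) l r" by simp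
    qed
    also have "\<dots> = 0" unfolding \<Delta>_smult by simp
    finally show ?thesis .
  qed
  moreover have "(\<Sum>l\<le>n. \<Delta> e (T' l)) = \<Delta> e (T' i) + \<Delta> e (T' k) + (\<Sum>l\<in>{..n} - {i, k}. \<Delta> e (T' l))"
    using ik by (subst sum.subset_diff[of "{i, k}"]) (auto simp: algebra_simps)
  ultimately have "- (\<Delta> e (T' i) + \<Delta> e (T' k)) \<in> J"
    by (metis add_eq_0_iff)
  from mult[OF this, of "s * t"]
  have "- (s * (t * \<Delta> e (T' i))) - s * (t * \<Delta> e (T' k)) \<in> J" by (simp add: algebra_simps)
  from diff[OF diff[OF this 1] 2] show ?thesis unfolding Mk Mi by (simp add: algebra_simps)
qed

section \<open>Polynomials as combinations of monomials\<close>

abbreviation mon :: "('v \<Rightarrow>\<^sub>0 nat) \<Rightarrow> ('v, 'k::comm_ring_1) mpoly"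
  where "mon \<mu> \<equiv> Poly_Mapping.single \<mu> 1"

lemma mon_add: "mon (\<mu> + \<nu>) = mon \<mu> * mon \<nu>"
  by (simp add: mult_single)

lemma single_eq_Const_mult: "Poly_Mapping.single \<mu> c = Const c * mon \<mu>"
  by (simp add: Const_def mult_single)

lemma mpoly_expand: "f = (\<Sum>\<mu>\<in>keys f. Const (lookup f \<mu>) * mon \<mu>)"
  unfolding single_eq_Const_mult[symmetric]
  by (rule poly_mapping_eqI)
    (auto simp: lookup_sum lookup_single when_def in_keys_iff)

lemma Const_add: "Const (a + b) = Const a + Const b"
  by (simp add: Const_def single_add)

lemma Const_mult: "Const (a * b) = Const a * Const b"
  by (simp add: Const_def mult_single)

lemma lookup_Const_mult: "lookup (Const c * f) \<mu> = c * lookup f \<mu>"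
  unfolding Const_def mult_map_scale_conv_mult[symmetric] by (simp add: map.rep_eq when_def)

lemma Const_0 [simp]: "Const 0 = 0" and Const_1 [simp]: "Const 1 = 1"
  by (simp_all add: Const_def)

lemma Var_eq_mon: "Var v = mon (Poly_Mapping.single v 1)"
  by (simp add: Var_def)


text \<open>
  The span of a set of monomials. All conditions on the terms of a polynomial take this form: the
  variables that occur, homogeneity, divisibility by a \<open>u\<close>-variable, being standard.
\<close>

definition mspan :: "('v \<Rightarrow>\<^sub>0 nat) set \<Rightarrow> ('v, 'k::comm_ring_1) mpoly set"
  where "mspan X = {f. keys f \<subseteq> X}"

lemma mspan_mono: "f \<in> mspan X \<Longrightarrow> X \<subseteq> Y \<Longrightarrow> f \<in> mspan Y"
  by (auto simp: mspan_def)

lemma mspan_0 [simp]: "0 \<in> mspan X"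
  by (simp add: mspan_def)

lemma mspan_add: "f \<in> mspan X \<Longrightarrow> g \<in> mspan X \<Longrightarrow> f + g \<in> mspan X"
  using Poly_Mapping.keys_add[of f g] by (auto simp: mspan_def)

lemma mspan_uminus: "f \<in> mspan X \<Longrightarrow> - f \<in> mspan X"
  by (auto simp: mspan_def in_keys_iff)

lemma mspan_diff: "f \<in> mspan X \<Longrightarrow> g \<in> mspan X \<Longrightarrow> f - g \<in> mspan X"
  using mspan_add[of f X "- g"] mspan_uminus[of g X] by simp

lemma mspan_sum: "(\<And>i. i \<in> A \<Longrightarrow> f i \<in> mspan X) \<Longrightarrow> (\<Sum>i\<in>A. f i) \<in> mspan X"
  by (induction A rule: infinite_finite_induct) (auto intro: mspan_add)

lemma mspan_mult:
  assumes "f \<in> mspan X" "g \<in> mspan Y" "\<And>\<mu> \<nu>. \<mu> \<in> X \<Longrightarrow> \<nu> \<in> Y \<Longrightarrow> \<mu> + \<nu> \<in> Z"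
  shows "f * g \<in> mspan Z"
proof -
  have "\<mu> \<in> Z" if "\<mu> \<in> keys (f * g)" for \<mu>
    using that keys_mult[of f g] assms unfolding mspan_def by blast
  then show ?thesis unfolding mspan_def by blast
qed

lemma mspan_single: "\<mu> \<in> X \<Longrightarrow> Poly_Mapping.single \<mu> c \<in> mspan X"
  by (simp add: mspan_def)

lemma mspan_Const_mult: "f \<in> mspan X \<Longrightarrow> Const c * f \<in> mspan X"
  unfolding Const_def by (rule mspan_mult[OF mspan_single[of 0 "{0}"]]) auto

lemma mspan_induct [consumes 1, case_names zero add smult mon]:
  assumes "f \<in> mspan X" and "P 0" and "\<And>f g. P f \<Longrightarrow> P g \<Longrightarrow> P (f + g)"
    and "\<And>c f. P f \<Longrightarrow> P (Const c * f)" and "\<And>\<mu>. \<mu> \<in> X \<Longrightarrow> P (mon \<mu>)"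
  shows "P f"
proof -
  have "P (\<Sum>\<mu>\<in>A. Const (lookup f \<mu>) * mon \<mu>)" if "A \<subseteq> keys f" for A
    using that
  proof (induction A rule: infinite_finite_induct)
    case (insert \<mu> A)
    then have "P (mon \<mu>)" using assms(1,5) unfolding mspan_def by blast
    then show ?case using insert assms(3,4) by simp
  qed (simp_all add: assms(2))
  from this[OF order_refl] mpoly_expand[of f, symmetric] show ?thesis by (rule back_subst[of P])
qed

section \<open>Linear extension from monomials\<close>

text \<open>
  The extension of a map on monomials that is semilinear along \<open>h\<close>. Evaluation homomorphisms, coefficient
  extraction and restriction to some of the monomials are all of this form.
\<close>

definition linext ::
  "('k \<Rightarrow> 'r) \<Rightarrow> (('v \<Rightarrow>\<^sub>0 nat) \<Rightarrow> 'r) \<Rightarrow> ('v, 'k::comm_ring_1) mpoly \<Rightarrow> 'r::comm_ring_1"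
  where "linext h \<phi> f = (\<Sum>\<mu>\<in>keys f. h (lookup f \<mu>) * \<phi> \<mu>)"

locale coefficient_hom =
  fixes h :: "'k::comm_ring_1 \<Rightarrow> 'r::comm_ring_1"
  assumes h_0: "h 0 = 0" and h_1: "h 1 = 1"
    and h_add: "h (a + b) = h a + h b" and h_mult: "h (a * b) = h a * h b"
begin

lemma linext_superset:
  assumes "finite A" "keys f \<subseteq> A"
  shows "linext h \<phi> f = (\<Sum>\<mu>\<in>A. h (lookup f \<mu>) * \<phi> \<mu>)"
  unfolding linext_def using assms by (intro sum.mono_neutral_left) (auto simp: h_0 in_keys_iff)

lemma linext_0: "linext h \<phi> 0 = 0"
  by (simp add: linext_def)

lemma linext_add: "linext h \<phi> (f + g) = linext h \<phi> f + linext h \<phi> g"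
proof -
  let ?A = "keys f \<union> keys g"
  have "finite ?A" "keys (f + g) \<subseteq> ?A" using Poly_Mapping.keys_add[of f g] by auto
  then show ?thesis
    by (simp add: linext_superset[of ?A] lookup_add h_add distrib_right sum.distrib)
qed

lemma linext_single: "linext h \<phi> (Poly_Mapping.single \<mu> c) = h c * \<phi> \<mu>"
  by (simp add: linext_superset[of "{\<mu>}"])

lemma linext_mon: "linext h \<phi> (mon \<mu>) = \<phi> \<mu>"
  by (simp add: linext_single h_1)

lemma linext_Const_mult: "linext h \<phi> (Const c * f) = h c * linext h \<phi> f"
proof -
  have "keys (Const c * f) \<subseteq> keys f"
    by (auto simp: in_keys_iff lookup_Const_mult)
  then show ?thesis
    by (simp add: linext_superset[of "keys f"] lookup_Const_mult h_mult sum_distrib_left mult.assoc)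
qed

lemma linext_sum: "linext h \<phi> (\<Sum>i\<in>A. f i) = (\<Sum>i\<in>A. linext h \<phi> (f i))"
  by (induction A rule: infinite_finite_induct) (simp_all add: linext_0 linext_add)

text \<open>
  With \<open>\<phi>' = \<phi>\<close> this is multiplicativity of evaluation; with \<open>\<phi>'\<close> the identity it is linearity over a
  subring of polynomials.
\<close>

lemma linext_mult:
  assumes "\<And>\<mu> \<nu>. \<mu> \<in> X \<Longrightarrow> \<phi> (\<mu> + \<nu>) = \<phi>' \<mu> * \<phi> \<nu>" and f: "f \<in> mspan X"
  shows "linext h \<phi> (f * g) = linext h \<phi>' f * linext h \<phi> g"
  using f
proof (induction f rule: mspan_induct)
  case (mon \<mu>)
  have "g \<in> mspan UNIV" by (simp add: mspan_def)
  then show ?case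
  proof (induction g rule: mspan_induct)
    case (mon \<nu>)
    then show ?case using assms(1)[OF \<open>\<mu> \<in> X\<close>] unfolding mon_add[symmetric] linext_mon by simp
  next
    case (smult c f)
    then show ?case unfolding mult.left_commute[of _ "Const c"] linext_Const_mult by simp
  qed (simp_all add: linext_0 linext_add distrib_left)
qed (simp_all add: linext_0 linext_add distrib_right linext_Const_mult mult.assoc)

lemma poly_eval_eq_linext:
  "poly_eval h \<sigma> = linext h (\<lambda>\<mu>. \<Prod>v\<in>keys \<mu>. \<sigma> v ^ lookup \<mu> v)"
  by (rule ext) (simp add: poly_eval_def linext_def)

lemma poly_eval_add: "poly_eval h \<sigma> (f + g) = poly_eval h \<sigma> f + poly_eval h \<sigma> g"
  unfolding poly_eval_eq_linext by (rule linext_add)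

lemma poly_eval_mult: "poly_eval h \<sigma> (f * g) = poly_eval h \<sigma> f * poly_eval h \<sigma> g"
  unfolding poly_eval_eq_linext
proof (rule linext_mult[where X = UNIV])
  fix \<mu> \<nu> :: "'a \<Rightarrow>\<^sub>0 nat"
  let ?p = "\<lambda>A \<mu>. \<Prod>v\<in>A. \<sigma> v ^ lookup \<mu> v"
  let ?A = "keys \<mu> \<union> keys \<nu>"
  have *: "?p (keys \<kappa>) \<kappa> = ?p ?A \<kappa>" if "keys \<kappa> \<subseteq> ?A" for \<kappa>
    using that by (intro prod.mono_neutral_left) (auto simp: in_keys_iff)
  show "?p (keys (\<mu> + \<nu>)) (\<mu> + \<nu>) = ?p (keys \<mu>) \<mu> * ?p (keys \<nu>) \<nu>"
    using Poly_Mapping.keys_add[of \<mu> \<nu>]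
    by (simp only: *[of "\<mu> + \<nu>"] *[of \<mu>] *[of \<nu>] Un_upper1 Un_upper2)
      (simp add: lookup_add power_add prod.distrib)
qed (simp add: mspan_def)

lemma poly_eval_Const: "poly_eval h \<sigma> (Const c) = h c"
  unfolding poly_eval_eq_linext Const_def linext_single by simp

lemma poly_eval_Var: "poly_eval h \<sigma> (Var v) = \<sigma> v"
  unfolding poly_eval_eq_linext Var_def linext_single by (simp add: h_1)

end

interpretation Const: coefficient_hom Const
  by unfold_locales (simp_all add: Const_add Const_mult)


section \<open>Gradings\<close>

definition weight :: "('v \<Rightarrow> nat) \<Rightarrow> ('v \<Rightarrow>\<^sub>0 nat) \<Rightarrow> nat"
  where "weight w \<mu> = (\<Sum>v\<in>keys \<mu>. w v * lookup \<mu> v)"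

lemma weight_superset:
  assumes "finite A" "keys \<mu> \<subseteq> A"
  shows "weight w \<mu> = (\<Sum>v\<in>A. w v * lookup \<mu> v)"
  unfolding weight_def using assms by (intro sum.mono_neutral_left) (auto simp: in_keys_iff)

lemma weight_add: "weight w (\<mu> + \<nu>) = weight w \<mu> + weight w \<nu>"
proof -
  let ?A = "keys \<mu> \<union> keys \<nu>"
  have "finite ?A" "keys (\<mu> + \<nu>) \<subseteq> ?A" using Poly_Mapping.keys_add[of \<mu> \<nu>] by auto
  then show ?thesis
    by (simp add: weight_superset[of ?A] lookup_add distrib_left sum.distrib)
qed

lemma weight_single: "weight w (Poly_Mapping.single v n) = w v * n"
  by (simp add: weight_superset[of "{v}"])

lemma weight_0: "weight w 0 = 0"
  by (simp add: weight_def)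

lemma weight_eq_0_iff: "weight w \<mu> = 0 \<longleftrightarrow> (\<forall>v\<in>keys \<mu>. w v = 0)"
  by (auto simp: weight_def in_keys_iff)

definition graded :: "'v set \<Rightarrow> ('v \<Rightarrow> nat) \<Rightarrow> nat \<Rightarrow> ('v \<Rightarrow>\<^sub>0 nat) set"
  where "graded V w d = {\<mu>. keys \<mu> \<subseteq> V \<and> weight w \<mu> = d}"

lemma graded_add: "\<mu> \<in> graded V w d \<Longrightarrow> \<nu> \<in> graded V w e \<Longrightarrow> \<mu> + \<nu> \<in> graded V w (d + e)"
  using Poly_Mapping.keys_add[of \<mu> \<nu>] unfolding graded_def by (auto simp: weight_add)

lemma mspan_graded_mult:
  "f \<in> mspan (graded V w d) \<Longrightarrow> g \<in> mspan (graded V w e) \<Longrightarrow> f * g \<in> mspan (graded V w (d + e))"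
  by (rule mspan_mult) (auto intro: graded_add)

lemma mspan_graded_1: "1 \<in> mspan (graded V w 0)"
  unfolding single_one[symmetric] by (rule mspan_single) (simp add: graded_def weight_0)

lemma mspan_graded_Var: "v \<in> V \<Longrightarrow> Var v \<in> mspan (graded V w (w v))"
  unfolding Var_def by (rule mspan_single) (simp add: graded_def weight_single)

lemma mspan_graded_prod:
  "(\<And>i. i \<in> A \<Longrightarrow> f i \<in> mspan (graded V w (d i))) \<Longrightarrow>
    (\<Prod>i\<in>A. f i) \<in> mspan (graded V w (\<Sum>i\<in>A. d i))"
proof (induction A rule: infinite_finite_induct)
  case (insert i A)
  then show ?case by (simp add: mspan_graded_mult)
qed (simp_all add: mspan_graded_1)

text \<open>
  Columns of degrees \<open>d k\<close> suffice, as each term of the determinant has one factor from each column.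
\<close>

lemma mspan_graded_det:
  assumes "\<And>j k. j < n \<Longrightarrow> k < n \<Longrightarrow> A j k \<in> mspan (graded V w (d k))"
  shows "det_fun n A \<in> mspan (graded V w (\<Sum>k<n. d k))"
proof -
  have "signof p * (\<Prod>k<n. mat n n (\<lambda>(j, k). A j k) $$ (p k, k)) \<in> mspan (graded V w (\<Sum>k<n. d k))"
    if p: "p permutes {0..<n}" for p
  proof -
    have "(\<Prod>k<n. mat n n (\<lambda>(j, k). A j k) $$ (p k, k)) \<in> mspan (graded V w (\<Sum>k<n. d k))"
      using assms permutes_in_image[OF p] by (intro mspan_graded_prod) auto
    then show ?thesis using mspan_uminus signof_pm_one[of p] by (auto simp: sign_def)
  qed
  then show ?thesis unfolding det_fun_def
    by (subst det_col[of _ n]) (auto intro!: mspan_sum)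
qed

section \<open>Polynomial rings\<close>

lemma carrier_ring_on: "carrier (ring_on C) = C"
  and mult_ring_on: "x \<otimes>\<^bsub>ring_on C\<^esub> y = x * y"
  and one_ring_on: "\<one>\<^bsub>ring_on C\<^esub> = 1"
  and zero_ring_on: "\<zero>\<^bsub>ring_on C\<^esub> = 0"
  and add_ring_on: "x \<oplus>\<^bsub>ring_on C\<^esub> y = x + y"
  by (simp_all add: ring_on_def)

lemma cring_ring_on:
  assumes "0 \<in> C" "1 \<in> C" "\<And>x. x \<in> C \<Longrightarrow> - x \<in> C"
    "\<And>x y. x \<in> C \<Longrightarrow> y \<in> C \<Longrightarrow> x + y \<in> C" "\<And>x y. x \<in> C \<Longrightarrow> y \<in> C \<Longrightarrow> x * y \<in> C"
  shows "cring (ring_on C)"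
proof (rule cringI)
  show "abelian_group (ring_on C)"
  proof (rule abelian_groupI)
    fix x assume "x \<in> carrier (ring_on C)"
    then show "\<exists>y\<in>carrier (ring_on C). y \<oplus>\<^bsub>ring_on C\<^esub> x = \<zero>\<^bsub>ring_on C\<^esub>"
      using assms(3) by (intro bexI[of _ "- x"]) (simp_all add: ring_on_def)
  qed (use assms in \<open>simp_all add: ring_on_def algebra_simps\<close>)
  show "Group.comm_monoid (ring_on C)"
    by (rule comm_monoidI) (use assms in \<open>simp_all add: ring_on_def algebra_simps\<close>)
qed (simp add: ring_on_def distrib_right)

lemma carrier_poly_ring: "carrier (poly_ring V) = mspan {\<mu>. keys \<mu> \<subseteq> V}"
  unfolding poly_ring_def carrier_ring_on mspan_def by auto

lemma poly_ring_mult_closed: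
  "f \<in> carrier (poly_ring V) \<Longrightarrow> g \<in> carrier (poly_ring V) \<Longrightarrow> f * g \<in> carrier (poly_ring V)"
  unfolding carrier_poly_ring
proof (rule mspan_mult)
  fix \<mu> \<nu> :: "'a \<Rightarrow>\<^sub>0 nat"
  show "\<mu> + \<nu> \<in> {\<mu>. keys \<mu> \<subseteq> V}"
    if "\<mu> \<in> {\<mu>. keys \<mu> \<subseteq> V}" "\<nu> \<in> {\<mu>. keys \<mu> \<subseteq> V}"
    using that Poly_Mapping.keys_add[of \<mu> \<nu>] by blast
qed

lemma poly_ring_Const: "Const c \<in> carrier (poly_ring V)"
  unfolding carrier_poly_ring Const_def by (rule mspan_single) simp

lemma poly_ring_Var: "v \<in> V \<Longrightarrow> Var v \<in> carrier (poly_ring V)"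
  unfolding carrier_poly_ring Var_def by (rule mspan_single) simp

lemma poly_ring_1: "1 \<in> carrier (poly_ring V)"
  using poly_ring_Const[of 1 V] by simp

lemma cring_poly_ring: "cring (poly_ring V :: ('a, 'b::comm_ring_1) mpoly ring)"
proof -
  have eq: "(poly_ring V :: ('a, 'b) mpoly ring) = ring_on (carrier (poly_ring V))" by (simp add: poly_ring_def carrier_ring_on)
  have "cring (ring_on (carrier (poly_ring V :: ('a, 'b) mpoly ring)))"
  proof (rule cring_ring_on)
    fix f g :: "('a, 'b) mpoly" assume fg: "f \<in> carrier (poly_ring V)" "g \<in> carrier (poly_ring V)"
    show "- f \<in> carrier (poly_ring V)" "f + g \<in> carrier (poly_ring V)"
      using fg unfolding carrier_poly_ring by (simp_all add: mspan_uminus mspan_add)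
    show "f * g \<in> carrier (poly_ring V)" using fg by (rule poly_ring_mult_closed)
  qed (simp_all add: poly_ring_1, simp add: carrier_poly_ring)
  then show ?thesis using eq by metis
qed

section \<open>The grading and the branches of the tree\<close>

lemma sum_nth_distinct:
  "distinct xs \<Longrightarrow> (\<Sum>i<length xs. f (xs ! i)) = (\<Sum>x\<in>set xs. f x)"
  by (rule sum.reindex_bij_betw, rule bij_betw_nth) auto

text \<open>
  The degree of $p_1$ is chosen so that it exceeds the degree of all $S_p(q)$ by one.
\<close>

fun x_weight :: "'p::{finite, order} tree_var \<Rightarrow> nat"
  where "x_weight (X1 p) = card {p..}" | "x_weight (X2 q) = 1"
  | "x_weight U_root = 0" | "x_weight (U q p) = 0"

fun u_weight :: "'p tree_var \<Rightarrow> nat"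
  where "u_weight (X1 p) = 0" | "u_weight (X2 q) = 0"
  | "u_weight U_root = 2" | "u_weight (U q p) = 1"

definition total_weight :: "'p::{finite, order} tree_var \<Rightarrow> nat"
  where "total_weight v = x_weight v + u_weight v"

lemma weight_total: "weight total_weight \<mu> = weight x_weight \<mu> + weight u_weight \<mu>"
  by (simp add: weight_def total_weight_def distrib_right sum.distrib)

text \<open>
  The monomials in the ideal of the \<open>u\<close>-variables.
\<close>

definition u_positive :: "('p tree_var \<Rightarrow>\<^sub>0 nat) set"
  where "u_positive = {\<mu>. weight u_weight \<mu> > 0}"

lemma u_positive_add: "\<mu> \<in> u_positive \<Longrightarrow> \<mu> + \<nu> \<in> u_positive" "\<nu> \<in> u_positive \<Longrightarrow> \<mu> + \<nu> \<in> u_positive"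
  by (auto simp: u_positive_def weight_add)

lemma ideal_u_positive: "ideal_set (mspan u_positive :: ('p, 'k::comm_ring_1) tree_poly set)"
proof
  fix r x :: "('p, 'k) tree_poly"
  assume "x \<in> mspan u_positive"
  then show "r * x \<in> mspan u_positive"
    by (intro mspan_mult[of r UNIV x]) (auto simp: u_positive_add mspan_def)
qed (auto intro: mspan_add)

lemma Var_u_positive: "Var U_root \<in> mspan u_positive" "Var (U q p) \<in> mspan u_positive"
  by (auto simp: Var_def u_positive_def weight_single intro!: mspan_single)

context rooted_tree
begin

abbreviation branches :: "'p \<Rightarrow> 'p list"
  where "branches a \<equiv> a # ch a"

lemma distinct_branches: "distinct (branches a)"
  using distinct_ch set_ch unfolding covers_def by simp

lemma child_not_le:
  fixes q :: 'p
  assumes "a \<lessdot> c" "a \<lessdot> c'" "c \<noteq> c'" "c \<le> q"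
  shows "\<not> c' \<le> q"
  using comparable_below[OF assms(4), of c'] assms(1-3) unfolding covers_def
  by (metis order_less_le)

lemma siblings_child: "a \<lessdot> b \<Longrightarrow> siblings b = set (ch a) - {b}"
  unfolding siblings_def set_ch by (auto dest: parent_eqI)

lemma atLeast_eq: "{a..} = insert a (\<Union>c\<in>set (ch a). {c..})"
proof (intro equalityI subsetI)
  fix q assume "q \<in> {a..}"
  then show "q \<in> insert a (\<Union>c\<in>set (ch a). {c..})"
    by (cases "q = a") (auto simp: set_ch intro: covers_between[of a q])
qed (auto simp: set_ch covers_def)

lemma sum_atLeast:
  fixes f :: "'p \<Rightarrow> 'c::comm_monoid_add"
  shows "(\<Sum>q\<in>{a..}. f q) = f a + (\<Sum>c\<in>set (ch a). \<Sum>q\<in>{c..}. f q)"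
proof -
  have "a \<notin> (\<Union>c\<in>set (ch a). {c..})" by (auto simp: set_ch covers_def)
  then have "(\<Sum>q\<in>{a..}. f q) = f a + (\<Sum>q\<in>(\<Union>c\<in>set (ch a). {c..}). f q)"
    by (subst atLeast_eq) simp
  also have "(\<Sum>q\<in>(\<Union>c\<in>set (ch a). {c..}). f q) = (\<Sum>c\<in>set (ch a). \<Sum>q\<in>{c..}. f q)"
    by (rule sum.UNION_disjoint) (auto simp: set_ch dest: child_not_le)
  finally show ?thesis .
qed

lemma card_atLeast: "card {a..} = 1 + (\<Sum>c\<in>set (ch a). card {c..})"
  using sum_atLeast[of "\<lambda>_. 1 :: nat" a] by simp

lemma card_less:
  fixes a c :: 'p
  shows "a < c \<Longrightarrow> card {c..} < card {a..}"
  by (intro psubset_card_mono) (auto intro: order_trans less_imp_le)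

text \<open>
  The elements above \<open>a\<close> but not above its child \<open>b\<close> are \<open>a\<close> and those above a sibling of \<open>b\<close>. They are the
  \<open>q\<close> for which there is a variable $u_{q,b}$.
\<close>

lemma sum_outside_branch:
  fixes f :: "'p \<Rightarrow> 'c::ab_group_add"
  assumes "a \<lessdot> b"
  shows "(\<Sum>q\<in>{a..} - {b..}. f q) = f a + (\<Sum>c\<in>siblings b. \<Sum>q\<in>{c..}. f q)"
proof -
  have b: "b \<in> set (ch a)" "{b..} \<subseteq> {a..}" using assms by (auto simp: set_ch covers_def)
  have "(\<Sum>q\<in>{a..}. f q) = (\<Sum>q\<in>{a..} - {b..}. f q) + (\<Sum>q\<in>{b..}. f q)"
    by (rule sum.subset_diff[OF b(2)]) simp
  moreover have "(\<Sum>c\<in>set (ch a). \<Sum>q\<in>{c..}. f q) = (\<Sum>q\<in>{b..}. f q) + (\<Sum>c\<in>siblings b. \<Sum>q\<in>{c..}. f q)"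
    unfolding siblings_child[OF assms] using b by (intro sum.remove) auto
  ultimately show ?thesis using sum_atLeast[of f a] by (simp add: algebra_simps)
qed

declare D.simps [simp del] S.simps [simp del]

section \<open>The polynomials \<open>D\<close>, \<open>S\<close> and \<open>T\<close>\<close>

text \<open>
  The entry $S_cT_c(b)$ of $M(a)$ in row \<open>b\<close> and column \<open>c\<close>.
\<close>

definition entry :: "'p \<Rightarrow> 'p \<Rightarrow> 'p \<Rightarrow> ('p, 'k::comm_ring_1) tree_poly"
  where "entry a b c = (if c = b then Var (X1 b) else if c = a then - Var (U a b)
    else - (\<Sum>q\<in>{c..}. Var (U q b) * S c q))"

lemma D_eq_signed_minor:
  assumes "i \<le> length (ch a)"
  shows "D a (branches a ! i) =
    signed_minor (length (ch a)) (\<lambda>j k. entry a (ch a ! j) (branches a ! k)) i"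
proof (cases "ch a = []")
  case True
  then show ?thesis
    using assms by (subst D.simps) (simp add: signed_minor_eq det_fun_def)
next
  case False
  have "(LEAST i'. branches a ! i' = branches a ! i) = i"
  proof (rule Least_equality)
    fix y assume y: "branches a ! y = branches a ! i"
    show "i \<le> y"
    proof (rule ccontr)
      assume "\<not> i \<le> y"
      then have "y < length (branches a)" "i < length (branches a)" "y \<noteq> i" using assms by auto
      then show False using y distinct_branches nth_eq_iff_index_eq by blast
    qed
  qed simp
  then show ?thesis
    using False assms by (subst D.simps) (simp add: signed_minor_eq Let_def entry_def)
qed

text \<open>
  The product $R(a,b)$.
\<close>

definition path_prod :: "'p \<Rightarrow> 'p \<Rightarrow> ('p, 'k::comm_ring_1) tree_poly"
  where "path_prod a b = (\<Prod>(p, q)\<in>{(p, q). a \<le> p \<and> p \<lessdot> q \<and> q \<le> b}. D p q)"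

lemma S_eq: "a \<le> b \<Longrightarrow> S a b = path_prod a b * D b b"
  by (subst S.simps) (simp add: path_prod_def)

lemma path_prod_split:
  assumes "p \<le> a" "a \<le> x"
  shows "path_prod p x = path_prod p a * path_prod a x"
proof -
  let ?E = "\<lambda>a b. {(r, s). a \<le> r \<and> r \<lessdot> s \<and> s \<le> b}"
  have E: "?E p x = ?E p a \<union> ?E a x"
  proof (intro equalityI subsetI)
    fix z assume "z \<in> ?E p x"
    then obtain r s where z: "z = (r, s)" "p \<le> r" "r \<lessdot> s" "s \<le> x" by auto
    consider "s \<le> a" | "a < s" using comparable_below[OF z(4) assms(2)] by (auto simp: order_le_less)
    then show "z \<in> ?E p a \<union> ?E a x"
    proof cases
      case 2
      then have "a \<le> r" using le_parent[of a s] parent_eqI[OF z(3)] by simp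
      then show ?thesis using z by simp
    qed (use z in simp)
  qed (use assms in \<open>auto intro: order_trans\<close>)
  have "?E p a \<inter> ?E a x = {}" unfolding covers_def by force
  then show ?thesis unfolding path_prod_def E by (intro prod.union_disjoint) auto
qed

lemma path_prod_refl [simp]: "path_prod a a = 1"
proof -
  have E: "{(r, s). a \<le> r \<and> r \<lessdot> s \<and> s \<le> a} = {}" unfolding covers_def by force
  show ?thesis unfolding path_prod_def E by simp
qed

lemma path_prod_child:
  assumes "a \<lessdot> c"
  shows "path_prod a c = D a c"
proof -
  have E: "{(r, s). a \<le> r \<and> r \<lessdot> s \<and> s \<le> c} = {(a, c)}"
  proof (intro equalityI subsetI)
    fix z assume "z \<in> {(r, s). a \<le> r \<and> r \<lessdot> s \<and> s \<le> c}"
    then obtain r s where z: "z = (r, s)" "a \<le> r" "r \<lessdot> s" "s \<le> c" by auto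
    then have "r < c" "a < s" unfolding covers_def by auto
    then have "r = a" "s = c" using z(2,4) assms unfolding covers_def by (auto simp: order_le_less)
    then show "z \<in> {(a, c)}" using z(1) by simp
  qed (use assms in simp)
  show ?thesis unfolding path_prod_def E by simp
qed

lemma S_split:
  assumes "p \<le> a" "a \<le> x"
  shows "S p x = path_prod p a * S a x"
  unfolding S_eq[OF order_trans[OF assms]] S_eq[OF assms(2)] path_prod_split[OF assms]
  by (rule mult.assoc)

lemma S_refl: "S a a = D a a"
  by (simp add: S_eq)

lemma S_child:
  assumes "a \<lessdot> c" "c \<le> q"
  shows "S a q = D a c * S c q"
proof -
  have "a \<le> c" using assms(1) unfolding covers_def by (auto intro: less_imp_le)
  then show ?thesis using S_split[of a c q] path_prod_child[OF assms(1)] assms(2) by metis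
qed

lemma sum_D_entry:
  assumes "a \<lessdot> b"
  shows "(\<Sum>c\<in>set (branches a). D a c * entry a b c) = 0"
proof -
  obtain j where j: "j < length (ch a)" "ch a ! j = b"
    using assms by (metis in_set_conv_nth mem_Collect_eq set_ch)
  have "(\<Sum>c\<in>set (branches a). D a c * entry a b c)
      = (\<Sum>i\<le>length (ch a). D a (branches a ! i) * entry a b (branches a ! i))"
    using sum_nth_distinct[OF distinct_branches, of "\<lambda>c. D a c * entry a b c" a, symmetric]
    by (simp only: length_Cons lessThan_Suc_atMost simp_thms)
  also have "\<dots> = 0"
    using sum_signed_minor[OF j(1), of "\<lambda>j k. entry a (ch a ! j) (branches a ! k)"]
    by (simp add: D_eq_signed_minor j(2))
  finally show ?thesis .
qed

text \<open>
  This is $S_a(T(b)) = b_1 D(a)^b$. By definition $T(b)$ is minus the sum of the other $T_c(b)$, and $S_a$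
  is $D(a)^cS_c$ above \<open>c\<close>, so the left-hand side is minus the sum of all products of $D(a)^c$ with an entry of
  row \<open>b\<close> of $M(a)$ except the one in the column of \<open>b\<close>. As the sum over all columns is zero, what remains is
  the entry $b_1$ times $D(a)^b$.
\<close>

lemma S_T:
  assumes "a \<lessdot> b"
  shows "(\<Sum>q\<in>{a..} - {b..}. Var (U q b) * S a q) = Var (X1 b) * (D a b :: ('p, 'k::comm_ring_1) tree_poly)"
proof -
  have ab: "a \<noteq> b" "b \<in> set (ch a)" using assms by (auto simp: covers_def set_ch)
  have "a \<notin> set (ch a)" using distinct_branches[of a] by simp
  then have "0 = D a a * entry a b a + (\<Sum>c\<in>set (ch a). D a c * (entry a b c :: ('p, 'k) tree_poly))"
    using sum_D_entry[OF assms] by simp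
  also have "(\<Sum>c\<in>set (ch a). D a c * entry a b c)
      = D a b * entry a b b + (\<Sum>c\<in>siblings b. D a c * entry a b c)"
    unfolding siblings_child[OF assms] using ab by (intro sum.remove) auto
  also have "(\<Sum>c\<in>siblings b. D a c * (entry a b c :: ('p, 'k) tree_poly)) = - (\<Sum>c\<in>siblings b. \<Sum>q\<in>{c..}. Var (U q b) * S a q)"
  proof (subst sum_negf[symmetric], rule sum.cong[OF refl])
    fix c assume "c \<in> siblings b"
    then have c: "a \<lessdot> c" "c \<noteq> b" "c \<noteq> a" by (auto simp: siblings_child[OF assms] set_ch covers_def)
    have "(\<Sum>q\<in>{c..}. Var (U q b) * S a q)
        = D a c * (\<Sum>q\<in>{c..}. Var (U q b) * (S c q :: ('p, 'k) tree_poly))"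
      unfolding sum_distrib_left by (intro sum.cong) (auto simp: S_child[OF c(1)] algebra_simps)
    then show "D a c * entry a b c = - (\<Sum>q\<in>{c..}. Var (U q b) * (S a q :: ('p, 'k) tree_poly))"
      using c by (simp add: entry_def)
  qed
  finally show ?thesis unfolding sum_outside_branch[OF assms]
    using ab by (simp add: entry_def S_refl algebra_simps)
qed

lemma T_eq:
  assumes "a \<lessdot> b"
  shows "T b = (\<Sum>q\<in>{a..} - {b..}. Var (X2 q) * Var (U q b) :: ('p, 'k::comm_ring_1) tree_poly)"
proof -
  have b: "b \<noteq> \<rho>" using assms minimal_iff[of b] unfolding covers_def by blast
  have "(\<Sum>c\<in>siblings b. T_part c b :: ('p, 'k) tree_poly) = - (\<Sum>c\<in>siblings b. \<Sum>q\<in>{c..}. Var (X2 q) * Var (U q b))"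
    using parent_eqI[OF assms]
    by (subst sum_negf[symmetric], intro sum.cong)
      (auto simp: T_part_def siblings_child[OF assms] set_ch covers_def)
  moreover have "(T_part a b :: ('p, 'k) tree_poly) = - (Var (X2 a) * Var (U a b))"
    using parent_eqI[OF assms] by (simp add: T_part_def)
  ultimately show ?thesis
    unfolding sum_outside_branch[OF assms] using b parent_eqI[OF assms] by (simp add: T_def)
qed

lemma T_u_positive: "T b \<in> mspan u_positive"
proof (cases "b = \<rho>")
  case True
  then show ?thesis by (simp add: T_def Var_u_positive)
next
  case False
  then show ?thesis unfolding T_eq[OF parent_covers[OF False]]
    by (intro mspan_sum ideal_set.mult[OF ideal_u_positive] Var_u_positive)
qed

section \<open>Homogeneity\<close>

abbreviation vars :: "'p tree_var set"
  where "vars \<equiv> u_vars \<union> x_vars"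

abbreviation homog :: "nat \<Rightarrow> ('p, 'k::comm_ring_1) tree_poly set"
  where "homog d \<equiv> mspan (graded vars total_weight d)"

lemma X1_hom: "Var (X1 p) \<in> homog (card {p..})"
  using mspan_graded_Var[of "X1 p" vars total_weight] by (simp add: x_vars_def total_weight_def)

lemma X2_hom: "Var (X2 q) \<in> homog 1"
  using mspan_graded_Var[of "X2 q" vars total_weight] by (simp add: x_vars_def total_weight_def)

lemma U_root_hom: "Var U_root \<in> homog 2"
  using mspan_graded_Var[of "U_root" vars total_weight] by (simp add: u_vars_def total_weight_def numeral_2_eq_2)

lemma U_vars:
  assumes "a \<lessdot> b" "q \<in> {a..} - {b..}"
  shows "U q b \<in> u_vars"
proof -
  have b: "b \<noteq> \<rho>" using assms minimal_iff[of b] unfolding covers_def by blast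
  show ?thesis
  proof (cases "q = a")
    case True
    then show ?thesis using u_vars_iff_sibling[OF b] parent_eqI[OF assms(1)] by simp
  next
    case False
    then have "a < q" using assms(2) by auto
    then obtain c where "a \<lessdot> c" "c \<le> q" by (rule covers_between)
    then show ?thesis
      using u_vars_iff_sibling[OF b] siblings_child[OF assms(1)] assms(2) by (auto simp: set_ch)
  qed
qed

lemma U_hom:
  assumes "a \<lessdot> b" "q \<in> {a..} - {b..}"
  shows "Var (U q b) \<in> homog 1"
  using mspan_graded_Var[of "U q b" vars total_weight] U_vars[OF assms]
  by (simp add: total_weight_def)

lemma T_hom: "T b \<in> homog 2"
proof (cases "b = \<rho>")
  case True
  then show ?thesis by (simp add: T_def U_root_hom)
next
  case False
  have "Var (X2 q) * Var (U q b) \<in> homog 2" if "q \<in> {parent b..} - {b..}" for q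
    using mspan_graded_mult[OF X2_hom U_hom[OF parent_covers[OF False] that]] by (simp only: one_add_one)
  then show ?thesis unfolding T_eq[OF parent_covers[OF False]] by (intro mspan_sum)
qed

text \<open>
  All entries in column \<open>c\<close> of $M(a)$ have the degree of $c_1$ if \<open>c\<close> is a child of \<open>a\<close>, and degree 1 if
  \<open>c = a\<close>, because $S_c(q)$ has one degree less than $c_1$. The degrees of all columns add up to the number
  of elements above \<open>a\<close>, and $D(a)^c$ misses the degree of column \<open>c\<close>. Along a chain the degrees telescope,
  so all $S_a(q)$ have the same degree, one less than that of $a_1$.
\<close>

lemma hom_D_S:
  "(\<forall>c\<in>set (branches a). (D a c :: ('p, 'k::comm_ring_1) tree_poly) \<in> homog (card {a..} - (if c = a then 1 else card {c..}))) \<and>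
    (\<forall>q\<ge>a. (S a q :: ('p, 'k) tree_poly) \<in> homog (card {a..} - 1))"
proof (induction "card {a..}" arbitrary: a rule: less_induct)
  case less
  have IH: "(S c q :: ('p, 'k) tree_poly) \<in> homog (card {c..} - 1)" if "a \<lessdot> c" "c \<le> q" for c q
    using less.hyps[OF card_less, of c] that by (simp add: covers_def)
  define d where "d c = (if c = a then 1 else card {c..})" for c
  have sum_d: "(\<Sum>c\<in>set (branches a). d c) = card {a..}"
  proof -
    have a: "a \<notin> set (ch a)" using distinct_branches[of a] by simp
    then have "(\<Sum>c\<in>set (ch a). d c) = (\<Sum>c\<in>set (ch a). card {c..})"
      unfolding d_def by (intro sum.cong) auto
    then show ?thesis unfolding card_atLeast[of a] using a by (simp add: d_def)
  qed
  have entry: "(entry a b c :: ('p, 'k) tree_poly) \<in> homog (d c)" if b: "a \<lessdot> b" and c: "c \<in> set (branches a)" for b c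
  proof (cases "c = b \<or> c = a")
    case True
    have "a \<in> {a..} - {b..}" "a \<noteq> b" using b by (auto simp: covers_def)
    then show ?thesis using True X1_hom[of b] mspan_uminus[OF U_hom[OF b, of a]]
      by (auto simp: entry_def d_def)
  next
    case False
    then have c': "a \<lessdot> c" using c by (auto simp: set_ch)
    have "Var (U q b) * S c q \<in> (homog (card {c..}) :: ('p, 'k) tree_poly set)" if "c \<le> q" for q
    proof -
      have "q \<in> {a..} - {b..}"
        using child_not_le[OF c' b _ that] False c' that by (auto simp: covers_def)
      from mspan_graded_mult[OF U_hom[OF b this] IH[OF c' that]]
      show ?thesis using card_atLeast[of c] by simp
    qed
    then have "- (\<Sum>q\<in>{c..}. Var (U q b) * S c q) \<in> (homog (card {c..}) :: ('p, 'k) tree_poly set)"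
      by (intro mspan_uminus mspan_sum) simp
    then show ?thesis using False by (simp add: entry_def d_def)
  qed
  have D: "(D a c :: ('p, 'k) tree_poly) \<in> homog (card {a..} - d c)"
    if c: "c \<in> set (branches a)" for c
  proof -
    obtain i where i: "i < length (branches a)" "branches a ! i = c"
      using c[unfolded in_set_conv_nth] by (elim exE conjE)
    define d' where "d' k = (if k = i then 0 else d (branches a ! k))" for k
    have "(D a c :: ('p, 'k) tree_poly) = signed_minor (length (ch a)) (\<lambda>j k. entry a (ch a ! j) (branches a ! k)) i"
      unfolding i(2)[symmetric] by (rule D_eq_signed_minor) (use i(1) in simp)
    also have "\<dots> \<in> homog (\<Sum>k<Suc (length (ch a)). d' k)"
      unfolding signed_minor_def det_cols_def
    proof (rule mspan_graded_det)
      fix r k assume rk: "r < Suc (length (ch a))" "k < Suc (length (ch a))"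
      show "((\<lambda>k. below_zero (\<lambda>j. entry a (ch a ! j) (branches a ! k)))(i := case_nat 1 (\<lambda>_. 0))) k r
          \<in> (homog (d' k) :: ('p, 'k) tree_poly set)"
      proof (cases r)
        case 0
        then show ?thesis by (simp add: below_zero_def d'_def mspan_graded_1)
      next
        case (Suc j)
        then have "ch a ! j \<in> set (ch a)" "branches a ! k \<in> set (branches a)"
          using rk by (simp_all only: nth_mem length_Cons Suc_less_eq)
        then have "a \<lessdot> ch a ! j" "branches a ! k \<in> set (branches a)" by (simp_all only: set_ch mem_Collect_eq)
        from entry[OF this] show ?thesis by (simp add: Suc below_zero_def d'_def)
      qed
    qed
    also have "(\<Sum>k<Suc (length (ch a)). d' k) = card {a..} - d c"
    proof -
      have "(\<Sum>k<length (branches a). d (branches a ! k)) = d c + (\<Sum>k\<in>{..<length (branches a)} - {i}. d (branches a ! k))"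
        using i by (subst sum.remove[of _ i]) auto
      moreover have "(\<Sum>k<length (branches a). d' k) = (\<Sum>k\<in>{..<length (branches a)} - {i}. d (branches a ! k))"
        using i by (subst sum.remove[of _ i]) (auto simp: d'_def intro: sum.cong)
      ultimately show ?thesis using sum_d sum_nth_distinct[OF distinct_branches, of d a] by simp
    qed
    finally show ?thesis .
  qed
  have "(S a q :: ('p, 'k) tree_poly) \<in> homog (card {a..} - 1)" if q: "a \<le> q" for q
  proof (cases "q = a")
    case True
    then show ?thesis using D[of a] by (simp add: S_refl d_def)
  next
    case False
    then have "a < q" using q by auto
    then obtain c where c: "a \<lessdot> c" "c \<le> q" by (rule covers_between)
    then have "c \<noteq> a" "c \<in> set (branches a)" by (auto simp: set_ch covers_def)
    then have "(D a c :: ('p, 'k) tree_poly) \<in> homog (card {a..} - card {c..})"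
      using D[of c] by (simp only: d_def if_False)
    from mspan_graded_mult[OF this IH[OF c]]
    show ?thesis using card_less[of a c] card_atLeast[of c] c by (simp add: S_child covers_def)
  qed
  then show ?case using D by (auto simp: d_def)
qed

lemma S_hom: "a \<le> q \<Longrightarrow> S a q \<in> homog (card {a..} - 1)"
  using conjunct2[OF hom_D_S[of a]] by (elim allE impE) assumption

end

section \<open>Independence of standard monomials\<close>

definition linear_subspace :: "('v, 'k::comm_ring_1) mpoly set \<Rightarrow> bool"
  where "linear_subspace C \<longleftrightarrow> 0 \<in> C \<and> (\<forall>f\<in>C. \<forall>g\<in>C. f + g \<in> C) \<and> (\<forall>f\<in>C. \<forall>c. Const c * f \<in> C)"

lemma linear_subspaceD:
  assumes "linear_subspace C"
  shows "0 \<in> C" "f \<in> C \<Longrightarrow> g \<in> C \<Longrightarrow> f + g \<in> C" "f \<in> C \<Longrightarrow> Const c * f \<in> C"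
  using assms unfolding linear_subspace_def by blast+

lemma linear_subspace_sum:
  "linear_subspace C \<Longrightarrow> (\<And>i. i \<in> A \<Longrightarrow> f i \<in> C) \<Longrightarrow> (\<Sum>i\<in>A. f i) \<in> C"
  by (induction A rule: infinite_finite_induct) (simp_all add: linear_subspaceD)

lemma linear_subspace_mon_mult:
  assumes C: "linear_subspace C" and f: "f \<in> mspan X" and "\<And>\<mu>. \<mu> \<in> X \<Longrightarrow> mon \<mu> * g \<in> C"
  shows "f * g \<in> C"
  using f
  by (induction f rule: mspan_induct)
    (simp_all add: linear_subspaceD[OF C] distrib_right mult.assoc assms(3))

text \<open>
  Buchberger's criterion for generators with leading monomials \<open>l e\<close>, where the terms of the tails have
  smaller weight. For each monomial that is not standard, choose one multiple of a generator which has
  it as its leading monomial. By induction on the weight, the hypothesis on S-polynomials reduces all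
  multiples of generators to the chosen ones. In a combination of chosen ones, a leading monomial of
  maximal weight cannot cancel, so the combination is zero if all its terms are standard.

  The hypothesis speaks of arbitrary linear subspaces \<open>C\<close> in place of the span of the multiples of
  generators with leading monomials of smaller weight; in this form it can be applied directly in the
  induction.
\<close>

theorem standard_monomials_independent:
  fixes l :: "'e \<Rightarrow> ('v \<Rightarrow>\<^sub>0 nat)" and t :: "'e \<Rightarrow> ('v, 'k::comm_ring_1) mpoly"
    and w :: "('v \<Rightarrow>\<^sub>0 nat) \<Rightarrow> nat"
  assumes w_add: "\<And>\<mu> \<nu>. w (\<mu> + \<nu>) = w \<mu> + w \<nu>"
    and tail: "\<And>e \<kappa>. e \<in> E \<Longrightarrow> \<kappa> \<in> keys (t e) \<Longrightarrow> w \<kappa> < w (l e)"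
    and g: "\<And>e. e \<in> E \<Longrightarrow> g e = mon (l e) - t e"
    and spair: "\<And>e e' a b C. e \<in> E \<Longrightarrow> e' \<in> E \<Longrightarrow> a + l e = b + l e' \<Longrightarrow> linear_subspace C \<Longrightarrow>
      (\<And>c e''. e'' \<in> E \<Longrightarrow> w (c + l e'') < w (a + l e) \<Longrightarrow> mon c * g e'' \<in> C) \<Longrightarrow>
      mon a * g e - mon b * g e' \<in> C"
    and f: "f = (\<Sum>e\<in>E. h e * g e)"
    and standard: "\<And>a e. e \<in> E \<Longrightarrow> a + l e \<notin> keys f"
  shows "f = 0"
proof -
  define nonstd where "nonstd \<mu> \<longleftrightarrow> (\<exists>e\<in>E. \<exists>a. \<mu> = a + l e)" for \<mu>
  define ind where "ind \<mu> = (SOME (a, e). e \<in> E \<and> \<mu> = a + l e)" for \<mu>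
  have ind: "snd (ind \<mu>) \<in> E" "\<mu> = fst (ind \<mu>) + l (snd (ind \<mu>))" if ns: "nonstd \<mu>" for \<mu>
  proof -
    obtain a e where "case (a, e) of (a, e) \<Rightarrow> e \<in> E \<and> \<mu> = a + l e"
      using ns unfolding nonstd_def by auto
    then have "case ind \<mu> of (a, e) \<Rightarrow> e \<in> E \<and> \<mu> = a + l e" unfolding ind_def by (rule someI)
    then show "snd (ind \<mu>) \<in> E" "\<mu> = fst (ind \<mu>) + l (snd (ind \<mu>))"
      unfolding case_prod_beta by blast+
  qed
  define can where "can \<mu> = (if nonstd \<mu> then mon (fst (ind \<mu>)) * g (snd (ind \<mu>)) else 0)" for \<mu>
  define C where "C = range (linext Const can)"
  have C: "linear_subspace C"
    unfolding linear_subspace_def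
  proof (intro conjI ballI allI)
    show "0 \<in> C" unfolding C_def using rangeI[of "linext Const can" 0] by (simp add: Const.linext_0)
    fix x assume "x \<in> C"
    then obtain F where F: "x = linext Const can F" unfolding C_def by blast
    show "Const c * x \<in> C" for c
      unfolding C_def F Const.linext_Const_mult[symmetric] by (rule rangeI)
    fix y assume "y \<in> C"
    then obtain G where G: "y = linext Const can G" unfolding C_def by blast
    show "x + y \<in> C" unfolding C_def F G Const.linext_add[symmetric] by (rule rangeI)
  qed
  \<comment> \<open>\<open>C\<close> is the span of the chosen multiples of generators.\<close>
  have in_C: "mon a * g e \<in> C" if "e \<in> E" for a e
    using that
  proof (induction "w (a + l e)" arbitrary: a e rule: less_induct)
    case less
    let ?\<mu> = "a + l e"
    have ns: "nonstd ?\<mu>" using less.prems unfolding nonstd_def by blast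
    have "mon a * g e - mon (fst (ind ?\<mu>)) * g (snd (ind ?\<mu>)) \<in> C"
      by (rule spair[OF less.prems ind[OF ns] C less.hyps])
    moreover have "mon (fst (ind ?\<mu>)) * g (snd (ind ?\<mu>)) = linext Const can (mon ?\<mu>)"
      unfolding Const.linext_mon using ns by (simp only: can_def if_True)
    ultimately have "mon a * g e - linext Const can (mon ?\<mu>) \<in> C" by (simp only:)
    from linear_subspaceD(2)[OF C this, of "linext Const can (mon ?\<mu>)"]
    show ?case by (simp add: C_def)
  qed
  have "f \<in> C"
    unfolding f
  proof (rule linear_subspace_sum[OF C])
    fix e assume "e \<in> E"
    then show "h e * g e \<in> C"
      by (intro linear_subspace_mon_mult[where X = UNIV, OF C _ in_C]) (simp add: mspan_def)
  qed
  then obtain G where G: "f = linext Const can G" unfolding C_def by blast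
  define N where "N = {\<mu> \<in> keys G. nonstd \<mu>}"
  have fin: "finite N" unfolding N_def by simp
  have fN: "f = (\<Sum>\<nu>\<in>N. Const (lookup G \<nu>) * can \<nu>)"
    unfolding G linext_def N_def
  proof (rule sum.mono_neutral_right)
    show "\<forall>\<mu>\<in>keys G - {\<mu> \<in> keys G. nonstd \<mu>}.
        Const (lookup G \<mu>) * can \<mu> = 0"
      by (simp add: can_def)
  qed auto
  have "N = {}"
  proof (rule ccontr)
    assume "N \<noteq> {}"
    then obtain \<mu> where \<mu>: "\<mu> \<in> N" "Max (w ` N) = w \<mu>"
      using obtains_MAX[OF fin, of w] by blast
    have max: "w \<nu> \<le> w \<mu>" if "\<nu> \<in> N" for \<nu>
      unfolding \<mu>(2)[symmetric] using fin that by (intro Max_ge) auto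
    have can: "lookup (can \<nu>) \<mu> = (if \<nu> = \<mu> then 1 else 0)" if \<nu>: "\<nu> \<in> N" for \<nu>
    proof -
      have ns: "nonstd \<nu>" using \<nu> unfolding N_def by blast
      let ?a = "fst (ind \<nu>)" and ?e = "snd (ind \<nu>)"
      have "can \<nu> = mon \<nu> - mon ?a * t ?e"
        using ns g[OF ind(1)[OF ns]] ind(2)[OF ns, symmetric]
        by (simp only: can_def if_True right_diff_distrib mon_add[symmetric])
      moreover have "\<mu> \<notin> keys (mon ?a * t ?e)"
      proof
        assume "\<mu> \<in> keys (mon ?a * t ?e)"
        then obtain a \<kappa> where "\<mu> = a + \<kappa>" "a \<in> keys (mon ?a :: ('v, 'k) mpoly)"
          and \<kappa>: "\<kappa> \<in> keys (t ?e)"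
          using keys_mult[of "mon ?a" "t ?e"] by blast
        then have "\<mu> = ?a + \<kappa>" by (simp split: if_splits)
        then have "w \<mu> < w (?a + l ?e)" using tail[OF ind(1)[OF ns] \<kappa>] by (simp add: w_add)
        then show False using max[OF \<nu>] ind(2)[OF ns] by simp
      qed
      ultimately show ?thesis by (simp add: lookup_minus lookup_single in_keys_iff when_def)
    qed
    have "lookup f \<mu> = (\<Sum>\<nu>\<in>N. if \<nu> = \<mu> then lookup G \<mu> else 0)"
      unfolding fN lookup_sum lookup_Const_mult by (intro sum.cong) (simp_all add: can)
    also have "\<dots> = lookup G \<mu>" using fin \<mu>(1) by simp
    also have "\<dots> \<noteq> 0" using \<mu>(1) by (simp add: N_def in_keys_iff)
    finally have "\<mu> \<in> keys f" by (simp add: in_keys_iff)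
    moreover have "nonstd \<mu>" using \<mu>(1) by (simp add: N_def)
    ultimately show False using standard unfolding nonstd_def by blast
  qed
  then show ?thesis using fN by simp
qed

lemma common_multiple_decomp:
  fixes a b m m' :: "'v \<Rightarrow>\<^sub>0 nat"
  assumes "a + m = b + m'" and disj: "keys m \<inter> keys m' = {}"
  obtains c where "a = c + m'" "b = c + m"
proof
  have "lookup a v + lookup m v = lookup b v + lookup m' v" for v
    using arg_cong[OF assms(1), of "\<lambda>\<mu>. lookup \<mu> v"] by (simp add: lookup_add)
  moreover have "lookup m v = 0 \<or> lookup m' v = 0" for v
    using disj by (auto simp: in_keys_iff)
  ultimately have ge: "lookup m' v \<le> lookup a v" for v
    by (metis add_0_right le_add2 zero_le)
  then show a: "a = (a - m') + m'"
    by (intro poly_mapping_eqI) (simp add: lookup_add lookup_minus)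
  have "(a - m') + m + m' = ((a - m') + m') + m" by (simp only: ac_simps)
  also have "\<dots> = b + m'" using a assms(1) by simp
  finally show "b = (a - m') + m" by simp
qed

definition restrict_monomials :: "(('v \<Rightarrow>\<^sub>0 nat) \<Rightarrow> bool) \<Rightarrow> ('v, 'k::comm_ring_1) mpoly \<Rightarrow> ('v, 'k) mpoly"
  where "restrict_monomials P = linext Const (\<lambda>\<mu>. if P \<mu> then mon \<mu> else 0)"

lemma restrict_monomials_add: "restrict_monomials P (f + g) = restrict_monomials P f + restrict_monomials P g"
  and restrict_monomials_0 [simp]: "restrict_monomials P 0 = 0"
  and restrict_monomials_Const_mult: "restrict_monomials P (Const c * f) = Const c * restrict_monomials P f"
  and restrict_monomials_mon: "restrict_monomials P (mon \<mu>) = (if P \<mu> then mon \<mu> else 0)"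
  and restrict_monomials_sum: "restrict_monomials P (\<Sum>i\<in>A. F i) = (\<Sum>i\<in>A. restrict_monomials P (F i))"
  unfolding restrict_monomials_def
  by (simp_all add: Const.linext_add Const.linext_0 Const.linext_Const_mult Const.linext_mon Const.linext_sum)

lemma restrict_monomials_id: "f \<in> mspan {\<mu>. P \<mu>} \<Longrightarrow> restrict_monomials P f = f"
  by (induction f rule: mspan_induct) (simp_all add: restrict_monomials_add restrict_monomials_Const_mult restrict_monomials_mon)

lemma restrict_monomials_none: "f \<in> mspan {\<mu>. \<not> P \<mu>} \<Longrightarrow> restrict_monomials P f = 0"
  by (induction f rule: mspan_induct) (simp_all add: restrict_monomials_add restrict_monomials_Const_mult restrict_monomials_mon)

lemma restrict_monomials_mspan: "f \<in> mspan X \<Longrightarrow> restrict_monomials P f \<in> mspan {\<mu> \<in> X. P \<mu>}"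
  by (induction f rule: mspan_induct)
    (auto simp: restrict_monomials_add restrict_monomials_Const_mult restrict_monomials_mon intro: mspan_add mspan_Const_mult mspan_single)

lemma restrict_monomials_homogeneous_mult:
  assumes g: "g \<in> mspan (graded V w e)"
  shows "restrict_monomials (\<lambda>\<mu>. weight w \<mu> = d) (f * g) = restrict_monomials (\<lambda>\<mu>. weight w \<mu> + e = d) f * g"
proof -
  have "f \<in> mspan UNIV" by (simp add: mspan_def)
  then show ?thesis
  proof (induction f rule: mspan_induct)
    case (mon \<kappa>)
    have *: "mon \<kappa> * g \<in> mspan {\<mu>. weight w \<mu> = weight w \<kappa> + e}"
      by (rule mspan_mult[OF mspan_single[of \<kappa> "{\<kappa>}"] g]) (auto simp: graded_def weight_add)
    show ?case
    proof (cases "weight w \<kappa> + e = d")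
      case True
      then show ?thesis using restrict_monomials_id[of "mon \<kappa> * g" "\<lambda>\<mu>. weight w \<mu> = d"] * by (simp add: restrict_monomials_mon)
    next
      case False
      then have "mon \<kappa> * g \<in> mspan {\<mu>. weight w \<mu> \<noteq> d}" by (intro mspan_mono[OF *]) auto
      then show ?thesis using False restrict_monomials_none[of "mon \<kappa> * g" "\<lambda>\<mu>. weight w \<mu> = d"] by (simp add: restrict_monomials_mon)
    qed
  qed (simp_all add: restrict_monomials_add restrict_monomials_Const_mult distrib_right mult.assoc)
qed

context rooted_tree
begin

section \<open>The ideal of the generators\<close>

definition gen :: "'p \<Rightarrow> 'p \<Rightarrow> ('p, 'k::comm_ring_1) tree_poly"
  where "gen p q = Var (X1 p) * Var (X2 q) - T p * S p q"

text \<open>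
  Besides the ideal \<open>J\<close> itself, the coefficients from the ideal of the \<open>u\<close>-variables give the product
  \<open>JU\<close> of the two ideals, which contains the S-polynomials. All variables of the type are admitted
  here; independence modulo this larger ideal implies independence modulo the ideal of $B(2,P)$.
\<close>

definition combinations :: "('p, 'k::comm_ring_1) tree_poly set \<Rightarrow> ('p, 'k) tree_poly set"
  where "combinations H = {(\<Sum>e\<in>{(p, q). p \<le> q}. h e * case_prod gen e) | h. \<forall>e. h e \<in> H}"

lemma combinationsI: "(\<And>e. h e \<in> H) \<Longrightarrow> (\<Sum>e\<in>{(p, q). p \<le> q}. h e * case_prod gen e) \<in> combinations H"
  unfolding combinations_def by blast

lemma combinationsE:
  assumes "f \<in> combinations H"
  obtains h where "\<And>e. h e \<in> H" "f = (\<Sum>e\<in>{(p, q). p \<le> q}. h e * case_prod gen e)"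
  using assms unfolding combinations_def by blast

lemma ideal_combinations:
  fixes H :: "('p, 'k::comm_ring_1) tree_poly set"
  assumes "ideal_set H"
  shows "ideal_set (combinations H)"
proof
  interpret H: ideal_set H by fact
  show "0 \<in> combinations H" using combinationsI[of "\<lambda>_. 0" H] H.zero by simp
  fix f g r :: "('p, 'k) tree_poly"
  assume "f \<in> combinations H"
  then obtain h where h: "\<And>e. h e \<in> H" "f = (\<Sum>e\<in>{(p, q). p \<le> q}. h e * case_prod gen e)" by (rule combinationsE) blast
  show "r * f \<in> combinations H"
    using combinationsI[of "\<lambda>e. r * h e" H] h(1) H.mult unfolding h(2) by (simp add: sum_distrib_left mult.assoc)
  assume "g \<in> combinations H"
  then obtain h' where h': "\<And>e. h' e \<in> H" "g = (\<Sum>e\<in>{(p, q). p \<le> q}. h' e * case_prod gen e)" by (rule combinationsE) blast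
  show "f + g \<in> combinations H"
    using combinationsI[of "\<lambda>e. h e + h' e" H] h(1) h'(1) H.add unfolding h(2) h'(2)
    by (simp add: sum.distrib distrib_right)
qed

lemma combinations_gen:
  assumes "ideal_set H" "f \<in> H" "p \<le> q"
  shows "f * gen p q \<in> combinations H"
proof -
  have "(\<Sum>e\<in>{(p, q). p \<le> q}. (if e = (p, q) then f else 0) * case_prod gen e)
      = (\<Sum>e\<in>{(p, q). p \<le> q}. if e = (p, q) then f * gen p q else 0)"
    by (intro sum.cong) auto
  also have "\<dots> = f * gen p q" using assms(3) by simp
  finally show ?thesis
    using combinationsI[of "\<lambda>e. if e = (p, q) then f else 0" H] assms(2) ideal_set.zero[OF assms(1)] by simp
qed

abbreviation J :: "('p, 'k::comm_ring_1) tree_poly set"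
  where "J \<equiv> combinations UNIV"

abbreviation JU :: "('p, 'k::comm_ring_1) tree_poly set"
  where "JU \<equiv> combinations (mspan u_positive)"

lemma ideal_J: "ideal_set J"
  by (rule ideal_combinations) (unfold_locales, auto)

lemma ideal_JU: "ideal_set JU"
  by (rule ideal_combinations) (rule ideal_u_positive)

lemma gen_J: "p \<le> q \<Longrightarrow> gen p q \<in> J"
  using combinations_gen[of UNIV 1 p q] by (simp add: ideal_set_def)

lemma u_positive_J:
  assumes f: "f \<in> mspan u_positive" and g: "g \<in> J"
  shows "f * g \<in> JU"
proof -
  obtain h where h: "g = (\<Sum>e\<in>{(p, q). p \<le> q}. h e * case_prod gen e)" using g by (rule combinationsE)
  have "h e * f \<in> mspan u_positive" for e by (rule ideal_set.mult[OF ideal_u_positive f])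
  from combinationsI[of "\<lambda>e. h e * f", OF this] show ?thesis unfolding h
    by (simp add: sum_distrib_left mult.assoc mult.left_commute)
qed

section \<open>The exchange relations\<close>

text \<open>
  The matrix of the $T_c(b)$ for \<open>c\<close> in the list of \<open>a\<close> and its children; its rows add up to zero.
\<close>

definition T_entry :: "'p \<Rightarrow> 'p \<Rightarrow> ('p, 'k::comm_ring_1) tree_poly"
  where "T_entry b c = (if c = b then T b else T_part c b)"

lemma sum_T_entry:
  assumes "a \<lessdot> b"
  shows "(\<Sum>c\<in>set (branches a). T_entry b c) = (0 :: ('p, 'k::comm_ring_1) tree_poly)"
proof -
  have b: "b \<noteq> \<rho>" using assms minimal_iff[of b] unfolding covers_def by blast
  have a: "a \<notin> set (ch a)" "a \<noteq> b" "b \<in> set (ch a)" using assms by (auto simp: set_ch covers_def)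
  have "(\<Sum>c\<in>set (branches a). T_entry b c :: ('p, 'k) tree_poly)
      = T_entry b a + (\<Sum>c\<in>set (ch a). T_entry b c)" using a by simp
  also have "(\<Sum>c\<in>set (ch a). T_entry b c :: ('p, 'k) tree_poly)
      = T_entry b b + (\<Sum>c\<in>siblings b. T_entry b c)"
    unfolding siblings_child[OF assms] using a by (intro sum.remove) auto
  also have "(\<Sum>c\<in>siblings b. T_entry b c :: ('p, 'k) tree_poly) = (\<Sum>c\<in>siblings b. T_part c b)"
    by (intro sum.cong) (auto simp: T_entry_def siblings_def)
  finally show ?thesis using a b parent_eqI[OF assms] by (simp add: T_entry_def T_def)
qed

text \<open>
  The elements above \<open>a\<close> are divided into branches, indexed like the columns of $M(a)$. The branch of
  \<open>a\<close> consists of \<open>a\<close> alone.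
\<close>

definition in_branch :: "'p \<Rightarrow> 'p \<Rightarrow> 'p \<Rightarrow> bool"
  where "in_branch a c q \<longleftrightarrow> (if c = a then q = a else c \<le> q)"

text \<open>
  The factor of $S_a(q)$ besides $D(a)^c$, for \<open>q\<close> in the branch of \<open>c\<close>. In the branch of \<open>a\<close> it is 1 and not
  $S_a(a) = D(a)^a$.
\<close>

definition S_branch :: "'p \<Rightarrow> 'p \<Rightarrow> 'p \<Rightarrow> ('p, 'k::comm_ring_1) tree_poly"
  where "S_branch a c q = (if c = a then 1 else S c q)"

lemma S_eq_S_branch:
  assumes "c \<in> set (branches a)" "in_branch a c q"
  shows "S a q = S_branch a c q * D a c"
  using assms by (auto simp: in_branch_def S_branch_def S_refl set_ch S_child mult.commute split: if_splits)

lemma obtain_branch: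
  assumes "a \<le> q"
  obtains i where "i \<le> length (ch a)" "in_branch a (branches a ! i) q"
proof (cases "q = a")
  case True
  then show ?thesis using that[of 0] by (simp add: in_branch_def)
next
  case False
  then have "a < q" using assms by auto
  then obtain c where c: "a \<lessdot> c" "c \<le> q" by (rule covers_between)
  then obtain j where "j < length (ch a)" "ch a ! j = c"
    by (metis in_set_conv_nth mem_Collect_eq set_ch)
  moreover have "in_branch a c q" using c by (auto simp: in_branch_def covers_def)
  ultimately show ?thesis using that[of "Suc j"] by simp
qed

text \<open>
  If \<open>q\<close> and \<open>q'\<close> are in the same branch, the claim reduces to the child \<open>c\<close> of \<open>p\<close> below both, with the
  common factor $D(p)^c$. Otherwise it is an instance of the determinantal lemma: for \<open>q\<close> in the branch of \<open>c\<close>,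
  multiplying column \<open>c\<close> of $M(p)$ by $q_2$ gives $S_c(q)$ times the column of the $T_c(b)$ modulo \<open>J\<close>. In the
  row of \<open>c\<close> this is the generator $c_1q_2 - T(c)S_c(q)$, in the other rows it is the induction hypothesis.
\<close>

lemma S_exchange:
  assumes "p \<le> q" "p \<le> q'"
  shows "Var (X2 q) * S p q' - Var (X2 q') * S p q \<in> (J :: ('p, 'k::comm_ring_1) tree_poly set)"
  using assms
proof (induction "card {p..}" arbitrary: p q q' rule: less_induct)
  case less
  interpret J: ideal_set "J :: ('p, 'k) tree_poly set" by (rule ideal_J)
  have IH: "Var (X2 q) * S c q' - Var (X2 q') * S c q \<in> (J :: ('p, 'k) tree_poly set)"
    if "p \<lessdot> c" "c \<le> q" "c \<le> q'" for c q q'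
    using less.hyps[OF card_less, of c q q'] that by (simp add: covers_def)
  \<comment> \<open>Modulo \<open>J\<close>, a column of $M(p)$ is proportional to the corresponding column of the $T_c(b)$.\<close>
  have col: "Var (X2 q) * entry p b c - S_branch p c q * T_entry b c \<in> (J :: ('p, 'k) tree_poly set)"
    if b: "p \<lessdot> b" and c: "c \<in> set (branches p)" and q: "in_branch p c q" for b c q
  proof -
    have pb: "p \<noteq> b" using b by (auto simp: covers_def)
    consider "c = p" | "c = b" "c \<noteq> p" | "c \<noteq> p" "c \<noteq> b" "p \<lessdot> c" using c by (auto simp: set_ch)
    then show ?thesis
    proof cases
      case 1
      then show ?thesis using q pb parent_eqI[OF b]
        by (simp add: in_branch_def entry_def S_branch_def T_entry_def T_part_def J.zero)
    next
      case 2
      then have "gen b q \<in> (J :: ('p, 'k) tree_poly set)" using q by (intro gen_J) (simp add: in_branch_def)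
      then show ?thesis using 2
        by (simp add: entry_def S_branch_def T_entry_def gen_def mult.commute)
    next
      case 3
      have cq: "c \<le> q" using q 3 by (simp add: in_branch_def)
      have "(\<Sum>q'\<in>{c..}. - Var (U q' b) * (Var (X2 q) * S c q' - Var (X2 q') * S c q)) \<in> (J :: ('p, 'k) tree_poly set)"
        using IH[OF 3(3) cq] by (intro J.sum J.mult) simp
      moreover have "entry p b c = - (\<Sum>q'\<in>{c..}. Var (U q' b) * (S c q' :: ('p, 'k) tree_poly))"
        and "T_entry b c = - (\<Sum>q'\<in>{c..}. Var (X2 q') * Var (U q' b) :: ('p, 'k) tree_poly)"
        and "S_branch p c q = (S c q :: ('p, 'k) tree_poly)"
        using 3 parent_eqI[OF b] by (simp_all add: entry_def S_branch_def T_entry_def T_part_def)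
      ultimately show ?thesis
        by (simp only: mult_minus_right sum_distrib_left flip: sum_negf sum_subtractf)
          (simp add: algebra_simps)
    qed
  qed
  have minors: "T_entry b c * entry p b' c - T_entry b' c * entry p b c \<in> (J :: ('p, 'k) tree_poly set)"
    if b: "p \<lessdot> b" "p \<lessdot> b'" and c: "c \<in> set (branches p)" for b b' c
  proof -
    have *: "T_entry b c * entry p b' c - T_entry b' c * entry p b c \<in> (J :: ('p, 'k) tree_poly set)"
      if b: "p \<lessdot> b" "p \<lessdot> b'" and cb: "c \<noteq> b" for b b'
    proof (cases "c = p")
      case True
      then show ?thesis using b parent_eqI[OF b(1)] parent_eqI[OF b(2)]
        by (auto simp: entry_def T_entry_def T_part_def covers_def J.zero)
    next
      case False
      have "(\<Sum>q\<in>{c..}. - Var (U q b) * (Var (X2 q) * entry p b' c - S_branch p c q * T_entry b' c))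
          \<in> (J :: ('p, 'k) tree_poly set)"
        using col[OF b(2) c] False by (intro J.sum J.mult) (simp add: in_branch_def)
      moreover have "entry p b c = - (\<Sum>q'\<in>{c..}. Var (U q' b) * (S c q' :: ('p, 'k) tree_poly))"
        and "T_entry b c = - (\<Sum>q'\<in>{c..}. Var (X2 q') * Var (U q' b) :: ('p, 'k) tree_poly)"
        and "S_branch p c q = (S c q :: ('p, 'k) tree_poly)" for q
        using False cb parent_eqI[OF b(1)] by (simp_all add: entry_def S_branch_def T_entry_def T_part_def)
      ultimately show ?thesis
        by (simp only: mult_minus_right mult_minus_left sum_distrib_left sum_distrib_right
            flip: sum_negf sum_subtractf) (simp add: algebra_simps)
    qed
    show ?thesis
    proof (cases "c = b")
      case True
      show ?thesis
      proof (cases "c = b'")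
        case True
        then show ?thesis using \<open>c = b\<close> by (simp add: J.zero)
      next
        case False
        from J.uminus[OF *[OF b(2,1) False]] show ?thesis by simp
      qed
    qed (use * b in blast)
  qed
  obtain i where i: "i \<le> length (ch p)" "in_branch p (branches p ! i) q"
    using less.prems(1) by (rule obtain_branch)
  obtain k where k: "k \<le> length (ch p)" "in_branch p (branches p ! k) q'"
    using less.prems(2) by (rule obtain_branch)
  have mem: "branches p ! l \<in> set (branches p)" if "l \<le> length (ch p)" for l
    using that by (intro nth_mem) simp
  have Sq: "(S p q :: ('p, 'k) tree_poly) = S_branch p (branches p ! i) q * D p (branches p ! i)"
    "(S p q' :: ('p, 'k) tree_poly) = S_branch p (branches p ! k) q' * D p (branches p ! k)"
    by (rule S_eq_S_branch[OF mem[OF i(1)] i(2)]) (rule S_eq_S_branch[OF mem[OF k(1)] k(2)])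
  show ?case
  proof (cases "i = k")
    case True
    show ?thesis
    proof (cases "branches p ! k = p")
      case True
      then have "q = p" "q' = p" using i k \<open>i = k\<close> by (auto simp: in_branch_def)
      then show ?thesis by (simp add: J.zero)
    next
      case False
      let ?c = "branches p ! k"
      have c: "p \<lessdot> ?c" using mem[OF k(1)] False by (auto simp: set_ch)
      have le: "?c \<le> q" "?c \<le> q'" using i(2) k(2) False \<open>i = k\<close> by (auto simp: in_branch_def)
      from J.mult[OF IH[OF c le], of "D p ?c"] show ?thesis
        by (simp only: S_child[OF c le(1)] S_child[OF c le(2)] right_diff_distrib mult.left_commute)
    qed
  next
    case False
    have ch: "p \<lessdot> ch p ! j" if "j < length (ch p)" for j
      using nth_mem[OF that] by (simp only: set_ch mem_Collect_eq)
    have "Var (X2 q) * (S_branch p (branches p ! k) q' *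
          signed_minor (length (ch p)) (\<lambda>j k. entry p (ch p ! j) (branches p ! k)) k) -
        Var (X2 q') * (S_branch p (branches p ! i) q *
          signed_minor (length (ch p)) (\<lambda>j k. entry p (ch p ! j) (branches p ! k)) i)
        \<in> (J :: ('p, 'k) tree_poly set)"
    proof (rule J.signed_minor_exchange[OF i(1) k(1) False, where T = "\<lambda>j l. T_entry (ch p ! j) (branches p ! l)"])
      fix j assume j: "j < length (ch p)"
      show "(\<Sum>l\<le>length (ch p). T_entry (ch p ! j) (branches p ! l) :: ('p, 'k) tree_poly) = 0"
        using sum_nth_distinct[OF distinct_branches, of "T_entry (ch p ! j)" p]
        unfolding length_Cons lessThan_Suc_atMost sum_T_entry[OF ch[OF j]] .
      show "Var (X2 q) * entry p (ch p ! j) (branches p ! i) -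
          S_branch p (branches p ! i) q * T_entry (ch p ! j) (branches p ! i) \<in> (J :: ('p, 'k) tree_poly set)"
        by (rule col[OF ch[OF j] mem[OF i(1)] i(2)])
      show "Var (X2 q') * entry p (ch p ! j) (branches p ! k) -
          S_branch p (branches p ! k) q' * T_entry (ch p ! j) (branches p ! k) \<in> (J :: ('p, 'k) tree_poly set)"
        by (rule col[OF ch[OF j] mem[OF k(1)] k(2)])
    next
      fix l j j' assume "l \<le> length (ch p)" "j < length (ch p)" "j' < length (ch p)"
      then show "T_entry (ch p ! j) (branches p ! l) * entry p (ch p ! j') (branches p ! l) -
          T_entry (ch p ! j') (branches p ! l) * entry p (ch p ! j) (branches p ! l) \<in> (J :: ('p, 'k) tree_poly set)"
        by (intro minors ch mem)
    qed
    then show ?thesis unfolding D_eq_signed_minor[OF i(1), symmetric] D_eq_signed_minor[OF k(1), symmetric]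
      by (simp only: Sq)
  qed
qed

section \<open>S-polynomials\<close>

lemma spair_same_first:
  assumes "p \<le> q" "p \<le> q'"
  shows "Var (X2 q') * gen p q - Var (X2 q) * gen p q' \<in> (JU :: ('p, 'k::comm_ring_1) tree_poly set)"
proof -
  have "Var (X2 q') * gen p q - Var (X2 q) * gen p q'
      = T p * (Var (X2 q) * S p q' - Var (X2 q') * S p q :: ('p, 'k) tree_poly)"
    by (simp add: gen_def algebra_simps)
  then show ?thesis using u_positive_J[OF T_u_positive S_exchange[OF assms]] by metis
qed

text \<open>
  Reduce $p_1T(p')$ term by term with the generators for \<open>p\<close> and \<open>x\<close>, where \<open>x\<close> runs through the elements in
  $T(p')$; their coefficients are the variables $u_{x,p'}$. The result is $T(p)S_p(T(p'))$, which equals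
  $p'_1T(p)R(p,p')$.
\<close>

lemma spair_same_second:
  assumes "p < p'" "p' \<le> q"
  shows "Var (X1 p') * gen p q - Var (X1 p) * gen p' q \<in> (JU :: ('p, 'k::comm_ring_1) tree_poly set)"
proof -
  interpret JU: ideal_set "JU :: ('p, 'k) tree_poly set" by (rule ideal_JU)
  define a where "a = parent p'"
  have p': "p' \<noteq> \<rho>" using assms(1) minimal_iff[of p'] by blast
  have a: "a \<lessdot> p'" "p \<le> a" unfolding a_def using parent_covers[OF p'] le_parent[OF assms(1)] by auto
  have "a < p'" using a(1) by (simp add: covers_def)
  let ?Q = "{a..} - {p'..}"
  have "(\<Sum>x\<in>?Q. Var (U x p') * gen p x) \<in> (JU :: ('p, 'k) tree_poly set)"
    using a(2) by (intro JU.sum combinations_gen[OF ideal_u_positive] Var_u_positive) auto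
  also have "(\<Sum>x\<in>?Q. Var (U x p') * gen p x :: ('p, 'k) tree_poly)
      = Var (X1 p) * (\<Sum>x\<in>?Q. Var (X2 x) * Var (U x p')) - T p * (\<Sum>x\<in>?Q. Var (U x p') * S p x)"
    by (simp add: gen_def sum_distrib_left sum_subtractf algebra_simps)
  also have "(\<Sum>x\<in>?Q. Var (X2 x) * Var (U x p') :: ('p, 'k) tree_poly) = T p'"
    by (rule T_eq[OF a(1), symmetric])
  also have "(\<Sum>x\<in>?Q. Var (U x p') * S p x :: ('p, 'k) tree_poly)
      = path_prod p a * (\<Sum>x\<in>?Q. Var (U x p') * S a x)"
    unfolding sum_distrib_left using a(2) by (intro sum.cong) (auto simp: S_split[of p a] algebra_simps)
  also have "\<dots> = Var (X1 p') * path_prod p p'"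
    unfolding S_T[OF a(1)] path_prod_split[OF a(2) less_imp_le[OF \<open>a < p'\<close>]] path_prod_child[OF a(1)]
    by (rule mult.left_commute)
  finally have "Var (X1 p) * T p' - T p * (Var (X1 p') * path_prod p p') \<in> (JU :: ('p, 'k) tree_poly set)" .
  from JU.mult[OF this, of "S p' q"]
  show ?thesis unfolding gen_def S_split[OF less_imp_le[OF assms(1)] assms(2)] by (simp add: algebra_simps)
qed

text \<open>
  Both generators reduce the product of the leading monomials to the product of the tails.
\<close>

lemma spair_coprime:
  assumes "p \<le> q" "p' \<le> q'"
  shows "Var (X1 p') * Var (X2 q') * gen p q - Var (X1 p) * Var (X2 q) * gen p' q'
    \<in> (JU :: ('p, 'k::comm_ring_1) tree_poly set)"
proof -
  interpret JU: ideal_set "JU :: ('p, 'k) tree_poly set" by (rule ideal_JU)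
  have TS: "T p * S p q \<in> mspan u_positive" for p q
    using ideal_set.mult_right[OF ideal_u_positive T_u_positive] .
  have "T p' * S p' q' * gen p q - T p * S p q * gen p' q' \<in> (JU :: ('p, 'k) tree_poly set)"
    using assms by (intro JU.diff combinations_gen ideal_u_positive TS)
  then show ?thesis by (simp add: gen_def algebra_simps)
qed


lemma gen_hom: "gen p q \<in> homog (card {p..} + 1)" if "p \<le> q"
proof -
  have "2 + (card {p..} - 1) = card {p..} + 1" using card_atLeast[of p] by simp
  then have "T p * S p q \<in> homog (card {p..} + 1)"
    using mspan_graded_mult[OF T_hom S_hom[OF that]] by metis
  then show ?thesis unfolding gen_def by (rule mspan_diff[OF mspan_graded_mult[OF X1_hom X2_hom]])
qed

definition lead :: "'p \<Rightarrow> 'p \<Rightarrow> ('p tree_var \<Rightarrow>\<^sub>0 nat)"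
  where "lead p q = Poly_Mapping.single (X1 p) 1 + Poly_Mapping.single (X2 q) 1"

lemma mon_lead: "mon (lead p q) = Var (X1 p) * Var (X2 q)"
  unfolding lead_def mon_add Var_eq_mon ..

lemma weight_lead: "weight x_weight (lead p q) = card {p..} + 1" "weight u_weight (lead p q) = 0"
  by (simp_all add: lead_def weight_add weight_single)

text \<open>
  In a homogeneous combination of the generators the coefficients may be taken to be homogeneous. If each
  of their monomials contains a \<open>u\<close>-variable, then the degree in the \<open>x\<close>-variables is strictly smaller than the
  total degree \<open>d\<close>.
\<close>

lemma JU_lower:
  fixes F :: "('p, 'k::comm_ring_1) tree_poly"
  assumes F: "F \<in> JU" "F \<in> homog d" and C: "linear_subspace C"
    and lower: "\<And>\<kappa> p q. p \<le> q \<Longrightarrow> \<kappa> \<in> u_positive \<Longrightarrow> weight total_weight \<kappa> + (card {p..} + 1) = d \<Longrightarrow>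
      mon \<kappa> * gen p q \<in> C"
  shows "F \<in> C"
proof -
  obtain h where h: "\<And>e. h e \<in> mspan u_positive" "F = (\<Sum>e\<in>{(p, q). p \<le> q}. h e * case_prod gen e)"
    using F(1) by (rule combinationsE) blast
  let ?part = "\<lambda>e. restrict_monomials (\<lambda>\<mu>. weight total_weight \<mu> + (card {fst e..} + 1) = d) (h e)"
  have "F = restrict_monomials (\<lambda>\<mu>. weight total_weight \<mu> = d) F"
    by (rule restrict_monomials_id[symmetric], rule mspan_mono[OF F(2)]) (auto simp: graded_def)
  also have "\<dots> = (\<Sum>e\<in>{(p, q). p \<le> q}. ?part e * case_prod gen e)"
    unfolding h(2) restrict_monomials_sum
  proof (rule sum.cong[OF refl])
    fix e :: "'p \<times> 'p" assume "e \<in> {(p, q). p \<le> q}"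
    then obtain p q where e: "e = (p, q)" "p \<le> q" by auto
    show "restrict_monomials (\<lambda>\<mu>. weight total_weight \<mu> = d) (h e * case_prod gen e) = ?part e * case_prod gen e"
      unfolding e(1) case_prod_conv fst_conv by (rule restrict_monomials_homogeneous_mult[OF gen_hom[OF e(2)]])
  qed
  also have "\<dots> \<in> C"
  proof (rule linear_subspace_sum[OF C])
    fix e :: "'p \<times> 'p" assume "e \<in> {(p, q). p \<le> q}"
    then obtain p q where e: "e = (p, q)" "p \<le> q" by auto
    show "?part e * case_prod gen e \<in> C"
      unfolding e(1) case_prod_conv fst_conv
      by (rule linear_subspace_mon_mult[OF C restrict_monomials_mspan[OF h(1)]]) (use lower[OF e(2)] in blast)
  qed
  finally show ?thesis .
qed

text \<open>
  The monomials \<open>a\<close> and \<open>b\<close> of the S-polynomial are free of \<open>u\<close>-variables, so the total degree of the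
  S-polynomial is the degree in the \<open>x\<close>-variables of the common multiple of the leading monomials. The
  factor \<open>c\<close> may contain \<open>u\<close>-variables.
\<close>

lemma spair_lower:
  fixes C :: "('p, 'k::comm_ring_1) tree_poly set"
  assumes le: "p \<le> q" "p' \<le> q'" and C: "linear_subspace C"
    and lower: "\<And>c p q. p \<le> q \<Longrightarrow> weight x_weight (c + lead p q) < w \<Longrightarrow> mon c * gen p q \<in> C"
    and spair: "mon a * gen p q - mon b * gen p' q' \<in> (JU :: ('p, 'k) tree_poly set)"
    and eq: "a + lead p q = b + lead p' q'"
    and a: "keys a \<subseteq> x_vars" and b: "keys b \<subseteq> x_vars"
    and w: "w = weight x_weight (c + a + lead p q)"
  shows "mon (c + a) * gen p q - mon (c + b) * gen p' q' \<in> C"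
proof -
  define d where "d = weight x_weight (a + lead p q)"
  have u0: "weight u_weight \<mu> = 0" if "keys \<mu> \<subseteq> x_vars" for \<mu> :: "'p tree_var \<Rightarrow>\<^sub>0 nat"
    using that unfolding weight_eq_0_iff x_vars_def by fastforce
  have x: "weight total_weight \<mu> = weight x_weight \<mu>" if "keys \<mu> \<subseteq> x_vars" for \<mu> :: "'p tree_var \<Rightarrow>\<^sub>0 nat"
    using u0[OF that] by (simp add: weight_total)
  have mon_hom: "mon \<mu> \<in> homog (weight x_weight \<mu>)" if "keys \<mu> \<subseteq> x_vars" for \<mu> :: "'p tree_var \<Rightarrow>\<^sub>0 nat"
    by (rule mspan_single) (use that x[OF that] in \<open>auto simp: graded_def\<close>)
  have d': "d = weight x_weight (b + lead p' q')" unfolding d_def eq ..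
  have 1: "mon a * gen p q \<in> homog d"
    using mspan_graded_mult[OF mon_hom[OF a] gen_hom[OF le(1)]]
    unfolding d_def weight_add[of _ _ "lead p q"] weight_lead .
  have 2: "mon b * gen p' q' \<in> homog d"
    using mspan_graded_mult[OF mon_hom[OF b] gen_hom[OF le(2)]]
    unfolding d' weight_add[of _ _ "lead p' q'"] weight_lead .
  define C' where "C' = {f. mon c * f \<in> C}"
  have C': "linear_subspace C'"
    unfolding linear_subspace_def C'_def
    by (auto simp: distrib_left mult.left_commute[of _ "Const _"] linear_subspaceD[OF C])
  have "mon a * gen p q - mon b * gen p' q' \<in> C'"
  proof (rule JU_lower[OF spair mspan_diff[OF 1 2] C'])
    fix \<kappa> :: "'p tree_var \<Rightarrow>\<^sub>0 nat" and r s :: 'p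
    assume rs: "r \<le> s" and \<kappa>: "\<kappa> \<in> u_positive"
      and wt: "weight total_weight \<kappa> + (card {r..} + 1) = d"
    have "weight x_weight \<kappa> < weight total_weight \<kappa>" using \<kappa> by (simp add: u_positive_def weight_total)
    then have "weight x_weight (c + \<kappa> + lead r s) < w"
      using wt unfolding w d_def weight_add weight_lead by linarith
    then have "mon (c + \<kappa>) * gen r s \<in> C" by (rule lower[OF rs])
    then show "mon \<kappa> * gen r s \<in> C'" unfolding C'_def mon_add by (simp add: mult.assoc)
  qed
  then show ?thesis unfolding C'_def mon_add by (simp add: right_diff_distrib mult.assoc)
qed

lemma J_standard:
  fixes f :: "('p, 'k::comm_ring_1) tree_poly"
  assumes f: "f \<in> J" and standard: "\<And>a p q. p \<le> q \<Longrightarrow> a + lead p q \<notin> keys f"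
  shows "f = 0"
proof -
  obtain h where h: "f = (\<Sum>e\<in>{(p, q). p \<le> q}. h e * case_prod gen e)" using f by (rule combinationsE)
  show ?thesis
  proof (rule standard_monomials_independent[where E = "{(p, q). p \<le> q}" and l = "case_prod lead"
        and t = "\<lambda>(p, q). T p * S p q" and w = "weight x_weight", OF weight_add _ _ _ h])
    fix e :: "'p \<times> 'p" assume "e \<in> {(p, q). p \<le> q}"
    then obtain p q where e: "e = (p, q)" "p \<le> q" by auto
    show "case_prod gen e = mon (case_prod lead e) - (case e of (p, q) \<Rightarrow> T p * S p q)"
      unfolding e by (simp add: gen_def mon_lead)
    show "a + case_prod lead e \<notin> keys f" for a
      using standard[OF e(2)] e(1) by simp
    fix \<kappa> assume "\<kappa> \<in> keys (case e of (p, q) \<Rightarrow> (T p * S p q :: ('p, 'k) tree_poly))"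
    then have \<kappa>: "\<kappa> \<in> keys (T p * S p q :: ('p, 'k) tree_poly)" by (simp add: e)
    have "(T p * S p q :: ('p, 'k) tree_poly) \<in> homog (2 + (card {p..} - 1))"
      by (rule mspan_graded_mult[OF T_hom S_hom[OF e(2)]])
    then have "weight total_weight \<kappa> = card {p..} + 1"
      using \<kappa> card_atLeast[of p] by (auto simp: mspan_def graded_def)
    moreover have "(T p * S p q :: ('p, 'k) tree_poly) \<in> mspan u_positive"
      by (rule ideal_set.mult_right[OF ideal_u_positive T_u_positive])
    then have "weight u_weight \<kappa> > 0" using \<kappa> by (auto simp: mspan_def u_positive_def)
    ultimately show "weight x_weight \<kappa> < weight x_weight (case_prod lead e)"
      by (simp add: e weight_lead weight_total)
  next
    fix e e' :: "'p \<times> 'p" and a b and C :: "('p, 'k) tree_poly set"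
    assume "e \<in> {(p, q). p \<le> q}" "e' \<in> {(p, q). p \<le> q}"
    then obtain p q p' q' where e: "e = (p, q)" "p \<le> q" "e' = (p', q')" "p' \<le> q'" by auto
    assume ab': "a + case_prod lead e = b + case_prod lead e'" and C: "linear_subspace C"
      and "\<And>c e''. e'' \<in> {(p, q). p \<le> q} \<Longrightarrow>
        weight x_weight (c + case_prod lead e'') < weight x_weight (a + case_prod lead e) \<Longrightarrow>
        mon c * case_prod gen e'' \<in> C"
    then have lower: "\<And>c r s. r \<le> s \<Longrightarrow> weight x_weight (c + lead r s) < weight x_weight (a + lead p q) \<Longrightarrow>
        mon c * gen r s \<in> C"
      unfolding e by fastforce
    have ab: "a + lead p q = b + lead p' q'" using ab' by (simp add: e)
    let ?x1 = "\<lambda>p. Poly_Mapping.single (X1 p :: 'p tree_var) (1 :: nat)"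
    let ?x2 = "\<lambda>q. Poly_Mapping.single (X2 q :: 'p tree_var) (1 :: nat)"
    let ?thesis' = "mon a * gen p q - mon b * gen p' q' \<in> C"
    have fin: ?thesis' if "a = c + a0" "b = c + b0"
      "mon a0 * gen p q - mon b0 * gen p' q' \<in> (JU :: ('p, 'k) tree_poly set)"
      "a0 + lead p q = b0 + lead p' q'"
      "keys a0 \<subseteq> x_vars" "keys b0 \<subseteq> x_vars" for a0 b0 c
      unfolding that(1,2) by (rule spair_lower[OF e(2,4) C lower that(3-6)]) (simp_all add: that(1))
    consider "p = p'" "q = q'" | "p = p'" "q \<noteq> q'" | "p \<noteq> p'" "q = q'" | "p \<noteq> p'" "q \<noteq> q'" by blast
    then have ?thesis'
    proof cases
      case 1
      then have "a = b" using ab by simp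
      then show ?thesis using 1 linear_subspaceD(1)[OF C] by simp
    next
      case 2
      have "(a + ?x2 q) + ?x1 p = (b + ?x2 q') + ?x1 p" using ab 2 by (simp only: lead_def ac_simps)
      then have "a + ?x2 q = b + ?x2 q'" by (rule add_right_imp_eq)
      then obtain c where c: "a = c + ?x2 q'" "b = c + ?x2 q"
        by (rule common_multiple_decomp) (use 2 in simp)
      show ?thesis
      proof (rule fin[OF c])
        show "mon (?x2 q') * gen p q - mon (?x2 q) * gen p' q' \<in> (JU :: ('p, 'k) tree_poly set)"
          using spair_same_first[of p q q'] e 2 by (simp add: Var_eq_mon)
      qed (simp_all add: lead_def 2 x_vars_def add.left_commute add.commute)
    next
      case 3
      have "(a + ?x1 p) + ?x2 q = (b + ?x1 p') + ?x2 q" using ab 3 by (simp only: lead_def ac_simps)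
      then have "a + ?x1 p = b + ?x1 p'" by (rule add_right_imp_eq)
      then obtain c where c: "a = c + ?x1 p'" "b = c + ?x1 p"
        by (rule common_multiple_decomp) (use 3 in simp)
      have "Var (X1 p') * gen p q - Var (X1 p) * gen p' q \<in> (JU :: ('p, 'k) tree_poly set)"
      proof (cases "p < p'")
        case True
        then show ?thesis using e 3 by (intro spair_same_second) auto
      next
        case False
        then have "p' < p" using comparable_below[of p q p'] e 3 by auto
        from ideal_set.uminus[OF ideal_JU spair_same_second[OF this e(2)]] show ?thesis by simp
      qed
      then have "mon (?x1 p') * gen p q - mon (?x1 p) * gen p' q' \<in> (JU :: ('p, 'k) tree_poly set)"
        using 3 by (simp add: Var_eq_mon)
      from c this show ?thesis
        by (rule fin) (simp_all add: lead_def 3 x_vars_def add.left_commute add.commute)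
    next
      case 4
      obtain c where c: "a = c + lead p' q'" "b = c + lead p q"
      proof (rule common_multiple_decomp[OF ab])
        have "keys (lead p q) \<subseteq> {X1 p, X2 q}" for p q
          using Poly_Mapping.keys_add[of "?x1 p" "?x2 q"] by (auto simp: lead_def)
        then show "keys (lead p q) \<inter> keys (lead p' q') = {}" using 4 by blast
      qed
      have x: "keys (lead p q) \<subseteq> x_vars" for p q
        using Poly_Mapping.keys_add[of "?x1 p" "?x2 q"] by (auto simp: lead_def x_vars_def)
      show ?thesis
      proof (rule fin[OF c])
        show "mon (lead p' q') * gen p q - mon (lead p q) * gen p' q' \<in> (JU :: ('p, 'k) tree_poly set)"
          using spair_coprime[OF e(2,4)] unfolding mon_lead .
      qed (rule add.commute, rule x, rule x)
    qed
    then show "mon a * case_prod gen e - mon b * case_prod gen e' \<in> C" by (simp add: e)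
  qed
qed

section \<open>Normal forms\<close>

text \<open>
  The standard monomials, with arbitrary \<open>u\<close>-variables. So their span is a module over \<open>B\<close>, free on the
  standard monomials in the \<open>x\<close>-variables.
\<close>

definition std :: "('p tree_var \<Rightarrow>\<^sub>0 nat) set"
  where "std = {\<mu>. keys \<mu> \<subseteq> vars \<and>
    (\<forall>p q. p \<le> q \<longrightarrow> X1 p \<in> keys \<mu> \<longrightarrow> X2 q \<notin> keys \<mu>)}"

lemma keys_add_lead: "X1 p \<in> keys (a + lead p q)" "X2 q \<in> keys (a + lead p q)"
  by (auto simp: in_keys_iff lookup_add lead_def)

lemma J_std:
  assumes "f \<in> J" "f \<in> mspan std"
  shows "f = 0"
proof (rule J_standard[OF assms(1)])
  fix a p q assume "(p :: 'p) \<le> q"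
  then have "a + lead p q \<notin> std" using keys_add_lead unfolding std_def by blast
  then show "a + lead p q \<notin> keys f" using assms(2) unfolding mspan_def by blast
qed

lemma nonstd_decomp:
  assumes "keys \<mu> \<subseteq> vars" "\<mu> \<notin> std"
  obtains a p q where "p \<le> q" "\<mu> = a + lead p q" "keys a \<subseteq> vars"
proof -
  obtain p q where pq: "p \<le> q" "X1 p \<in> keys \<mu>" "X2 q \<in> keys \<mu>"
    using assms unfolding std_def by blast
  have "\<mu> = (\<mu> - lead p q) + lead p q"
  proof (rule poly_mapping_eqI)
    fix v
    have "lookup (lead p q) v \<le> lookup \<mu> v"
      using pq by (auto simp: lead_def lookup_add lookup_single when_def in_keys_iff)
    then show "lookup \<mu> v = lookup (\<mu> - lead p q + lead p q) v"
      by (simp add: lookup_add lookup_minus)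
  qed
  moreover have "keys (\<mu> - lead p q) \<subseteq> keys \<mu>"
    by (auto simp: in_keys_iff lookup_minus)
  ultimately show ?thesis using that[OF pq(1)] assms(1) by blast
qed

abbreviation pring :: "('p, 'k::comm_ring_1) tree_poly ring"
  where "pring \<equiv> poly_ring vars"

lemma hom_carrier: "f \<in> homog d \<Longrightarrow> f \<in> carrier pring"
  unfolding carrier_poly_ring by (erule mspan_mono) (auto simp: graded_def)

lemma T_carrier: "T p \<in> carrier pring"
  using T_hom by (rule hom_carrier)

lemma S_carrier: "p \<le> q \<Longrightarrow> S p q \<in> carrier pring"
  using S_hom by (rule hom_carrier)

lemma gen_carrier: "p \<le> q \<Longrightarrow> gen p q \<in> carrier pring"
  using gen_hom by (rule hom_carrier)

lemma J_ideal_eq: "J_ideal = Idl\<^bsub>pring\<^esub> {gen p q | p q. p \<le> q}"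
  unfolding J_ideal_def gen_def ..

end

lemma ideal_poly_ring:
  fixes K :: "('v, 'k::comm_ring_1) mpoly set"
  assumes "0 \<in> K" "\<And>f g. f \<in> K \<Longrightarrow> g \<in> K \<Longrightarrow> f + g \<in> K"
    "\<And>r f. r \<in> carrier (poly_ring V) \<Longrightarrow> f \<in> K \<Longrightarrow> r * f \<in> K" "K \<subseteq> carrier (poly_ring V)"
  shows "ideal K (poly_ring V)"
proof (rule idealI)
  interpret cring "poly_ring V :: ('v, 'k) mpoly ring" by (rule cring_poly_ring)
  show ring: "ring (poly_ring V :: ('v, 'k) mpoly ring)" by (rule ring_axioms)
  show "subgroup K (add_monoid (poly_ring V))"
  proof (rule add.subgroupI)
    fix f assume f: "f \<in> K"
    have "- 1 * f \<in> K" by (rule assms(3)[OF _ f]) (use a_inv_closed in \<open>simp add: carrier_poly_ring mspan_uminus poly_ring_1[unfolded carrier_poly_ring]\<close>)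
    moreover have "\<ominus>\<^bsub>poly_ring V\<^esub> f = - f"
      by (rule minus_equality) (use f assms(4) in \<open>auto simp: poly_ring_def ring_on_def mspan_uminus carrier_poly_ring[unfolded poly_ring_def carrier_ring_on] subset_iff\<close>)
    ultimately show "\<ominus>\<^bsub>poly_ring V\<^esub> f \<in> K" by simp
  qed (use assms in \<open>auto simp: poly_ring_def ring_on_def\<close>)
  fix f r :: "('v, 'k) mpoly" assume f: "f \<in> K" "r \<in> carrier (poly_ring V)"
  show "r \<otimes>\<^bsub>poly_ring V\<^esub> f \<in> K" "f \<otimes>\<^bsub>poly_ring V\<^esub> r \<in> K"
    using assms(3)[OF f(2,1)] by (simp_all add: poly_ring_def mult_ring_on mult.commute)
qed

lemma poly_ring_simps:
  "x \<otimes>\<^bsub>poly_ring V\<^esub> y = x * y" "\<one>\<^bsub>poly_ring V\<^esub> = 1" "\<zero>\<^bsub>poly_ring V\<^esub> = 0" "x \<oplus>\<^bsub>poly_ring V\<^esub> y = x + y"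
  by (simp_all add: poly_ring_def ring_on_def)

text \<open>
  Ideals of a polynomial ring are ideals of a ring with a carrier; these rules allow to calculate in them
  with the operations of the type.
\<close>

lemma mem_poly_ideal:
  fixes K :: "('v, 'k::comm_ring_1) mpoly set"
  assumes "ideal K (poly_ring V)"
  shows "K \<subseteq> carrier (poly_ring V)" "0 \<in> K" "f \<in> K \<Longrightarrow> g \<in> K \<Longrightarrow> f + g \<in> K"
    "f \<in> K \<Longrightarrow> - f \<in> K" "f \<in> K \<Longrightarrow> g \<in> K \<Longrightarrow> f - g \<in> K"
    "r \<in> carrier (poly_ring V) \<Longrightarrow> f \<in> K \<Longrightarrow> r * f \<in> K" "f \<in> K \<Longrightarrow> Const c * f \<in> K"
proof -
  interpret ideal K "poly_ring V" by fact
  show sub: "K \<subseteq> carrier (poly_ring V)" by (rule a_subset)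
  show "0 \<in> K" using additive_subgroup.zero_closed[OF is_additive_subgroup] by (simp add: poly_ring_simps)
  show add: "f \<in> K \<Longrightarrow> g \<in> K \<Longrightarrow> f + g \<in> K" for f g using additive_subgroup.a_closed[OF is_additive_subgroup, of f g] by (simp add: poly_ring_simps)
  show mult: "r \<in> carrier (poly_ring V) \<Longrightarrow> f \<in> K \<Longrightarrow> r * f \<in> K" for r f
    using I_l_closed[of f r] by (simp add: poly_ring_simps)
  show C: "f \<in> K \<Longrightarrow> Const c * f \<in> K" for f c by (rule mult[OF poly_ring_Const])
  show minus: "f \<in> K \<Longrightarrow> - f \<in> K" for f using C[of f "- 1"] by (simp add: Const_def single_uminus)
  show "f \<in> K \<Longrightarrow> g \<in> K \<Longrightarrow> f - g \<in> K" using add[of f "- g"] minus[of g] by simp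
qed

context rooted_tree
begin

lemma ideal_J_ideal: "ideal (J_ideal :: ('p, 'k::comm_ring_1) tree_poly set) pring"
  unfolding J_ideal_eq
  by (rule ring.genideal_ideal[OF cring.axioms(1)[OF cring_poly_ring]]) (use gen_carrier in blast)

lemma gen_J_ideal:
  assumes "p \<le> q"
  shows "gen p q \<in> J_ideal"
proof -
  have "{gen p q | p q. p \<le> q} \<subseteq> carrier (pring :: ('p, 'k::comm_ring_1) tree_poly ring)"
    using gen_carrier by blast
  from ring.genideal_self[OF cring.axioms(1)[OF cring_poly_ring] this]
  show ?thesis using assms unfolding J_ideal_eq by blast
qed

lemma J_ideal_subset: "(J_ideal :: ('p, 'k::comm_ring_1) tree_poly set) \<subseteq> J"
proof -
  interpret J: ideal_set "J :: ('p, 'k) tree_poly set" by (rule ideal_J)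
  have "ideal (J \<inter> carrier pring) (pring :: ('p, 'k) tree_poly ring)"
  proof (rule ideal_poly_ring)
    show "0 \<in> (J \<inter> carrier pring :: ('p, 'k) tree_poly set)" using J.zero by (simp add: carrier_poly_ring)
    fix f g :: "('p, 'k) tree_poly" assume "f \<in> (J \<inter> carrier pring :: ('p, 'k) tree_poly set)" "g \<in> J \<inter> carrier pring"
    then show "f + g \<in> J \<inter> carrier pring" using J.add by (simp add: carrier_poly_ring mspan_add)
  next
    fix r f :: "('p, 'k) tree_poly" assume "r \<in> carrier pring" "f \<in> (J \<inter> carrier pring :: ('p, 'k) tree_poly set)"
    then show "r * f \<in> J \<inter> carrier pring" using J.mult poly_ring_mult_closed by blast
  qed blast
  moreover have "{gen p q | p q. p \<le> q} \<subseteq> (J \<inter> carrier pring :: ('p, 'k) tree_poly set)"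
    using gen_J gen_carrier by blast
  ultimately have "Idl\<^bsub>pring\<^esub> {gen p q | p q. p \<le> q} \<subseteq> (J \<inter> carrier pring :: ('p, 'k) tree_poly set)"
    by (rule ring.genideal_minimal[OF cring.axioms(1)[OF cring_poly_ring]])
  then show ?thesis unfolding J_ideal_eq by blast
qed

text \<open>
  Rewriting a leading monomial with a generator lowers the degree in the \<open>x\<close>-variables.
\<close>

lemma std_exists:
  fixes f :: "('p, 'k::comm_ring_1) tree_poly"
  assumes "f \<in> carrier pring"
  shows "\<exists>g\<in>mspan std. f - g \<in> J_ideal"
proof -
  note J = mem_poly_ideal[OF ideal_J_ideal]
  let ?G = "\<lambda>f :: ('p, 'k) tree_poly. \<exists>g\<in>mspan std. f - g \<in> J_ideal"
  have G_zero: "?G 0" using J(2) by (intro bexI[of _ 0]) simp_all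
  have G_add: "?G (f + f')" if "?G f" "?G f'" for f f'
  proof -
    from that obtain g g' where g: "g \<in> mspan std" "g' \<in> mspan std" "f - g \<in> J_ideal" "f' - g' \<in> J_ideal" by blast
    then show ?thesis using J(3)[OF g(3,4)] by (intro bexI[of _ "g + g'"]) (auto simp: algebra_simps mspan_add)
  qed
  have G_smult: "?G (Const c * f)" if G: "?G f" for f c
  proof -
    from G obtain g where g: "g \<in> mspan std" "f - g \<in> J_ideal" by blast
    show ?thesis
      by (rule bexI[of _ "Const c * g"])
        (use J(7)[OF g(2), of c] mspan_Const_mult[OF g(1)] in \<open>simp_all only: right_diff_distrib\<close>)
  qed
  have G_mon: "?G (mon \<mu>)" if "keys \<mu> \<subseteq> vars" for \<mu>
    using that
  proof (induction "weight x_weight \<mu>" arbitrary: \<mu> rule: less_induct)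
    case less
    show ?case
    proof (cases "\<mu> \<in> std")
      case True
      then show ?thesis using J(2) by (intro bexI[of _ "mon \<mu>"]) (simp_all add: mspan_single)
    next
      case False
      obtain a p q where apq: "p \<le> q" "\<mu> = a + lead p q" "keys a \<subseteq> vars"
        by (rule nonstd_decomp[OF less.prems False])
      let ?X = "{\<nu>. keys \<nu> \<subseteq> vars \<and> weight x_weight \<nu> < weight x_weight \<mu>}"
      have a: "mon a \<in> carrier (pring :: ('p, 'k) tree_poly ring)"
        unfolding carrier_poly_ring by (rule mspan_single) (use apq in simp)
      have "T p * S p q \<in> (mspan {\<nu>. keys \<nu> \<subseteq> vars \<and> weight x_weight \<nu> < card {p..} + 1} :: ('p, 'k) tree_poly set)"
      proof -
        have "(T p * S p q :: ('p, 'k) tree_poly) \<in> homog (2 + (card {p..} - 1))"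
          by (rule mspan_graded_mult[OF T_hom S_hom[OF apq(1)]])
        moreover have "(T p * S p q :: ('p, 'k) tree_poly) \<in> mspan u_positive"
          by (rule ideal_set.mult_right[OF ideal_u_positive T_u_positive])
        ultimately show ?thesis
          using card_atLeast[of p] by (fastforce simp: mspan_def graded_def u_positive_def weight_total)
      qed
      then have "mon a * (T p * S p q) \<in> (mspan ?X :: ('p, 'k) tree_poly set)"
        by (rule mspan_mult[OF mspan_single[OF singletonI]])
          (use apq Poly_Mapping.keys_add in \<open>fastforce simp: weight_add weight_lead\<close>)+
      then have TS: "?G (mon a * (T p * S p q))"
      proof (induction rule: mspan_induct)
        case (mon \<nu>)
        then show ?case by (intro less.hyps) simp_all
      qed (rule G_zero G_add G_smult; assumption)+
      have "mon a * gen p q \<in> (J_ideal :: ('p, 'k) tree_poly set)"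
        by (rule J(6)[OF a gen_J_ideal[OF apq(1)]])
      then have "?G (mon a * gen p q)" by (intro bexI[of _ 0]) simp_all
      from G_add[OF this TS] show ?thesis unfolding apq(2) mon_add mon_lead gen_def
        by (simp add: algebra_simps)
    qed
  qed
  from assms[unfolded carrier_poly_ring] show ?thesis
  proof (induction rule: mspan_induct)
    case (mon \<mu>)
    then show ?case by (intro G_mon) simp
  qed (rule G_zero G_add G_smult; assumption)+
qed

lemma std_unique:
  fixes f :: "('p, 'k::comm_ring_1) tree_poly"
  assumes "f \<in> mspan std" "g \<in> mspan std" "f - g \<in> J_ideal"
  shows "f = g"
  using J_std[of "f - g"] J_ideal_subset assms mspan_diff by auto

end

section \<open>Coefficients over a subset of the variables\<close>

definition drop_vars :: "'v set \<Rightarrow> ('v \<Rightarrow>\<^sub>0 nat) \<Rightarrow> ('v \<Rightarrow>\<^sub>0 nat)"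
  where "drop_vars W \<mu> = Poly_Mapping.mapp (\<lambda>v n. if v \<in> W then 0 else n) \<mu>"

lemma lookup_drop_vars: "lookup (drop_vars W \<mu>) v = (if v \<in> W then 0 else lookup \<mu> v)"
  by (simp add: drop_vars_def lookup_mapp when_def in_keys_iff)

text \<open>
  The coefficient of \<open>m\<close> in a polynomial over the ring of polynomials in the variables from \<open>W\<close>.
\<close>

definition coeff_over :: "'v set \<Rightarrow> ('v \<Rightarrow>\<^sub>0 nat) \<Rightarrow> ('v, 'k::comm_ring_1) mpoly \<Rightarrow> ('v, 'k) mpoly"
  where "coeff_over W m = linext Const (\<lambda>\<mu>. if drop_vars W \<mu> = m then mon (\<mu> - m) else 0)"

lemma coeff_over_add: "coeff_over W m (f + g) = coeff_over W m f + coeff_over W m g"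
  unfolding coeff_over_def by (rule Const.linext_add)

lemma coeff_over_0: "coeff_over W m 0 = 0"
  unfolding coeff_over_def by (rule Const.linext_0)

lemma coeff_over_Const_mult: "coeff_over W m (Const c * f) = Const c * coeff_over W m f"
  unfolding coeff_over_def by (rule Const.linext_Const_mult)

lemma coeff_over_mon: "coeff_over W m (mon \<mu>) = (if drop_vars W \<mu> = m then mon (\<mu> - m) else 0)"
  unfolding coeff_over_def by (rule Const.linext_mon)

lemma coeff_over_mult:
  fixes b f :: "('v, 'k::comm_ring_1) mpoly"
  assumes b: "b \<in> mspan {\<nu>. keys \<nu> \<subseteq> W}"
  shows "coeff_over W m (b * f) = b * coeff_over W m f"
proof -
  have "coeff_over W m (b * f) = linext Const mon b * coeff_over W m f"
    unfolding coeff_over_def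
  proof (rule Const.linext_mult[OF _ b])
    fix \<nu> \<mu> :: "'v \<Rightarrow>\<^sub>0 nat"
    assume "\<nu> \<in> {\<nu>. keys \<nu> \<subseteq> W}"
    then have \<nu>: "lookup \<nu> v = 0" if "v \<notin> W" for v
      using that by (auto simp: in_keys_iff)
    have drop_vars: "drop_vars W (\<nu> + \<mu>) = drop_vars W \<mu>"
      by (rule poly_mapping_eqI) (simp add: lookup_drop_vars lookup_add \<nu>)
    have "\<nu> + \<mu> - m = \<nu> + (\<mu> - m)" if "drop_vars W \<mu> = m"
      unfolding that[symmetric]
      by (rule poly_mapping_eqI) (simp add: lookup_drop_vars lookup_add lookup_minus \<nu>)
    then show "(if drop_vars W (\<nu> + \<mu>) = m then mon (\<nu> + \<mu> - m) else 0)
        = mon \<nu> * (if drop_vars W \<mu> = m then mon (\<mu> - m) else 0 :: ('v, 'k) mpoly)"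
      unfolding drop_vars by (simp add: mon_add)
  qed
  moreover have "linext Const mon b = b"
    unfolding linext_def by (rule mpoly_expand[symmetric])
  ultimately show ?thesis by simp
qed

lemma coeff_over_mspan: "coeff_over W m f \<in> mspan {\<nu>. keys \<nu> \<subseteq> W}"
proof -
  have "f \<in> mspan UNIV" by (simp add: mspan_def)
  then show ?thesis
  proof (induction f rule: mspan_induct)
    case (mon \<mu>)
    have "keys (\<mu> - drop_vars W \<mu>) \<subseteq> W"
      by (auto simp: in_keys_iff lookup_minus lookup_drop_vars split: if_splits)
    then show ?case by (auto simp: coeff_over_mon intro: mspan_single)
  qed (simp_all only: coeff_over_0 coeff_over_add coeff_over_Const_mult mspan_0 mspan_add mspan_Const_mult)
qed

lemma coeff_over_expand:
  fixes f :: "('a, 'b::comm_ring_1) mpoly"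
  assumes "finite A" and f: "f \<in> mspan {\<mu>. drop_vars W \<mu> \<in> A}"
  shows "f = (\<Sum>m\<in>A. coeff_over W m f * mon m)"
  using f
proof (induction f rule: mspan_induct)
  case (mon \<mu>)
  have "\<mu> - drop_vars W \<mu> + drop_vars W \<mu> = \<mu>"
    by (rule poly_mapping_eqI) (simp add: lookup_add lookup_minus lookup_drop_vars)
  then have "(\<Sum>m\<in>A. coeff_over W m (mon \<mu>) * mon m) = (\<Sum>m\<in>A. if drop_vars W \<mu> = m then mon \<mu> else 0 :: ('a, 'b) mpoly)"
    by (intro sum.cong) (auto simp: coeff_over_mon simp flip: mon_add)
  then have "(\<Sum>m\<in>A. coeff_over W m (mon \<mu>) * mon m) = (mon \<mu> :: ('a, 'b) mpoly)"
    using mon assms(1) by simp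
  then show ?case by (rule sym)
next
  case (add f g)
  then show ?case by (simp add: coeff_over_add distrib_right sum.distrib)
next
  case (smult c f)
  then show ?case by (simp add: coeff_over_Const_mult mult.assoc flip: sum_distrib_left)
qed (simp add: coeff_over_0)

lemma coeff_over_eq_0:
  assumes f: "f \<in> mspan {\<mu>. drop_vars W \<mu> \<noteq> m}"
  shows "coeff_over W m f = 0"
  using f by (induction f rule: mspan_induct)
    (simp_all add: coeff_over_0 coeff_over_add coeff_over_Const_mult coeff_over_mon)

section \<open>Algebras as modules\<close>

lemma algebra_via_simps:
  "carrier (algebra_via h A) = carrier A" "x \<oplus>\<^bsub>algebra_via h A\<^esub> y = x \<oplus>\<^bsub>A\<^esub> y"
  "x \<otimes>\<^bsub>algebra_via h A\<^esub> y = x \<otimes>\<^bsub>A\<^esub> y" "\<zero>\<^bsub>algebra_via h A\<^esub> = \<zero>\<^bsub>A\<^esub>" "\<one>\<^bsub>algebra_via h A\<^esub> = \<one>\<^bsub>A\<^esub>"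
  "r \<odot>\<^bsub>algebra_via h A\<^esub> x = h r \<otimes>\<^bsub>A\<^esub> x"
  by (simp_all add: algebra_via_def)

lemma abelian_group_algebra_via:
  assumes "abelian_group A"
  shows "abelian_group (algebra_via h A)"
proof -
  interpret A: abelian_group A by fact
  show ?thesis
  proof (rule abelian_groupI)
    fix x assume "x \<in> carrier (algebra_via h A)"
    then show "\<exists>y\<in>carrier (algebra_via h A). y \<oplus>\<^bsub>algebra_via h A\<^esub> x = \<zero>\<^bsub>algebra_via h A\<^esub>"
      unfolding algebra_via_simps by (intro bexI[of _ "\<ominus>\<^bsub>A\<^esub> x"]) (simp_all add: A.l_neg)
  qed (simp_all add: algebra_via_simps A.a_assoc A.a_comm A.a_lcomm)
qed

lemma finsum_algebra_via:
  assumes "abelian_group A" "finite I" "f \<in> I \<rightarrow> carrier A"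
  shows "finsum (algebra_via h A) f I = finsum A f I"
  using assms(2,3)
proof (induction I)
  interpret A: abelian_group A by fact
  interpret A': abelian_group "algebra_via h A" using assms(1) by (rule abelian_group_algebra_via)
  case empty
  then show ?case by (simp add: algebra_via_simps)
next
  interpret A: abelian_group A by fact
  interpret A': abelian_group "algebra_via h A" using assms(1) by (rule abelian_group_algebra_via)
  case (insert i I)
  then have "f i \<in> carrier A" "f \<in> I \<rightarrow> carrier A" by auto
  then show ?case using insert A.finsum_insert[of I i f] A'.finsum_insert[of I i f]
    by (simp add: algebra_via_simps)
qed

lemma module_algebra_via:
  assumes "cring R" "cring A" "h \<in> Ring.ring_hom R A"
  shows "module R (algebra_via h A)"
proof -
  interpret R: cring R by fact
  interpret A: cring A by fact
  have h: "h r \<in> carrier A" if "r \<in> carrier R" for r using ring_hom_closed[OF assms(3) that] .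
  show ?thesis
    by (rule moduleI)
      (use h assms(3) in \<open>auto simp: algebra_via_simps R.is_cring ring_hom_add ring_hom_mult ring_hom_one
        A.l_distr A.r_distr A.m_assoc intro!: abelian_group_algebra_via A.abelian_group_axioms\<close>)
qed

lemma cring_algebra_via:
  assumes "cring A"
  shows "cring (algebra_via h A)"
proof -
  interpret A: cring A by fact
  show ?thesis
  proof (rule cringI)
    show "abelian_group (algebra_via h A)"
      by (rule abelian_group_algebra_via) (rule A.abelian_group_axioms)
    show "Group.comm_monoid (algebra_via h A)"
      by (rule comm_monoidI) (simp_all add: algebra_via_simps A.m_assoc A.m_comm A.m_lcomm)
  qed (simp add: algebra_via_simps A.l_distr)
qed

section \<open>Quotients of polynomial rings\<close>

lemma finsum_poly_ring:
  fixes f :: "'i \<Rightarrow> ('v, 'k::comm_ring_1) mpoly"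
  assumes "finite A" "f \<in> A \<rightarrow> carrier (poly_ring V)"
  shows "finsum (poly_ring V) f A = (\<Sum>i\<in>A. f i)"
  using assms
proof (induction A)
  interpret cring "poly_ring V :: ('v, 'k) mpoly ring" by (rule cring_poly_ring)
  case empty
  then show ?case by (simp add: poly_ring_simps)
next
  interpret cring "poly_ring V :: ('v, 'k) mpoly ring" by (rule cring_poly_ring)
  case (insert i A)
  then show ?case by (simp add: poly_ring_simps Pi_iff)
qed

lemma mem_coset_poly_ring:
  "g \<in> K +>\<^bsub>poly_ring V\<^esub> f \<longleftrightarrow> g - f \<in> (K :: ('v, 'k::comm_ring_1) mpoly set)"
proof -
  have "K +>\<^bsub>poly_ring V\<^esub> f = (\<lambda>h. h + f) ` K"
    by (auto simp: a_r_coset_def r_coset_def poly_ring_def ring_on_def)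
  then show ?thesis by (auto simp: image_iff intro: bexI[of _ "g - f"])
qed

lemma coset_poly_ring_eq_iff:
  fixes K :: "('v, 'k::comm_ring_1) mpoly set"
  assumes "ideal K (poly_ring V)"
  shows "K +>\<^bsub>poly_ring V\<^esub> f = K +>\<^bsub>poly_ring V\<^esub> g \<longleftrightarrow> f - g \<in> K"
proof
  note K = mem_poly_ideal[OF assms]
  assume "K +>\<^bsub>poly_ring V\<^esub> f = K +>\<^bsub>poly_ring V\<^esub> g"
  moreover have "f \<in> K +>\<^bsub>poly_ring V\<^esub> f" using K(2) by (simp add: mem_coset_poly_ring)
  ultimately show "f - g \<in> K" by (simp add: mem_coset_poly_ring)
next
  note K = mem_poly_ideal[OF assms]
  assume fg: "f - g \<in> K"
  have "h - f \<in> K \<longleftrightarrow> h - g \<in> K" for h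
    using K(3)[of "h - f" "f - g"] K(5)[of "h - g" "f - g"] fg by auto
  then show "K +>\<^bsub>poly_ring V\<^esub> f = K +>\<^bsub>poly_ring V\<^esub> g" by (auto simp: mem_coset_poly_ring)
qed

lemma carrier_poly_quotient:
  "carrier (poly_ring V Quot K) = {K +>\<^bsub>poly_ring V\<^esub> f | f. f \<in> carrier (poly_ring V)}"
  unfolding FactRing_def A_RCOSETS_def' by auto

lemma poly_quotient_simps:
  fixes K :: "('v, 'k::comm_ring_1) mpoly set"
  assumes "ideal K (poly_ring V)" "f \<in> carrier (poly_ring V)" "g \<in> carrier (poly_ring V)"
  shows "(K +>\<^bsub>poly_ring V\<^esub> f) \<oplus>\<^bsub>poly_ring V Quot K\<^esub> (K +>\<^bsub>poly_ring V\<^esub> g) = K +>\<^bsub>poly_ring V\<^esub> (f + g)"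
    "(K +>\<^bsub>poly_ring V\<^esub> f) \<otimes>\<^bsub>poly_ring V Quot K\<^esub> (K +>\<^bsub>poly_ring V\<^esub> g) = K +>\<^bsub>poly_ring V\<^esub> (f * g)"
  using ring_hom_add[OF ideal.rcos_ring_hom[OF assms(1)] assms(2,3)]
    ring_hom_mult[OF ideal.rcos_ring_hom[OF assms(1)] assms(2,3)]
  by (simp_all only: poly_ring_simps)

context rooted_tree
begin

section \<open>Flatness of the deformation\<close>

abbreviation Jcos :: "('p, 'k::comm_ring_1) tree_poly \<Rightarrow> ('p, 'k) tree_poly set"
  where "Jcos f \<equiv> J_ideal +>\<^bsub>pring\<^esub> f"

lemma cring_quotient: "cring (pring Quot (J_ideal :: ('p, 'k::comm_ring_1) tree_poly set))"
  by (rule ideal.quotient_is_cring[OF ideal_J_ideal cring_poly_ring])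

lemma B_carrier: "b \<in> carrier B_ring \<Longrightarrow> b \<in> carrier pring"
  unfolding B_ring_def carrier_poly_ring by (erule mspan_mono) auto

lemma cos_ring_hom: "Jcos \<in> Ring.ring_hom B_ring (pring Quot (J_ideal :: ('p, 'k::comm_ring_1) tree_poly set))"
proof -
  have hom: "Jcos \<in> Ring.ring_hom pring (pring Quot (J_ideal :: ('p, 'k) tree_poly set))"
    by (rule ideal.rcos_ring_hom[OF ideal_J_ideal])
  show ?thesis
  proof (rule ring_hom_memI)
    fix x y :: "('p, 'k) tree_poly"
    assume "x \<in> carrier B_ring"
    then have x: "x \<in> carrier pring" by (rule B_carrier)
    show "Jcos x \<in> carrier (pring Quot J_ideal)" by (rule ring_hom_closed[OF hom x])
    assume "y \<in> carrier B_ring"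
    then have y: "y \<in> carrier pring" by (rule B_carrier)
    show "Jcos (x \<otimes>\<^bsub>B_ring\<^esub> y) = Jcos x \<otimes>\<^bsub>pring Quot J_ideal\<^esub> Jcos y"
      using ring_hom_mult[OF hom x y] by (simp add: B_ring_def poly_ring_simps)
    show "Jcos (x \<oplus>\<^bsub>B_ring\<^esub> y) = Jcos x \<oplus>\<^bsub>pring Quot J_ideal\<^esub> Jcos y"
      using ring_hom_add[OF hom x y] by (simp add: B_ring_def poly_ring_simps)
  next
    show "Jcos \<one>\<^bsub>B_ring\<^esub> = \<one>\<^bsub>pring Quot (J_ideal :: ('p, 'k) tree_poly set)\<^esub>"
      using ring_hom_one[OF hom] by (simp add: B_ring_def poly_ring_simps)
  qed
qed

lemma module_deformation:
  "module B_ring (deformation :: (('p, 'k::comm_ring_1) tree_poly, ('p, 'k) tree_poly set) module)"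
  unfolding deformation_def
  by (rule module_algebra_via[OF _ cring_quotient cos_ring_hom]) (simp add: B_ring_def cring_poly_ring)

definition std_rep :: "('p, 'k::comm_ring_1) tree_poly set \<Rightarrow> ('p, 'k) tree_poly"
  where "std_rep y = (THE g. g \<in> mspan std \<and> g \<in> y)"

lemma std_rep_eqI:
  fixes f :: "('p, 'k::comm_ring_1) tree_poly"
  assumes "g \<in> mspan std" "f - g \<in> J_ideal"
  shows "std_rep (Jcos f) = g"
  unfolding std_rep_def
proof (rule the_equality)
  note J = mem_poly_ideal[OF ideal_J_ideal]
  show "g \<in> mspan std \<and> g \<in> Jcos f"
    using assms(1) J(4)[OF assms(2)] by (simp add: mem_coset_poly_ring)
  fix g' assume g': "g' \<in> mspan std \<and> g' \<in> Jcos f"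
  then have "g' - f + (f - g) \<in> J_ideal" by (intro J(3) assms(2)) (simp add: mem_coset_poly_ring)
  then show "g' = g" using std_unique[of g' g] assms(1) g' by simp
qed

lemma std_rep:
  fixes f :: "('p, 'k::comm_ring_1) tree_poly"
  assumes "f \<in> carrier pring"
  shows "std_rep (Jcos f) \<in> mspan std" "f - std_rep (Jcos f) \<in> J_ideal"
  using std_exists[OF assms] std_rep_eqI by metis+

lemma std_carrier: "f \<in> mspan std \<Longrightarrow> f \<in> carrier pring"
  unfolding carrier_poly_ring by (erule mspan_mono) (auto simp: std_def)

lemma B_mult_std:
  assumes "b \<in> carrier B_ring" "f \<in> mspan std"
  shows "b * f \<in> mspan std"
proof (rule mspan_mult)
  show "b \<in> mspan {\<nu>. keys \<nu> \<subseteq> u_vars}"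
    using assms(1) by (simp add: B_ring_def carrier_poly_ring)
  show "f \<in> mspan std" by fact
  fix \<nu> \<mu> :: "'p tree_var \<Rightarrow>\<^sub>0 nat"
  assume \<nu>: "\<nu> \<in> {\<nu>. keys \<nu> \<subseteq> u_vars}" and \<mu>: "\<mu> \<in> std"
  have X1: "X1 p \<in> keys \<mu>" if "X1 p \<in> keys (\<nu> + \<mu>)" for p
    using that \<nu> Poly_Mapping.keys_add[of \<nu> \<mu>] by (auto simp: u_vars_def)
  have X2: "X2 p \<in> keys \<mu>" if "X2 p \<in> keys (\<nu> + \<mu>)" for p
    using that \<nu> Poly_Mapping.keys_add[of \<nu> \<mu>] by (auto simp: u_vars_def)
  have "keys \<nu> \<subseteq> vars" "keys \<mu> \<subseteq> vars" using \<mu> \<nu> by (auto simp: std_def)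
  then have "keys (\<nu> + \<mu>) \<subseteq> vars" by (rule order_trans[OF Poly_Mapping.keys_add Un_least])
  moreover have "X2 q \<notin> keys (\<nu> + \<mu>)"
    if "p \<le> q" "X1 p \<in> keys (\<nu> + \<mu>)" for p q
    using \<mu> that(1) X1[OF that(2)] X2[of q] unfolding std_def by blast
  ultimately show "\<nu> + \<mu> \<in> std" by (simp add: std_def)
qed

text \<open>
  The coordinates of a class are the coefficients over \<open>B\<close> of its unique standard representative, indexed by
  the standard monomials without \<open>u\<close>-variables. They are linear because the standard polynomials are a
  \<open>B\<close>-submodule.
\<close>

theorem deformation_flat:
  "flat_module TYPE('a) TYPE('b) B_ring
    (deformation :: (('p, 'k::comm_ring_1) tree_poly, ('p, 'k) tree_poly set) module)"
proof -
  note J = mem_poly_ideal[OF ideal_J_ideal]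
  let ?M = "deformation :: (('p, 'k) tree_poly, ('p, 'k) tree_poly set) module"
  define I where "I = {m \<in> std. keys m \<inter> u_vars = {}}"
  define c where "c m y = coeff_over u_vars m (std_rep y)" for m and y :: "('p, 'k) tree_poly set"
  have M: "carrier ?M = {Jcos f | f. f \<in> carrier pring}"
    unfolding deformation_def algebra_via_simps carrier_poly_quotient ..
  have drop_vars: "drop_vars u_vars \<mu> \<in> I" if "\<mu> \<in> std" for \<mu>
  proof -
    have "keys (drop_vars u_vars \<mu>) = keys \<mu> - u_vars"
      by (auto simp: in_keys_iff lookup_drop_vars split: if_splits)
    then show ?thesis using that unfolding I_def std_def by auto
  qed
  show ?thesis
  proof (rule dual_basis_imp_flat[where I = I and e = "\<lambda>m. Jcos (mon m)" and c = c])
    show "module B_ring ?M" by (rule module_deformation)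
  next
    fix m assume "m \<in> I"
    then show "Jcos (mon m) \<in> carrier ?M"
      using std_carrier[OF mspan_single] unfolding M I_def by blast
  next
    fix m y
    show "c m y \<in> carrier B_ring"
      unfolding c_def B_ring_def carrier_poly_ring by (rule coeff_over_mspan)
  next
    fix m y z assume "y \<in> carrier ?M" "z \<in> carrier ?M"
    then obtain f g where fg: "f \<in> carrier pring" "g \<in> carrier pring" "y = Jcos f" "z = Jcos g" unfolding M by blast
    have "std_rep (Jcos (f + g)) = std_rep y + std_rep z"
      using J(3)[OF std_rep(2)[OF fg(1)] std_rep(2)[OF fg(2)]] unfolding fg
      by (intro std_rep_eqI mspan_add std_rep(1) fg(1,2)) (simp add: algebra_simps)
    moreover have "y \<oplus>\<^bsub>?M\<^esub> z = Jcos (f + g)"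
      unfolding fg deformation_def algebra_via_simps by (rule poly_quotient_simps(1)[OF ideal_J_ideal fg(1,2)])
    ultimately show "c m (y \<oplus>\<^bsub>?M\<^esub> z) = c m y \<oplus>\<^bsub>B_ring\<^esub> c m z"
      by (simp add: c_def coeff_over_add B_ring_def poly_ring_simps)
  next
    fix m y and b :: "('p, 'k) tree_poly" assume b: "b \<in> carrier B_ring" and "y \<in> carrier ?M"
    then obtain f where f: "f \<in> carrier pring" "y = Jcos f" unfolding M by blast
    have "b * f - b * std_rep y \<in> J_ideal"
      unfolding right_diff_distrib[symmetric] f(2) by (rule J(6)[OF B_carrier[OF b] std_rep(2)[OF f(1)]])
    then have "std_rep (Jcos (b * f)) = b * std_rep y"
      using B_mult_std[OF b std_rep(1)[OF f(1)]] unfolding f(2) by (intro std_rep_eqI)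
    moreover have "b \<odot>\<^bsub>?M\<^esub> y = Jcos (b * f)"
      unfolding f(2) deformation_def algebra_via_simps
      by (rule poly_quotient_simps(2)[OF ideal_J_ideal B_carrier[OF b] f(1)])
    ultimately show "c m (b \<odot>\<^bsub>?M\<^esub> y) = b \<otimes>\<^bsub>B_ring\<^esub> c m y"
      using coeff_over_mult[of b u_vars] b by (simp add: c_def B_ring_def poly_ring_simps carrier_poly_ring)
  next
    fix y assume "y \<in> carrier ?M"
    then obtain f where f: "f \<in> carrier pring" "y = Jcos f" unfolding M by blast
    define g where "g = std_rep y"
    have g: "g \<in> mspan std" "f - g \<in> J_ideal" using std_rep[OF f(1)] unfolding g_def f(2) by auto
    define A where "A = drop_vars u_vars ` keys g"
    have AI: "A \<subseteq> I" using drop_vars g(1) unfolding A_def mspan_def by blast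
    have gA: "g \<in> mspan {\<mu>. drop_vars u_vars \<mu> \<in> A}" unfolding mspan_def A_def by blast
    have "coeff_over u_vars m g = 0" if "m \<notin> A" for m
      by (rule coeff_over_eq_0, rule mspan_mono[OF gA]) (use that in blast)
    then have supp: "{m \<in> I. c m y \<noteq> \<zero>\<^bsub>B_ring\<^esub>} = {m \<in> A. coeff_over u_vars m g \<noteq> 0}"
      using AI unfolding c_def g_def[symmetric] by (auto simp: B_ring_def poly_ring_simps)
    then show fin: "finite {m \<in> I. c m y \<noteq> \<zero>\<^bsub>B_ring\<^esub>}" by (simp add: A_def)
    let ?A = "{m \<in> A. coeff_over u_vars m g \<noteq> 0}"
    have "g = (\<Sum>m\<in>A. coeff_over u_vars m g * mon m)"
      by (rule coeff_over_expand[OF _ gA]) (simp add: A_def)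
    also have "\<dots> = (\<Sum>m\<in>?A. coeff_over u_vars m g * mon m)"
      by (intro sum.mono_neutral_right) (auto simp: A_def)
    finally have g_sum: "g = (\<Sum>m\<in>?A. coeff_over u_vars m g * mon m)" .
    have B: "coeff_over u_vars m g \<in> carrier pring" for m
      by (rule B_carrier) (simp add: B_ring_def carrier_poly_ring coeff_over_mspan)
    have mon: "mon m \<in> carrier (pring :: ('p, 'k) tree_poly ring)" if "m \<in> A" for m
      using that AI std_carrier[OF mspan_single[of m std]] unfolding I_def by blast
    have prod: "(\<lambda>m. coeff_over u_vars m g * mon m) \<in> ?A \<rightarrow> carrier pring"
      using B mon by (intro Pi_I poly_ring_mult_closed) auto
    interpret hom: ring_hom_cring pring "pring Quot (J_ideal :: ('p, 'k) tree_poly set)" Jcos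
      by (rule ideal.rcos_ring_hom_cring[OF ideal_J_ideal cring_poly_ring])
    have "y = Jcos g" unfolding f(2) using coset_poly_ring_eq_iff[OF ideal_J_ideal] g(2) by blast
    also have "g = finsum pring (\<lambda>m. coeff_over u_vars m g * mon m) ?A"
      by (subst finsum_poly_ring[OF _ prod]) (simp add: A_def, rule g_sum)
    also have "Jcos \<dots> = finsum (pring Quot J_ideal) (Jcos \<circ> (\<lambda>m. coeff_over u_vars m g * mon m)) ?A"
      by (rule hom.hom_finsum[OF prod])
    also have "\<dots> = finsum ?M (\<lambda>m. c m y \<odot>\<^bsub>?M\<^esub> Jcos (mon m)) ?A"
    proof -
      have cm: "Jcos (coeff_over u_vars m g * mon m) = c m y \<odot>\<^bsub>?M\<^esub> Jcos (mon m)" if "m \<in> A" for m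
        unfolding deformation_def algebra_via_simps c_def g_def[symmetric]
        by (rule poly_quotient_simps(2)[OF ideal_J_ideal B mon[OF that], symmetric])
      have closed: "Jcos (coeff_over u_vars m g * mon m) \<in> carrier (pring Quot J_ideal)" if "m \<in> A" for m
        by (intro hom.hom_closed poly_ring_mult_closed B mon that)
      have "finsum (pring Quot J_ideal) (Jcos \<circ> (\<lambda>m. coeff_over u_vars m g * mon m)) ?A
          = finsum (pring Quot J_ideal) (\<lambda>m. c m y \<odot>\<^bsub>?M\<^esub> Jcos (mon m)) ?A"
        by (rule hom.S.finsum_cong') (use cm closed in auto)
      also have "\<dots> = finsum ?M (\<lambda>m. c m y \<odot>\<^bsub>?M\<^esub> Jcos (mon m)) ?A"
        unfolding deformation_def
        by (rule finsum_algebra_via[symmetric, OF hom.S.abelian_group_axioms])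
          (use cm closed in \<open>auto simp: A_def deformation_def simp flip: cm\<close>)
      finally show ?thesis .
    qed
    finally show "y = (\<Oplus>\<^bsub>?M\<^esub>m\<in>{m \<in> I. c m y \<noteq> \<zero>\<^bsub>B_ring\<^esub>}. c m y \<odot>\<^bsub>?M\<^esub> Jcos (mon m))"
      unfolding supp .
  qed
qed

end

section \<open>Tensor products of algebras\<close>

locale algebra_pair = module_pair R M N
  for R :: "('r, 'z) ring_scheme" and M :: "('r, 'm, 'x) module_scheme"
    and N :: "('r, 'n, 'y) module_scheme" +
  assumes cring_M: "cring M" and cring_N: "cring N"
    and smult_mult_M: "\<And>r x y. r \<in> carrier R \<Longrightarrow> x \<in> carrier M \<Longrightarrow> y \<in> carrier M \<Longrightarrow>
      (r \<odot>\<^bsub>M\<^esub> x) \<otimes>\<^bsub>M\<^esub> y = r \<odot>\<^bsub>M\<^esub> (x \<otimes>\<^bsub>M\<^esub> y)"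
    and smult_mult_N: "\<And>r x y. r \<in> carrier R \<Longrightarrow> x \<in> carrier N \<Longrightarrow> y \<in> carrier N \<Longrightarrow>
      (r \<odot>\<^bsub>N\<^esub> x) \<otimes>\<^bsub>N\<^esub> y = r \<odot>\<^bsub>N\<^esub> (x \<otimes>\<^bsub>N\<^esub> y)"
begin

definition frag_mult :: "('m \<times> 'n \<Rightarrow>\<^sub>0 int) \<Rightarrow> ('m \<times> 'n \<Rightarrow>\<^sub>0 int) \<Rightarrow> ('m \<times> 'n \<Rightarrow>\<^sub>0 int)"
  where "frag_mult s t = frag_extend (\<lambda>(x, y). frag_extend (\<lambda>(x', y').
    frag_of (x \<otimes>\<^bsub>M\<^esub> x', y \<otimes>\<^bsub>N\<^esub> y')) t) s"

lemma frag_mult_of: "frag_mult (frag_of (x, y)) (frag_of (x', y')) = frag_of (x \<otimes>\<^bsub>M\<^esub> x', y \<otimes>\<^bsub>N\<^esub> y')"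
  by (simp add: frag_mult_def)

lemma frag_mult_left: "frag_mult 0 t = 0" "frag_mult (s + s') t = frag_mult s t + frag_mult s' t"
    "frag_mult (- s) t = - frag_mult s t" "frag_mult (s - s') t = frag_mult s t - frag_mult s' t"
  by (simp_all add: frag_mult_def frag_extend_add frag_extend_minus frag_extend_diff)

lemma frag_mult_of_right:
  "frag_mult (frag_of z) 0 = 0" "frag_mult (frag_of z) (t - t') = frag_mult (frag_of z) t - frag_mult (frag_of z) t'"
  by (cases z; simp add: frag_mult_def frag_extend_diff)+

lemma frag_mult_right: "frag_mult s (t - t') = frag_mult s t - frag_mult s t'"
proof -
  have "keys s \<subseteq> UNIV" by simp
  then show ?thesis
    by (induction s rule: frag_induction) (simp_all add: frag_mult_left frag_mult_of_right algebra_simps)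
qed

lemma frag_mult_right_0: "frag_mult s 0 = 0"
  using frag_mult_right[of s 0 0] by simp

lemma frag_mult_commute:
  assumes "s \<in> frags" "t \<in> frags"
  shows "frag_mult s t = frag_mult t s"
proof -
  interpret M: cring M by (rule cring_M)
  interpret N: cring N by (rule cring_N)
  have *: "frag_mult (frag_of z) t = frag_mult t (frag_of z)" if z: "z \<in> carrier M \<times> carrier N" for z
  proof -
    have "keys t \<subseteq> carrier M \<times> carrier N" using assms(2) by simp
    then show ?thesis
    proof (induction t rule: frag_induction)
      case (one z')
      then show ?case using z by (auto simp: frag_mult_of M.m_comm N.m_comm)
    qed (simp_all add: frag_mult_left frag_mult_of_right)
  qed
  have "keys s \<subseteq> carrier M \<times> carrier N" using assms(1) by simp
  then show ?thesis
    by (induction s rule: frag_induction) (simp_all add: frag_mult_left frag_mult_right frag_mult_right_0 *)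
qed

lemma frag_mult_rel_left:
  assumes "s \<in> rel" "t \<in> frags"
  shows "frag_mult s t \<in> rel"
proof -
  interpret M: cring M by (rule cring_M)
  interpret N: cring N by (rule cring_N)
  have gen: "frag_mult g t \<in> rel" if g: "g \<in> gens" for g
  proof -
    have "keys t \<subseteq> carrier M \<times> carrier N" using assms(2) by simp
    then show ?thesis
    proof (induction t rule: frag_induction)
      case zero
      then show ?case by (simp add: frag_mult_right_0 rel_zero)
    next
      case (one z)
      then obtain u v where z: "z = (u, v)" "u \<in> carrier M" "v \<in> carrier N" by auto
      from g show ?case
      proof (cases rule: gens_cases)
        case (add_left x x' y)
        show ?thesis
          unfolding add_left(1) z(1) frag_mult_left frag_mult_of M.l_distr[OF add_left(2,3) z(2)]
          by (intro rel_add_left M.m_closed N.m_closed add_left z)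
      next
        case (add_right x y y')
        show ?thesis
          unfolding add_right(1) z(1) frag_mult_left frag_mult_of N.l_distr[OF add_right(3,4) z(3)]
          by (intro rel_add_right M.m_closed N.m_closed add_right z)
      next
        case (smult r x y)
        show ?thesis
          unfolding smult(1) z(1) frag_mult_left frag_mult_of smult_mult_M[OF smult(2,3) z(2)]
            smult_mult_N[OF smult(2,4) z(3)]
          by (intro rel_smult M.m_closed N.m_closed smult z)
      qed
    next
      case (diff a b)
      then show ?case unfolding frag_mult_right by (intro rel_diff)
    qed
  qed
  have "frag_mult s t \<in> rel \<and> s \<in> frags"
    using assms(1)
  proof (induction rule: rel_induct)
    case (gen g)
    then show ?case by (rule \<open>\<And>g. g \<in> gens \<Longrightarrow> frag_mult g t \<in> rel\<close>)
  next
    case zero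
    show ?case unfolding frag_mult_left by (rule rel_zero)
  next
    case (add s s')
    then show ?case unfolding frag_mult_left by (intro rel_add)
  next
    case (uminus s)
    then show ?case unfolding frag_mult_left by (intro rel_uminus)
  qed
  then show ?thesis ..
qed

lemma mem_cls_frags:
  assumes "s' \<in> cls s" "s \<in> frags"
  shows "s' \<in> frags"
proof -
  have "s' - s \<in> frags" using assms(1) rel_subset unfolding mem_cls_iff by blast
  from frags_add[OF this assms(2)] show ?thesis by simp
qed

text \<open>
  The union over all representatives that defines the product has a single value, since the relations
  are stable under multiplication. By commutativity it is enough to know this for the left factor.
\<close>

lemma mult_tensor_product:
  assumes s: "s \<in> frags" and t: "t \<in> frags"
  shows "cls s \<otimes>\<^bsub>tensor_product R M N\<^esub> cls t = cls (frag_mult s t)"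
proof -
  have "cls s \<otimes>\<^bsub>tensor_product R M N\<^esub> cls t = (\<Union>s'\<in>cls s. \<Union>t'\<in>cls t. cls (frag_mult s' t'))"
    by (simp add: tensor_product_def frag_mult_def)
  also have "\<dots> = (\<Union>s'\<in>cls s. cls (frag_mult s' t))"
  proof (intro SUP_cong refl UN_cls cls_eqI)
    fix s' t' assume "s' \<in> cls s" "t' \<in> cls t"
    then have s': "s' \<in> frags" and t': "t' - t \<in> rel" using mem_cls_frags s by (auto simp: mem_cls_iff)
    have "frag_mult s' (t' - t) = frag_mult (t' - t) s'"
      by (rule frag_mult_commute[OF s' rel_subset[OF t']])
    then show "frag_mult s' t' - frag_mult s' t \<in> rel"
      using frag_mult_rel_left[OF t' s'] by (simp add: frag_mult_right)
  qed
  also have "\<dots> = cls (frag_mult s t)"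
  proof (intro UN_cls cls_eqI)
    fix s' assume "s' \<in> cls s"
    then have "frag_mult (s' - s) t \<in> rel" using t by (intro frag_mult_rel_left) (simp_all add: mem_cls_iff)
    then show "frag_mult s' t - frag_mult s t \<in> rel" by (simp add: frag_mult_left)
  qed
  finally show ?thesis .
qed

end

section \<open>Setting the \<open>u\<close>-variables to zero\<close>

lemma mon_eq_prod_Var:
  "(\<Prod>v\<in>keys \<mu>. Var v ^ lookup \<mu> v) = (mon \<mu> :: ('v, 'k::comm_ring_1) mpoly)"
proof -
  have pow: "(Var v :: ('v, 'k) mpoly) ^ n = mon (Poly_Mapping.single v n)" for v n
    by (induction n) (simp_all add: Var_def mult_single single_add[symmetric] flip: single_one)
  have prod: "(\<Prod>v\<in>A. mon (m v)) = (mon (\<Sum>v\<in>A. m v) :: ('v, 'k) mpoly)" for A and m :: "'v \<Rightarrow> 'v \<Rightarrow>\<^sub>0 nat"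
    by (induction A rule: infinite_finite_induct) (simp_all add: mon_add flip: single_one)
  have "(\<Sum>v\<in>keys \<mu>. Poly_Mapping.single v (lookup \<mu> v)) = \<mu>"
    by (rule poly_mapping_eqI) (auto simp: lookup_sum lookup_single when_def in_keys_iff)
  then show ?thesis unfolding pow prod by simp
qed

lemma set_u_zero_add: "set_u_zero (f + g) = set_u_zero f + set_u_zero g"
  unfolding set_u_zero_def by (rule Const.poly_eval_add)

lemma set_u_zero_mult: "set_u_zero (f * g) = set_u_zero f * set_u_zero g"
  unfolding set_u_zero_def by (rule Const.poly_eval_mult)

lemma set_u_zero_Const: "set_u_zero (Const c) = Const c"
  unfolding set_u_zero_def by (rule Const.poly_eval_Const)

lemma set_u_zero_0: "set_u_zero 0 = 0"
  using set_u_zero_Const[of 0] by simp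

lemma set_u_zero_diff: "set_u_zero (f - g) = set_u_zero f - set_u_zero g"
  using set_u_zero_add[of "f - g" g] by simp

lemma set_u_zero_mon:
  "set_u_zero (mon \<mu>) = (if keys \<mu> \<subseteq> x_vars then mon \<mu> else 0 :: ('a, 'b::comm_ring_1) tree_poly)"
proof -
  have "set_u_zero (mon \<mu>) = (\<Prod>v\<in>keys \<mu>.
      (if v \<in> x_vars then Var v else 0 :: ('a, 'b) tree_poly) ^ lookup \<mu> v)"
    unfolding set_u_zero_def Const.poly_eval_eq_linext Const.linext_mon ..
  also have "\<dots> = (if keys \<mu> \<subseteq> x_vars then mon \<mu> else 0)"
  proof (cases "keys \<mu> \<subseteq> x_vars")
    case True
    then have "(\<Prod>v\<in>keys \<mu>. (if v \<in> x_vars then Var v else 0) ^ lookup \<mu> v)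
        = (\<Prod>v\<in>keys \<mu>. Var v ^ lookup \<mu> v :: ('a, 'b) tree_poly)"
      by (intro prod.cong) auto
    then show ?thesis using True by (simp add: mon_eq_prod_Var)
  next
    case False
    then obtain v where v: "v \<in> keys \<mu>" "v \<notin> x_vars" by blast
    then have "(if v \<in> x_vars then Var v else 0 :: ('a, 'b) tree_poly) ^ lookup \<mu> v = 0"
      by (simp add: in_keys_iff zero_power)
    then have "(\<Prod>v\<in>keys \<mu>. (if v \<in> x_vars then Var v else 0) ^ lookup \<mu> v)
        = (0 :: ('a, 'b) tree_poly)"
      by (intro prod_zero bexI[of _ v]) (use v in auto)
    then show ?thesis using False by simp
  qed
  finally show ?thesis .
qed

context rooted_tree
begin

abbreviation xring :: "('p, 'k::comm_ring_1) tree_poly ring"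
  where "xring \<equiv> poly_ring x_vars"

lemma xring_subset: "f \<in> carrier xring \<Longrightarrow> f \<in> carrier pring"
  unfolding carrier_poly_ring by (erule mspan_mono) auto

lemma set_u_zero_xring: "f \<in> carrier xring \<Longrightarrow> set_u_zero f = f"
  unfolding carrier_poly_ring
  by (induction f rule: mspan_induct)
    (simp_all add: set_u_zero_0 set_u_zero_add set_u_zero_mult set_u_zero_Const set_u_zero_mon)

lemma set_u_zero_closed: "set_u_zero f \<in> carrier xring"
proof -
  have "f \<in> mspan UNIV" by (simp add: mspan_def)
  then show ?thesis unfolding carrier_poly_ring
    by (induction f rule: mspan_induct)
      (simp_all add: set_u_zero_0 set_u_zero_add set_u_zero_mult set_u_zero_Const set_u_zero_mon
        mspan_add mspan_Const_mult mspan_single)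
qed

abbreviation u_multiples :: "('p tree_var \<Rightarrow>\<^sub>0 nat) set"
  where "u_multiples \<equiv> {\<mu> \<in> u_positive. keys \<mu> \<subseteq> vars}"

text \<open>
  A monomial is either unchanged or has a \<open>u\<close>-variable.
\<close>

lemma diff_set_u_zero: "f \<in> carrier pring \<Longrightarrow> f - set_u_zero f \<in> mspan u_multiples"
  unfolding carrier_poly_ring
proof (induction f rule: mspan_induct)
  case (add f g)
  then have "(f - set_u_zero f) + (g - set_u_zero g) \<in> mspan u_multiples" by (intro mspan_add)
  then show ?case by (simp add: set_u_zero_add algebra_simps)
next
  case (smult c f)
  then have "Const c * (f - set_u_zero f) \<in> mspan u_multiples" by (intro mspan_Const_mult)
  then show ?case by (simp add: set_u_zero_mult set_u_zero_Const right_diff_distrib)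
next
  case (mon \<mu>)
  show ?case
  proof (cases "keys \<mu> \<subseteq> x_vars")
    case False
    then obtain v where v: "v \<in> keys \<mu>" "v \<in> u_vars" using mon by blast
    then have "u_weight v \<noteq> 0" by (auto simp: u_vars_def)
    then have "\<mu> \<in> u_positive" using v(1) weight_eq_0_iff[of u_weight \<mu>] by (auto simp: u_positive_def)
    then show ?thesis using mon False by (simp add: set_u_zero_mon mspan_single)
  qed (simp add: set_u_zero_mon)
qed (simp add: set_u_zero_0)

lemma set_u_zero_u_positive: "f \<in> mspan u_positive \<Longrightarrow> set_u_zero f = 0"
proof (induction f rule: mspan_induct)
  case (mon \<mu>)
  then obtain v where "v \<in> keys \<mu>" "u_weight v \<noteq> 0"
    using weight_eq_0_iff[of u_weight \<mu>] by (auto simp: u_positive_def)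
  then have "\<not> keys \<mu> \<subseteq> x_vars" by (auto simp: x_vars_def)
  then show ?case by (simp add: set_u_zero_mon)
qed (simp_all add: set_u_zero_0 set_u_zero_add set_u_zero_mult)

lemma L_ideal_eq: "L_ideal = Idl\<^bsub>xring\<^esub> {Var (X1 p) * Var (X2 q) | p q. p \<le> q}"
  unfolding L_ideal_def ..

lemma lead_carrier: "Var (X1 p) * Var (X2 q) \<in> carrier xring"
  by (intro poly_ring_mult_closed poly_ring_Var) (simp_all add: x_vars_def)

lemma ideal_L_ideal: "ideal (L_ideal :: ('p, 'k::comm_ring_1) tree_poly set) xring"
  unfolding L_ideal_eq
  by (rule ring.genideal_ideal[OF cring.axioms(1)[OF cring_poly_ring]]) (use lead_carrier in blast)

lemma lead_L_ideal:
  fixes p q :: 'p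
  assumes "p \<le> q"
  shows "Var (X1 p) * Var (X2 q) \<in> (L_ideal :: ('p, 'k::comm_ring_1) tree_poly set)"
proof -
  let ?G = "{Var (X1 p) * Var (X2 q) | p q. p \<le> q} :: ('p, 'k) tree_poly set"
  have "?G \<subseteq> carrier xring" using lead_carrier by blast
  from ring.genideal_self[OF cring.axioms(1)[OF cring_poly_ring] this]
  have "?G \<subseteq> L_ideal" unfolding L_ideal_eq .
  moreover have "Var (X1 p) * Var (X2 q) \<in> ?G" using assms by blast
  ultimately show "Var (X1 p) * Var (X2 q) \<in> (L_ideal :: ('p, 'k) tree_poly set)" by (rule subsetD)
qed

lemma set_u_zero_J_ideal:
  fixes f :: "('p, 'k::comm_ring_1) tree_poly"
  assumes "f \<in> J_ideal"
  shows "set_u_zero f \<in> L_ideal"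
proof -
  note L = mem_poly_ideal[OF ideal_L_ideal]
  let ?K = "{f \<in> carrier pring. set_u_zero f \<in> (L_ideal :: ('p, 'k) tree_poly set)}"
  have "ideal ?K pring"
  proof (rule ideal_poly_ring)
    show "0 \<in> ?K" using L(2) by (simp add: carrier_poly_ring set_u_zero_0)
    fix f g assume "f \<in> ?K" "g \<in> ?K"
    then have *: "f \<in> carrier pring" "g \<in> carrier pring" "set_u_zero f \<in> L_ideal" "set_u_zero g \<in> L_ideal" by auto
    have "f + g \<in> carrier pring" using *(1,2) unfolding carrier_poly_ring by (rule mspan_add)
    then show "f + g \<in> ?K" using L(3)[OF *(3,4)] by (simp only: set_u_zero_add mem_Collect_eq simp_thms)
  next
    fix r f :: "('p, 'k) tree_poly" assume "r \<in> carrier pring" "f \<in> ?K"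
    then have *: "r \<in> carrier pring" "f \<in> carrier pring" "set_u_zero f \<in> L_ideal" by auto
    show "r * f \<in> ?K"
      using L(6)[OF set_u_zero_closed *(3)] poly_ring_mult_closed[OF *(1,2)]
      by (simp only: set_u_zero_mult mem_Collect_eq simp_thms)
  qed blast
  moreover have "{gen p q | p q. p \<le> q} \<subseteq> ?K"
  proof
    fix g :: "('p, 'k) tree_poly" assume "g \<in> {gen p q | p q. p \<le> q}"
    then obtain p q where g: "g = gen p q" "p \<le> q" by blast
    have "set_u_zero g = Var (X1 p) * Var (X2 q)"
      unfolding g(1) gen_def set_u_zero_diff set_u_zero_xring[OF lead_carrier]
        set_u_zero_u_positive[OF ideal_set.mult_right[OF ideal_u_positive T_u_positive]] by simp
    then show "g \<in> ?K" using lead_L_ideal[OF g(2)] gen_carrier[OF g(2)] g(1) by simp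
  qed
  ultimately have "Idl\<^bsub>pring\<^esub> {gen p q | p q. p \<le> q} \<subseteq> ?K"
    by (rule ring.genideal_minimal[OF cring.axioms(1)[OF cring_poly_ring]])
  then show ?thesis using assms unfolding J_ideal_eq by blast
qed

section \<open>The special fibre\<close>

abbreviation Lcos :: "('p, 'k::comm_ring_1) tree_poly \<Rightarrow> ('p, 'k) tree_poly set"
  where "Lcos f \<equiv> L_ideal +>\<^bsub>xring\<^esub> f"

lemma eval_0_ring_hom:
  "poly_eval (\<lambda>c. c) (\<lambda>_. 0) \<in> Ring.ring_hom B_ring (ring_on (UNIV :: 'k::comm_ring_1 set))"
proof -
  interpret coefficient_hom "\<lambda>c :: 'k. c" by unfold_locales simp_all
  have "poly_eval (\<lambda>c. c) (\<lambda>_. 0 :: 'k) (1 :: ('p, 'k) tree_poly) = 1"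
    using poly_eval_Const[of "\<lambda>_. 0" 1] by simp
  then show ?thesis
    by (intro ring_hom_memI) (simp_all add: B_ring_def poly_ring_simps ring_on_def poly_eval_add poly_eval_mult)
qed

lemma cring_ring_on_UNIV: "cring (ring_on (UNIV :: 'k::comm_ring_1 set))"
  by (rule cring_ring_on) simp_all

lemma algebra_pair_special_fibre:
  "algebra_pair (B_ring :: ('p, 'k::comm_ring_1) tree_poly ring) deformation residue_field"
proof -
  let ?Q = "pring Quot (J_ideal :: ('p, 'k) tree_poly set)"
  interpret Q: cring ?Q by (rule cring_quotient)
  interpret k: cring "ring_on (UNIV :: 'k set)" by (rule cring_ring_on_UNIV)
  have k: "module (B_ring :: ('p, 'k) tree_poly ring) residue_field"
    unfolding residue_field_def
    by (rule module_algebra_via[OF _ cring_ring_on_UNIV eval_0_ring_hom]) (simp add: B_ring_def cring_poly_ring)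
  have pair: "module_pair (B_ring :: ('p, 'k) tree_poly ring) deformation residue_field"
    by (rule module_pair.intro[OF module_deformation k])
  show ?thesis
  proof (rule algebra_pair.intro[OF pair], rule algebra_pair_axioms.intro)
    show "cring (deformation :: (('p, 'k) tree_poly, ('p, 'k) tree_poly set) module)"
      unfolding deformation_def by (rule cring_algebra_via[OF cring_quotient])
    show "cring (residue_field :: (('p, 'k) tree_poly, 'k) module)"
      unfolding residue_field_def by (rule cring_algebra_via[OF cring_ring_on_UNIV])
  next
    fix r :: "('p, 'k) tree_poly" and x y :: "('p, 'k) tree_poly set"
    assume r: "r \<in> carrier B_ring" and x: "x \<in> carrier deformation" and y: "y \<in> carrier deformation"
    show "(r \<odot>\<^bsub>deformation\<^esub> x) \<otimes>\<^bsub>deformation\<^esub> y = r \<odot>\<^bsub>deformation\<^esub> (x \<otimes>\<^bsub>deformation\<^esub> y)"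
      using Q.m_assoc[OF ring_hom_closed[OF cos_ring_hom r]] x y
      unfolding deformation_def algebra_via_simps by blast
  next
    fix r :: "('p, 'k) tree_poly" and x y :: 'k
    show "(r \<odot>\<^bsub>residue_field\<^esub> x) \<otimes>\<^bsub>residue_field\<^esub> y = r \<odot>\<^bsub>residue_field\<^esub> (x \<otimes>\<^bsub>residue_field\<^esub> y)"
      unfolding residue_field_def algebra_via_simps mult_ring_on by (rule mult.assoc)
  qed
qed


lemma set_u_zero_B:
  fixes b :: "('p, 'k::comm_ring_1) tree_poly"
  assumes "b \<in> carrier B_ring"
  shows "set_u_zero b = Const (poly_eval (\<lambda>c. c) (\<lambda>_. 0) b)"
proof -
  interpret id: coefficient_hom "\<lambda>c :: 'k. c" by unfold_locales simp_all
  show ?thesis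
    using assms unfolding B_ring_def carrier_poly_ring
  proof (induction b rule: mspan_induct)
    case zero
    show ?case by (simp add: set_u_zero_0 poly_eval_def)
  next
    case (add f g)
    then show ?case by (simp only: set_u_zero_add id.poly_eval_add Const_add)
  next
    case (smult c f)
    then show ?case
      by (simp only: set_u_zero_mult set_u_zero_Const id.poly_eval_mult id.poly_eval_Const Const_mult)
  next
    case (mon \<mu>)
    show ?case
    proof (cases "\<mu> = 0")
      case True
      have "mon 0 = (Const 1 :: ('p, 'k) tree_poly)" by (simp add: Const_def)
      then show ?thesis unfolding True by (simp only: set_u_zero_Const id.poly_eval_Const)
    next
      case False
      then obtain v where v: "v \<in> keys \<mu>" by (metis all_not_in_conv keys_eq_empty)
      then have vx: "v \<notin> x_vars" using mon by (auto simp: u_vars_def x_vars_def)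
      have "(0 :: 'k) ^ lookup \<mu> v = 0" using v by (simp add: in_keys_iff zero_power)
      then have "(\<Prod>v\<in>keys \<mu>. (0 :: 'k) ^ lookup \<mu> v) = 0"
        by (intro prod_zero bexI[OF _ v]) auto
      then have "poly_eval (\<lambda>c. c) (\<lambda>_. 0 :: 'k) (mon \<mu>) = 0"
        unfolding id.poly_eval_eq_linext id.linext_mon .
      then show ?thesis using v vx by (auto simp: set_u_zero_mon)
    qed
  qed
qed

text \<open>
  Every element of the tensor product has the form $\psi(f) = [f] \otimes 1$, since constants can be moved to the
  left, and \<open>\<psi>\<close> is compatible with the operations. The isomorphism sends $\psi(f)$ to the class of \<open>f\<close> with
  the \<open>u\<close>-variables set to zero. It is well defined by the universal property. For injectivity, the
  polynomials \<open>f\<close> with $\psi(f) = 0$ form an ideal \<open>K\<close>. It contains all multiples of \<open>u\<close>-variables, since these can be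
  moved to the right, where they act as zero, and hence also $p_1q_2$, which is congruent to $T(p)S_p(q)$. So it
  contains \<open>f\<close> as soon as setting the \<open>u\<close>-variables to zero gives an element of $L(2,P)$.
\<close>

theorem special_fibre:
  "\<exists>\<phi> \<in> ring_iso (tensor_product (B_ring :: ('p, 'k::comm_ring_1) tree_poly ring) deformation residue_field)
      (xring Quot L_ideal).
    \<forall>f \<in> carrier pring. \<forall>c.
      \<phi> (pure_tensor B_ring deformation residue_field (Jcos f) c) = Lcos (Const c * set_u_zero f)"
proof -
  let ?B = "B_ring :: ('p, 'k) tree_poly ring"
  let ?M = "deformation :: (('p, 'k) tree_poly, ('p, 'k) tree_poly set) module"
  let ?k = "residue_field :: (('p, 'k) tree_poly, 'k) module"
  let ?TP = "tensor_product ?B ?M ?k"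
  let ?Q = "xring Quot (L_ideal :: ('p, 'k) tree_poly set)"
  interpret P: algebra_pair ?B ?M ?k by (rule algebra_pair_special_fibre)
  interpret Q: cring ?Q by (rule ideal.quotient_is_cring[OF ideal_L_ideal cring_poly_ring])
  interpret id: coefficient_hom "\<lambda>c :: 'k. c" by unfold_locales simp_all
  note L = mem_poly_ideal[OF ideal_L_ideal] and J = mem_poly_ideal[OF ideal_J_ideal]
  have M: "carrier ?M = {Jcos f | f. f \<in> carrier pring}"
    unfolding deformation_def algebra_via_simps carrier_poly_quotient ..
  have M_add: "Jcos f \<oplus>\<^bsub>?M\<^esub> Jcos g = Jcos (f + g)" and M_mult: "Jcos f \<otimes>\<^bsub>?M\<^esub> Jcos g = Jcos (f * g)"
    if "f \<in> carrier pring" "g \<in> carrier pring" for f g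
    unfolding deformation_def algebra_via_simps using poly_quotient_simps[OF ideal_J_ideal that] by auto
  have M_smult: "b \<odot>\<^bsub>?M\<^esub> Jcos f = Jcos (b * f)" if "b \<in> carrier ?B" "f \<in> carrier pring" for b f
    unfolding deformation_def algebra_via_simps
    using poly_quotient_simps(2)[OF ideal_J_ideal B_carrier[OF that(1)] that(2)] .
  have M_zero: "\<zero>\<^bsub>?M\<^esub> = Jcos 0"
  proof -
    have "J_ideal = Jcos (0 :: ('p, 'k) tree_poly)" by (auto simp: mem_coset_poly_ring)
    then show ?thesis unfolding deformation_def algebra_via_simps by (simp only: FactRing_def ring.simps)
  qed
  have M_one: "\<one>\<^bsub>?M\<^esub> = Jcos 1"
    unfolding deformation_def algebra_via_simps by (simp add: FactRing_def poly_ring_simps)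
  have k: "carrier ?k = UNIV" "a \<oplus>\<^bsub>?k\<^esub> b = a + b" "a \<otimes>\<^bsub>?k\<^esub> b = a * b" "\<zero>\<^bsub>?k\<^esub> = 0" "\<one>\<^bsub>?k\<^esub> = 1"
    "r \<odot>\<^bsub>?k\<^esub> a = poly_eval (\<lambda>c. c) (\<lambda>_. 0) r * a" for a b r
    unfolding residue_field_def algebra_via_simps by (simp_all add: ring_on_def)
  have cos_M: "Jcos f \<in> carrier ?M" if "f \<in> carrier pring" for f using that M by blast
  have p_add: "f + g \<in> carrier pring" "f - g \<in> carrier pring"
    if "f \<in> carrier pring" "g \<in> carrier pring" for f g :: "('p, 'k) tree_poly"
    using that unfolding carrier_poly_ring by (simp_all add: mspan_add mspan_diff)
  have p_0: "0 \<in> carrier (pring :: ('p, 'k) tree_poly ring)" by (simp add: carrier_poly_ring)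
  have Const_B: "Const c \<in> carrier ?B" for c unfolding B_ring_def by (rule poly_ring_Const)
  have Const_p: "Const c * f \<in> carrier pring" if "f \<in> carrier pring" for c and f :: "('p, 'k) tree_poly"
    by (intro poly_ring_mult_closed poly_ring_Const that)
  define \<psi> where "\<psi> f = P.cls (frag_of (Jcos f, 1))" for f
  have \<psi>_frag: "frag_of (Jcos f, c) \<in> P.frags" if "f \<in> carrier pring" for f c
    using cos_M[OF that] by (simp add: k keys_frag_of)
  have pure: "P.cls (frag_of (Jcos f, c)) = \<psi> (Const c * f)" if f: "f \<in> carrier pring" for f c
  proof -
    have "frag_of (Const c \<odot>\<^bsub>?M\<^esub> Jcos f, 1) - frag_of (Jcos f, Const c \<odot>\<^bsub>?k\<^esub> 1) \<in> P.rel"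
      by (rule P.rel_smult[OF Const_B cos_M[OF f]]) (simp add: k)
    then have "P.cls (frag_of (Jcos (Const c * f), 1)) = P.cls (frag_of (Jcos f, c))"
      by (intro P.cls_eqI) (simp add: M_smult[OF Const_B f] k id.poly_eval_Const)
    then show ?thesis by (simp add: \<psi>_def)
  qed
  have \<psi>_add: "\<psi> f \<oplus>\<^bsub>?TP\<^esub> \<psi> g = \<psi> (f + g)" if fg: "f \<in> carrier pring" "g \<in> carrier pring" for f g
  proof -
    have "frag_of (Jcos (f + g), 1) - frag_of (Jcos f, 1) - frag_of (Jcos g, 1) \<in> P.rel"
      using P.rel_add_left[OF cos_M[OF fg(1)] cos_M[OF fg(2)], of 1] by (simp add: k M_add[OF fg])
    then have "P.cls (frag_of (Jcos (f + g), 1)) = P.cls (frag_of (Jcos f, 1) + frag_of (Jcos g, 1))"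
      by (intro P.cls_eqI) (simp add: algebra_simps)
    then show ?thesis by (simp add: \<psi>_def P.add_tensor_product)
  qed
  have \<psi>_mult: "\<psi> f \<otimes>\<^bsub>?TP\<^esub> \<psi> g = \<psi> (f * g)" if fg: "f \<in> carrier pring" "g \<in> carrier pring" for f g
    unfolding \<psi>_def P.mult_tensor_product[OF \<psi>_frag[OF fg(1)] \<psi>_frag[OF fg(2)]] P.frag_mult_of
    by (simp add: M_mult[OF fg] k)
  have \<psi>_0: "\<psi> 0 = P.cls 0"
    unfolding \<psi>_def using P.rel_zero_left[of 1] by (intro P.cls_eqI) (simp add: M_zero k)
  have carrier: "carrier ?TP = \<psi> ` carrier pring"
  proof (intro equalityI subsetI)
    fix X assume "X \<in> carrier ?TP"
    then obtain t where t: "X = P.cls t" "t \<in> P.frags" unfolding P.carrier_tensor_product by blast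
    have "keys t \<subseteq> carrier ?M \<times> carrier ?k" using t(2) by simp
    then have "\<exists>f\<in>carrier pring. P.cls t = \<psi> f"
    proof (induction t rule: frag_induction)
      case zero
      show ?case using \<psi>_0 p_0 by metis
    next
      case (one z)
      then obtain f c where "z = (Jcos f, c)" "f \<in> carrier pring" unfolding M by blast
      then show ?case using pure Const_p by metis
    next
      case (diff s t)
      then obtain f g where fg: "f \<in> carrier pring" "g \<in> carrier pring" "P.cls s = \<psi> f" "P.cls t = \<psi> g" by blast
      have "\<psi> (f - g) \<oplus>\<^bsub>?TP\<^esub> \<psi> g = \<psi> f" using \<psi>_add[OF p_add(2)[OF fg(1,2)] fg(2)] by simp
      then have "P.cls (frag_of (Jcos (f - g), 1) + t) = P.cls s"
        unfolding fg(3) fg(4)[symmetric] by (simp add: \<psi>_def P.add_tensor_product)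
      then have "- (frag_of (Jcos (f - g), 1) + t - s) \<in> P.rel"
        unfolding P.cls_eq_iff by (rule P.rel_uminus)
      then have "P.cls (s - t) = \<psi> (f - g)"
        unfolding \<psi>_def by (intro P.cls_eqI) (simp add: algebra_simps)
      then show ?case using p_add(2)[OF fg(1,2)] by blast
    qed
    then show "X \<in> \<psi> ` carrier pring" using t(1) by blast
  next
    fix X assume "X \<in> \<psi> ` carrier pring"
    then show "X \<in> carrier ?TP" unfolding P.carrier_tensor_product \<psi>_def using \<psi>_frag by blast
  qed
  define K where "K = {f \<in> carrier pring. \<psi> f = \<psi> 0}"
  have K_0: "0 \<in> K" using p_0 by (simp add: K_def)
  have K_add: "f + g \<in> K" if "f \<in> K" "g \<in> K" for f g
  proof -
    have "\<psi> (f + g) = \<psi> 0 \<oplus>\<^bsub>?TP\<^esub> \<psi> 0" using that \<psi>_add[of f g] by (simp add: K_def)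
    then show ?thesis using that p_add \<psi>_add[OF p_0 p_0] by (simp add: K_def)
  qed
  have K_mult: "r * f \<in> K" if "r \<in> carrier pring" "f \<in> K" for r f
  proof -
    have "\<psi> (r * f) = \<psi> r \<otimes>\<^bsub>?TP\<^esub> \<psi> 0" using that \<psi>_mult[of r f] by (simp add: K_def)
    moreover have "r * f \<in> carrier pring"
      by (rule poly_ring_mult_closed[OF that(1)]) (use that(2) in \<open>simp add: K_def\<close>)
    ultimately show ?thesis using \<psi>_mult[OF that(1) p_0] by (simp add: K_def)
  qed
  have K_u: "f \<in> K" if "f \<in> mspan u_multiples" for f
    using that
  proof (induction f rule: mspan_induct)
    case (smult c f)
    then show ?case by (intro K_mult poly_ring_Const)
  next
    case (mon \<mu>)
    then obtain v where v: "v \<in> keys \<mu>" "u_weight v \<noteq> 0"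
      using weight_eq_0_iff[of u_weight \<mu>] by (auto simp: u_positive_def)
    then have vu: "v \<in> u_vars" using mon by (auto simp: x_vars_def)
    define \<nu> where "\<nu> = \<mu> - Poly_Mapping.single v 1"
    have "\<mu> = Poly_Mapping.single v 1 + \<nu>" unfolding \<nu>_def
      using v(1) by (intro poly_mapping_eqI) (auto simp: lookup_add lookup_minus lookup_single when_def in_keys_iff)
    then have eq: "mon \<mu> = Var v * (mon \<nu> :: ('p, 'k) tree_poly)" by (simp add: mon_add Var_eq_mon)
    have "keys \<nu> \<subseteq> keys \<mu>" by (auto simp: \<nu>_def in_keys_iff lookup_minus)
    then have \<nu>: "mon \<nu> \<in> carrier (pring :: ('p, 'k) tree_poly ring)"
      unfolding carrier_poly_ring using mon by (intro mspan_single) blast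
    have vB: "Var v \<in> carrier ?B" unfolding B_ring_def using vu by (rule poly_ring_Var)
    have "frag_of (Var v \<odot>\<^bsub>?M\<^esub> Jcos (mon \<nu>), 1) - frag_of (Jcos (mon \<nu>), Var v \<odot>\<^bsub>?k\<^esub> 1) \<in> P.rel"
      by (rule P.rel_smult[OF vB cos_M[OF \<nu>]]) (simp add: k)
    moreover have "frag_of (Jcos (mon \<nu>), Var v \<odot>\<^bsub>?k\<^esub> 1) \<in> P.rel"
      using P.rel_zero_right[OF cos_M[OF \<nu>]] by (simp add: k id.poly_eval_Var)
    ultimately have "frag_of (Jcos (mon \<mu>), 1) \<in> P.rel"
      using P.rel_add by (fastforce simp: M_smult[OF vB \<nu>] eq)
    then have "\<psi> (mon \<mu>) = \<psi> 0" unfolding \<psi>_0 unfolding \<psi>_def by (intro P.cls_eqI) simp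
    moreover have "mon \<mu> \<in> carrier (pring :: ('p, 'k) tree_poly ring)"
      unfolding carrier_poly_ring using mon by (intro mspan_single) simp
    ultimately show ?case by (simp add: K_def)
  qed (auto intro: K_0 K_add)
  have K_L: "(L_ideal :: ('p, 'k) tree_poly set) \<subseteq> K"
  proof -
    have "ideal (K \<inter> carrier xring) (xring :: ('p, 'k) tree_poly ring)"
    proof (rule ideal_poly_ring)
      show "0 \<in> K \<inter> carrier xring" using K_0 by (simp add: carrier_poly_ring)
      fix f g assume "f \<in> K \<inter> carrier xring" "g \<in> K \<inter> carrier xring"
      then show "f + g \<in> K \<inter> carrier xring" using K_add by (simp add: carrier_poly_ring mspan_add)
    next
      fix r f :: "('p, 'k) tree_poly" assume "r \<in> carrier xring" "f \<in> K \<inter> carrier xring"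
      then show "r * f \<in> K \<inter> carrier xring" using K_mult xring_subset poly_ring_mult_closed by blast
    qed blast
    moreover have "{Var (X1 p) * Var (X2 q) | p q. p \<le> q} \<subseteq> K \<inter> carrier xring"
    proof
      fix f :: "('p, 'k) tree_poly" assume "f \<in> {Var (X1 p) * Var (X2 q) | p q. p \<le> q}"
      then obtain p q where f: "f = Var (X1 p) * Var (X2 q)" "p \<le> q" by blast
      have "Jcos (gen p q :: ('p, 'k) tree_poly) = Jcos 0"
        using gen_J_ideal[OF f(2)] by (simp add: coset_poly_ring_eq_iff[OF ideal_J_ideal])
      then have "(gen p q :: ('p, 'k) tree_poly) \<in> K" using gen_carrier[OF f(2)] by (simp add: K_def \<psi>_def)
      moreover have "T p * S p q \<in> K"
      proof (rule K_u)
        have "T p * S p q \<in> (mspan u_positive :: ('p, 'k) tree_poly set)"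
          by (rule ideal_set.mult_right[OF ideal_u_positive T_u_positive])
        moreover have "T p * S p q \<in> carrier (pring :: ('p, 'k) tree_poly ring)"
          by (intro poly_ring_mult_closed T_carrier S_carrier f(2))
        ultimately show "T p * S p q \<in> (mspan u_multiples :: ('p, 'k) tree_poly set)"
          unfolding carrier_poly_ring mspan_def by blast
      qed
      ultimately have "gen p q + T p * S p q \<in> K" by (rule K_add)
      then show "f \<in> K \<inter> carrier xring" using lead_carrier by (simp add: f(1) gen_def)
    qed
    ultimately have "Idl\<^bsub>xring\<^esub> {Var (X1 p) * Var (X2 q) | p q. p \<le> q} \<subseteq> K \<inter> carrier xring"
      by (rule ring.genideal_minimal[OF cring.axioms(1)[OF cring_poly_ring]])
    then show ?thesis unfolding L_ideal_eq by blast
  qed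
  have \<psi>_eqI: "\<psi> f = \<psi> g" if fg: "f \<in> carrier pring" "g \<in> carrier pring" and "set_u_zero (f - g) \<in> L_ideal" for f g
  proof -
    have "set_u_zero (f - g) + (f - g - set_u_zero (f - g)) \<in> K"
      using that(3) K_L K_u[OF diff_set_u_zero[OF p_add(2)[OF fg]]] by (intro K_add) auto
    then have "\<psi> (f - g) = \<psi> 0" by (simp add: K_def)
    then show ?thesis using \<psi>_add[OF p_add(2)[OF fg] fg(2)] \<psi>_add[OF p_0 fg(2)] by simp
  qed
  \<comment> \<open>For the map in the other direction, a class is sent to the value at an arbitrary representative.\<close>
  define \<tau> where "\<tau> y = Lcos (set_u_zero (SOME f. f \<in> carrier pring \<and> y = Jcos f))"
    for y :: "('p, 'k) tree_poly set"
  have Lcos_closed: "Lcos (set_u_zero f) \<in> carrier ?Q" for f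
    unfolding carrier_poly_quotient using set_u_zero_closed by blast
  have Lcos_Const: "Const c * set_u_zero f \<in> carrier xring" for c and f :: "('p, 'k) tree_poly"
    by (intro poly_ring_mult_closed poly_ring_Const set_u_zero_closed)
  have \<tau>: "\<tau> (Jcos f) = Lcos (set_u_zero f)" if "f \<in> carrier pring" for f
  proof -
    define g where "g = (SOME g. g \<in> carrier pring \<and> Jcos f = Jcos g)"
    have "g \<in> carrier pring \<and> Jcos f = Jcos g"
      unfolding g_def by (rule someI[of _ f]) (use that in simp)
    then have "g - f \<in> J_ideal" using coset_poly_ring_eq_iff[OF ideal_J_ideal, of g f] by simp
    then have "set_u_zero g - set_u_zero f \<in> L_ideal"
      using set_u_zero_J_ideal by (simp flip: set_u_zero_diff)
    then show ?thesis unfolding \<tau>_def g_def[symmetric] by (simp add: coset_poly_ring_eq_iff[OF ideal_L_ideal])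
  qed
  define F where "F y c = Lcos (Const c) \<otimes>\<^bsub>?Q\<^esub> \<tau> y" for y and c :: 'k
  have F: "F (Jcos f) c = Lcos (Const c * set_u_zero f)" if "f \<in> carrier pring" for f c
    unfolding F_def \<tau>[OF that]
    by (rule poly_quotient_simps(2)[OF ideal_L_ideal poly_ring_Const set_u_zero_closed])
  obtain h where h: "group_hom (tensor_free ?M ?k) (add_monoid ?Q) h"
    and h_F: "\<And>y c. y \<in> carrier ?M \<Longrightarrow> c \<in> carrier ?k \<Longrightarrow> h (frag_of (y, c)) = F y c"
    and h_rel: "\<And>t. t \<in> P.rel \<Longrightarrow> h t = \<one>\<^bsub>add_monoid ?Q\<^esub>"
  proof (rule P.balanced_map_extends[where f = F and G = "add_monoid ?Q"])
    show "comm_group (add_monoid ?Q)" by (rule Q.a_comm_group)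
  next
    fix y c assume "y \<in> carrier ?M"
    then obtain f where f: "y = Jcos f" "f \<in> carrier pring" unfolding M by blast
    have "Lcos (Const c * set_u_zero f) \<in> carrier ?Q"
      unfolding carrier_poly_quotient using Lcos_Const[of c f] by blast
    then show "F y c \<in> carrier (add_monoid ?Q)" unfolding f(1) F[OF f(2)] by simp
  next
    fix y y' c assume "y \<in> carrier ?M" "y' \<in> carrier ?M"
    then obtain f g where f: "y = Jcos f" "f \<in> carrier pring" "y' = Jcos g" "g \<in> carrier pring" unfolding M by blast
    show "F (y \<oplus>\<^bsub>?M\<^esub> y') c = F y c \<otimes>\<^bsub>add_monoid ?Q\<^esub> F y' c"
      using poly_quotient_simps(1)[OF ideal_L_ideal Lcos_Const[of c f] Lcos_Const[of c g]]
      unfolding f(1,3) M_add[OF f(2,4)] F[OF f(2)] F[OF f(4)] F[OF p_add(1)[OF f(2,4)]]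
      by (simp add: set_u_zero_add distrib_left)
  next
    fix y c d assume "y \<in> carrier ?M"
    then obtain f where f: "y = Jcos f" "f \<in> carrier pring" unfolding M by blast
    show "F y (c \<oplus>\<^bsub>?k\<^esub> d) = F y c \<otimes>\<^bsub>add_monoid ?Q\<^esub> F y d"
      using poly_quotient_simps(1)[OF ideal_L_ideal Lcos_Const[of c f] Lcos_Const[of d f]]
      unfolding f(1) F[OF f(2)] by (simp add: k Const_add distrib_right)
  next
    fix b y c assume b: "b \<in> carrier ?B" and "y \<in> carrier ?M"
    then obtain f where f: "y = Jcos f" "f \<in> carrier pring" unfolding M by blast
    from set_u_zero_B[OF b]
    show "F (b \<odot>\<^bsub>?M\<^esub> y) c = F y (b \<odot>\<^bsub>?k\<^esub> c)"
      unfolding f(1) M_smult[OF b f(2)] F[OF f(2)] F[OF poly_ring_mult_closed[OF B_carrier[OF b] f(2)]]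
      by (simp add: k set_u_zero_mult Const_mult algebra_simps)
  qed blast
  interpret h: group_hom "tensor_free ?M ?k" "add_monoid ?Q" h by (rule h)
  have \<psi>_eqD: "Lcos (set_u_zero f) = Lcos (set_u_zero g)"
    if fg: "f \<in> carrier pring" "g \<in> carrier pring" and eq: "\<psi> f = \<psi> g" for f g
  proof -
    let ?s = "frag_of (Jcos f, 1 :: 'k)" and ?t = "frag_of (Jcos g, 1 :: 'k)"
    have rel: "?s - ?t \<in> P.rel" using eq by (simp add: \<psi>_def P.cls_eq_iff)
    have "h ((?s - ?t) \<otimes>\<^bsub>tensor_free ?M ?k\<^esub> ?t) = h (?s - ?t) \<otimes>\<^bsub>add_monoid ?Q\<^esub> h ?t"
      using P.rel_subset[OF rel] \<psi>_frag[OF fg(2)] by (intro h.hom_mult) (simp_all only: P.carrier_tensor_free)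
    then have "h ?s = h ?t"
      using h_rel[OF rel] h.hom_closed[of ?t] \<psi>_frag[OF fg(2), of 1]
      by (simp add: P.mult_tensor_free P.carrier_tensor_free)
    then show ?thesis using h_F[OF cos_M[OF fg(1)], of 1] h_F[OF cos_M[OF fg(2)], of 1] F[OF fg(1), of 1] F[OF fg(2), of 1]
      by (simp add: k)
  qed
  define \<phi> where "\<phi> X = Lcos (set_u_zero (SOME f. f \<in> carrier pring \<and> X = \<psi> f))" for X
  have \<phi>: "\<phi> (\<psi> f) = Lcos (set_u_zero f)" if f: "f \<in> carrier pring" for f
  proof -
    define g where "g = (SOME g. g \<in> carrier pring \<and> \<psi> f = \<psi> g)"
    have "g \<in> carrier pring \<and> \<psi> f = \<psi> g"
      unfolding g_def by (rule someI[of _ f]) (use f in simp)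
    then show ?thesis unfolding \<phi>_def g_def[symmetric] using \<psi>_eqD f by metis
  qed
  have p_1: "1 \<in> carrier (pring :: ('p, 'k) tree_poly ring)" by (rule poly_ring_1)
  have "\<phi> \<in> Ring.ring_hom ?TP ?Q"
  proof (rule ring_hom_memI)
    fix X Y assume "X \<in> carrier ?TP"
    then obtain f where f: "f \<in> carrier pring" "X = \<psi> f" unfolding carrier by blast
    show "\<phi> X \<in> carrier ?Q" unfolding f(2) \<phi>[OF f(1)] by (rule Lcos_closed)
    assume "Y \<in> carrier ?TP"
    then obtain g where g: "g \<in> carrier pring" "Y = \<psi> g" unfolding carrier by blast
    show "\<phi> (X \<otimes>\<^bsub>?TP\<^esub> Y) = \<phi> X \<otimes>\<^bsub>?Q\<^esub> \<phi> Y"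
      unfolding f(2) g(2) \<psi>_mult[OF f(1) g(1)] \<phi>[OF poly_ring_mult_closed[OF f(1) g(1)]] \<phi>[OF f(1)] \<phi>[OF g(1)]
        set_u_zero_mult by (rule poly_quotient_simps(2)[OF ideal_L_ideal set_u_zero_closed set_u_zero_closed, symmetric])
    show "\<phi> (X \<oplus>\<^bsub>?TP\<^esub> Y) = \<phi> X \<oplus>\<^bsub>?Q\<^esub> \<phi> Y"
      unfolding f(2) g(2) \<psi>_add[OF f(1) g(1)] \<phi>[OF p_add(1)[OF f(1) g(1)]] \<phi>[OF f(1)] \<phi>[OF g(1)]
        set_u_zero_add by (rule poly_quotient_simps(1)[OF ideal_L_ideal set_u_zero_closed set_u_zero_closed, symmetric])
  next
    have "\<one>\<^bsub>?TP\<^esub> = \<psi> 1" by (simp add: tensor_product_def pure_tensor_def \<psi>_def M_one k)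
    moreover have "\<one>\<^bsub>?Q\<^esub> = Lcos 1" by (simp add: FactRing_def poly_ring_simps)
    moreover have "set_u_zero (1 :: ('p, 'k) tree_poly) = 1" using set_u_zero_Const[of 1] by simp
    ultimately show "\<phi> \<one>\<^bsub>?TP\<^esub> = \<one>\<^bsub>?Q\<^esub>" using \<phi>[OF p_1] by simp
  qed
  moreover have "inj_on \<phi> (carrier ?TP)"
  proof (rule inj_onI)
    fix X Y assume "X \<in> carrier ?TP" "Y \<in> carrier ?TP" and eq: "\<phi> X = \<phi> Y"
    then obtain f g where f: "f \<in> carrier pring" "X = \<psi> f" and g: "g \<in> carrier pring" "Y = \<psi> g"
      unfolding carrier by blast
    have "set_u_zero (f - g) \<in> L_ideal"
      using eq unfolding f(2) g(2) \<phi>[OF f(1)] \<phi>[OF g(1)] coset_poly_ring_eq_iff[OF ideal_L_ideal] set_u_zero_diff .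
    then show "X = Y" unfolding f(2) g(2) by (rule \<psi>_eqI[OF f(1) g(1)])
  qed
  moreover have "\<phi> ` carrier ?TP = carrier ?Q"
  proof
    show "\<phi> ` carrier ?TP \<subseteq> carrier ?Q" unfolding carrier using \<phi> Lcos_closed by auto
    show "carrier ?Q \<subseteq> \<phi> ` carrier ?TP"
    proof
      fix Z assume "Z \<in> carrier ?Q"
      then obtain f where f: "Z = Lcos f" "f \<in> carrier xring" unfolding carrier_poly_quotient by blast
      have "Z = \<phi> (\<psi> f)" unfolding \<phi>[OF xring_subset[OF f(2)]] set_u_zero_xring[OF f(2)] by (rule f(1))
      then show "Z \<in> \<phi> ` carrier ?TP" unfolding carrier using xring_subset[OF f(2)] by blast
    qed
  qed
  ultimately have "\<phi> \<in> ring_iso ?TP ?Q" unfolding ring_iso_def bij_betw_def by blast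
  moreover have "\<phi> (pure_tensor ?B ?M ?k (Jcos f) c) = Lcos (Const c * set_u_zero f)" if f: "f \<in> carrier pring" for f c
    unfolding pure_tensor_def pure[OF f] \<phi>[OF Const_p[OF f]] set_u_zero_mult set_u_zero_Const ..
  ultimately show ?thesis by blast
qed

end

section \<open>Flat deformation\<close>

theorem theorem7p6:
  fixes \<rho> :: "'p::{finite, order}" and ch :: "'p \<Rightarrow> 'p list"
  assumes "rooted_tree \<rho> ch"
  shows "flat_module TYPE('a) TYPE('b) (rooted_tree.B_ring \<rho>)
           (rooted_tree.deformation \<rho> ch
             :: (('p, 'k::field) tree_poly, ('p, 'k) tree_poly set) module)
    \<and> (\<exists>\<phi> \<in> ring_iso
            (tensor_product (rooted_tree.B_ring \<rho>)
              (rooted_tree.deformation \<rho> ch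
                :: (('p, 'k) tree_poly, ('p, 'k) tree_poly set) module)
              rooted_tree.residue_field)
            (poly_ring x_vars Quot L_ideal).
          \<forall>f \<in> carrier (poly_ring (rooted_tree.u_vars \<rho> \<union> x_vars)). \<forall>c.
            \<phi> (pure_tensor (rooted_tree.B_ring \<rho>) (rooted_tree.deformation \<rho> ch)
                 rooted_tree.residue_field
                 (rooted_tree.J_ideal \<rho> ch
                   +>\<^bsub>poly_ring (rooted_tree.u_vars \<rho> \<union> x_vars)\<^esub> f) c)
            = L_ideal +>\<^bsub>poly_ring x_vars\<^esub> (Const c * set_u_zero f))"
proof -
  interpret rooted_tree \<rho> ch by fact
  show ?thesis using deformation_flat special_fibre by blast
qed

end
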